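(* Let $G(r,1,n)$ be the imprimitive group with generating set $S=\{s_1,\dots,s_{n-1},t_1,\dots,t_n\}$. For two finite dimensional complex linear representations $\rho_1$ and $\rho_2$ of $G(r,1,n)$, the characteristic polynomials satisfy $d(S,\rho_1)=d(S,\rho_2)$ if and only if $\rho_1\cong\rho_2$ (equivalence of representations).
   Context: Let $r,n$ be positive integers. The imprimitive group $G(r,1,n)$ is the group with generators $s_1,\dots,s_{n-1},t_1,\dots,t_n$ and relations: (a) $s_is_j=s_js_i$ for $|i-j|>1$; (b) $s_is_{i+1}s_i=s_{i+1}s_is_{i+1}$ for $i\le n-2$; (c) $s_{n-1}t_ns_{n-1}t_n=t_ns_{n-1}t_ns_{n-1}$; (d) $s_it_n=t_ns_i$ for $i\le n-2$; (e) $s_i^2=1=t_j^r$ for $1\le i\le n-1$, $1\le j\le n$; (f) $t_i=s_i\cdots s_{n-1}t_ns_{n-1}\cdots s_i$ for $i\le n-1$. For a finite dimensional complex linear representation $\rho$ of $G(r,1,n)$, its characteristic polynomial is the polynomial in $x_0,x_1,\dots,x_{2n-1}$ given by $$d(S,\rho)=\det\Big(x_0I+\sum_{i=1}^{n-1}x_i\rho(s_i)+\sum_{i=1}^{n}x_{n-1+i}\rho(t_i)\Big).$$ Equality $d(S,\rho_1)=d(S,\rho_2)$ means equality of polynomials. *)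

theory Defs
  imports
    "Jordan_Normal_Form.Determinant"
    "HOL-Algebra.Group"
    "HOL-Library.Poly_Mapping"
    "HOL.Complex"
begin

section \<open>Groups given by generators and relations\<close>

text \<open>A letter \<open>(x, True)\<close> stands for the generator \<open>x\<close> and \<open>(x, False)\<close> for its inverse.
  A pair \<open>(u, v)\<close> of words in \<open>R\<close> is the relation \<open>u = v\<close>.\<close>

type_synonym 'a word = "('a \<times> bool) list"

definition words :: "'a set \<Rightarrow> 'a word set" where
  "words X = lists (X \<times> UNIV)"

inductive_set pres_rel :: "'a set \<Rightarrow> ('a word \<times> 'a word) set \<Rightarrow> ('a word \<times> 'a word) set"
  for X :: "'a set" and R :: "('a word \<times> 'a word) set" where
  pres_rel: "(u, v) \<in> R \<Longrightarrow> u \<in> words X \<Longrightarrow> v \<in> words X \<Longrightarrow> (u, v) \<in> pres_rel X R"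
| pres_cancel: "x \<in> X \<Longrightarrow> ([(x, b), (x, \<not> b)], []) \<in> pres_rel X R"
| pres_refl: "u \<in> words X \<Longrightarrow> (u, u) \<in> pres_rel X R"
| pres_sym: "(u, v) \<in> pres_rel X R \<Longrightarrow> (v, u) \<in> pres_rel X R"
| pres_trans: "(u, v) \<in> pres_rel X R \<Longrightarrow> (v, w) \<in> pres_rel X R \<Longrightarrow> (u, w) \<in> pres_rel X R"
| pres_append: "(u, v) \<in> pres_rel X R \<Longrightarrow> (u', v') \<in> pres_rel X R \<Longrightarrow> (u @ u', v @ v') \<in> pres_rel X R"

definition pres_class :: "'a set \<Rightarrow> ('a word \<times> 'a word) set \<Rightarrow> 'a word \<Rightarrow> 'a word set" where
  "pres_class X R w = pres_rel X R `` {w}"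

definition presented_group :: "'a set \<Rightarrow> ('a word \<times> 'a word) set \<Rightarrow> 'a word set monoid" where
  "presented_group X R =
     \<lparr>carrier = words X // pres_rel X R,
      mult = (\<lambda>A B. \<Union>a\<in>A. \<Union>b\<in>B. pres_class X R (a @ b)),
      one = pres_class X R []\<rparr>"

lemma pres_rel_words: "(u, v) \<in> pres_rel X R \<Longrightarrow> u \<in> words X \<and> v \<in> words X"
  by (induction rule: pres_rel.induct) (auto simp: words_def)

lemma equiv_pres_rel: "equiv (words X) (pres_rel X R)"
proof (rule equivI)
  show "pres_rel X R \<subseteq> words X \<times> words X"
    using pres_rel_words by fastforce
  show "refl_on (words X) (pres_rel X R)"
    by (auto simp: refl_on_def intro: pres_rel.pres_refl)
  show "sym (pres_rel X R)"
    by (auto simp: sym_def intro: pres_rel.pres_sym)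
  show "trans (pres_rel X R)"
    by (auto simp: trans_def intro: pres_rel.pres_trans)
qed

lemma pres_class_eq_iff:
  assumes "u \<in> words X" "v \<in> words X"
  shows "pres_class X R u = pres_class X R v \<longleftrightarrow> (u, v) \<in> pres_rel X R"
  unfolding pres_class_def using eq_equiv_class_iff[OF equiv_pres_rel] assms by metis

lemma carrier_presented_group: "carrier (presented_group X R) = pres_class X R ` words X"
  by (auto simp: presented_group_def pres_class_def quotient_def)

lemma one_presented_group: "\<one>\<^bsub>presented_group X R\<^esub> = pres_class X R []"
  by (simp add: presented_group_def)

lemma mult_presented_group:
  assumes "u \<in> words X" "v \<in> words X"
  shows "pres_class X R u \<otimes>\<^bsub>presented_group X R\<^esub> pres_class X R v = pres_class X R (u @ v)"
proof -
  have eq: "pres_class X R (a @ b) = pres_class X R (u @ v)"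
    if "a \<in> pres_class X R u" "b \<in> pres_class X R v" for a b
  proof -
    have "(u @ v, a @ b) \<in> pres_rel X R"
      using that by (auto simp: pres_class_def intro: pres_rel.pres_append)
    then show ?thesis
      unfolding pres_class_def using equiv_class_eq[OF equiv_pres_rel] by metis
  qed
  have u: "u \<in> pres_class X R u" and v: "v \<in> pres_class X R v"
    using assms by (auto simp: pres_class_def intro: pres_rel.pres_refl)
  have "(\<Union>a\<in>pres_class X R u. \<Union>b\<in>pres_class X R v. pres_class X R (a @ b)) =
      (\<Union>a\<in>pres_class X R u. \<Union>b\<in>pres_class X R v. pres_class X R (u @ v))"
    by (simp add: eq cong: SUP_cong)
  also have "\<dots> = pres_class X R (u @ v)"
    using u v by blast
  finally show ?thesis
    by (simp add: presented_group_def)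
qed

lemma word_inverse:
  assumes "w \<in> words X"
  shows "\<exists>w'\<in>words X. (w' @ w, []) \<in> pres_rel X R"
  using assms
proof (induction w)
  case Nil
  show ?case by (intro bexI[of _ "[]"]) (auto simp: words_def intro: pres_rel.pres_refl)
next
  case (Cons l w)
  obtain x b where l: "l = (x, b)" by (cases l)
  have x: "x \<in> X" and w: "w \<in> words X"
    using Cons.prems by (auto simp: words_def l)
  obtain w' where w': "w' \<in> words X" "(w' @ w, []) \<in> pres_rel X R"
    using Cons.IH w by blast
  have "([(x, \<not> b), (x, b)], []) \<in> pres_rel X R"
    using pres_rel.pres_cancel[OF x, of "\<not> b"] by simp
  then have "(w' @ ([(x, \<not> b), (x, b)] @ w), w' @ ([] @ w)) \<in> pres_rel X R"
    by (intro pres_rel.pres_append pres_rel.pres_refl w w')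
  then have "((w' @ [(x, \<not> b)]) @ l # w, []) \<in> pres_rel X R"
    using w'(2) pres_rel.pres_trans l by fastforce
  moreover have "w' @ [(x, \<not> b)] \<in> words X"
    using w'(1) x by (auto simp: words_def)
  ultimately show ?case by blast
qed

lemma group_presented_group: "group (presented_group X R)"
proof -
  have app: "u @ v \<in> words X" if "u \<in> words X" "v \<in> words X" for u v :: "'a word"
    using that by (auto simp: words_def)
  have nil: "[] \<in> words X" by (simp add: words_def)
  show ?thesis
  proof (rule groupI)
    fix a assume "a \<in> carrier (presented_group X R)"
    then obtain w where w: "w \<in> words X" "a = pres_class X R w"
      by (auto simp: carrier_presented_group)
    obtain w' where "w' \<in> words X" "(w' @ w, []) \<in> pres_rel X R"
      using word_inverse w(1) by blast
    then show "\<exists>b\<in>carrier (presented_group X R).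
        b \<otimes>\<^bsub>presented_group X R\<^esub> a = \<one>\<^bsub>presented_group X R\<^esub>"
      using w app nil
      by (intro bexI[of _ "pres_class X R w'"])
        (auto simp: carrier_presented_group one_presented_group mult_presented_group
          pres_class_eq_iff)
  qed (auto simp: carrier_presented_group one_presented_group mult_presented_group app nil
      intro!: imageI)
qed

section \<open>The imprimitive group \<open>G(r,1,n)\<close>\<close>

datatype gen = Gs nat | Gt nat

definition imprim_gens :: "nat \<Rightarrow> gen set" where
  "imprim_gens n = Gs ` {1..n-1} \<union> Gt ` {1..n}"

definition imprim_rels :: "nat \<Rightarrow> nat \<Rightarrow> (gen list \<times> gen list) set" where
  "imprim_rels r n =
     {([Gs i, Gs j], [Gs j, Gs i]) | i j.
        i \<in> {1..n-1} \<and> j \<in> {1..n-1} \<and> \<bar>int i - int j\<bar> > 1}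
   \<union> {([Gs i, Gs (i+1), Gs i], [Gs (i+1), Gs i, Gs (i+1)]) | i. 1 \<le> i \<and> i + 2 \<le> n}
   \<union> (if n \<ge> 2
      then {([Gs (n-1), Gt n, Gs (n-1), Gt n], [Gt n, Gs (n-1), Gt n, Gs (n-1)])} else {})
   \<union> {([Gs i, Gt n], [Gt n, Gs i]) | i. 1 \<le> i \<and> i + 2 \<le> n}
   \<union> {([Gs i, Gs i], []) | i. i \<in> {1..n-1}}
   \<union> {(replicate r (Gt j), []) | j. j \<in> {1..n}}
   \<union> {([Gt i], map Gs [i..<n] @ [Gt n] @ rev (map Gs [i..<n])) | i. i \<in> {1..n-1}}"

definition pos_word :: "gen list \<Rightarrow> gen word" where
  "pos_word w = map (\<lambda>x. (x, True)) w"

definition imprim_word_rels :: "nat \<Rightarrow> nat \<Rightarrow> (gen word \<times> gen word) set" where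
  "imprim_word_rels r n = map_prod pos_word pos_word ` imprim_rels r n"

definition imprim_group :: "nat \<Rightarrow> nat \<Rightarrow> gen word set monoid" where
  "imprim_group r n = presented_group (imprim_gens n) (imprim_word_rels r n)"

definition s_elt :: "nat \<Rightarrow> nat \<Rightarrow> nat \<Rightarrow> gen word set" where
  "s_elt r n i = pres_class (imprim_gens n) (imprim_word_rels r n) [(Gs i, True)]"

definition t_elt :: "nat \<Rightarrow> nat \<Rightarrow> nat \<Rightarrow> gen word set" where
  "t_elt r n i = pres_class (imprim_gens n) (imprim_word_rels r n) [(Gt i, True)]"

section \<open>Complex matrix representations\<close>

definition GL :: "nat \<Rightarrow> complex mat monoid" where
  "GL d = units_of (ring_mat TYPE(complex) d ())"

definition is_rep :: "('g, 'm) monoid_scheme \<Rightarrow> nat \<Rightarrow> ('g \<Rightarrow> complex mat) \<Rightarrow> bool" where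
  "is_rep H d \<rho> \<longleftrightarrow> \<rho> \<in> hom H (GL d)"

definition rep_equiv ::
  "('g, 'm) monoid_scheme \<Rightarrow> nat \<Rightarrow> ('g \<Rightarrow> complex mat) \<Rightarrow> nat \<Rightarrow> ('g \<Rightarrow> complex mat) \<Rightarrow> bool" where
  "rep_equiv H d\<^sub>1 \<rho>\<^sub>1 d\<^sub>2 \<rho>\<^sub>2 \<longleftrightarrow>
     d\<^sub>1 = d\<^sub>2 \<and> (\<exists>P\<in>carrier (GL d\<^sub>1). \<forall>g\<in>carrier H. P * \<rho>\<^sub>1 g = \<rho>\<^sub>2 g * P)"

section \<open>The characteristic polynomial\<close>

text \<open>Polynomials in variables \<open>x\<^sub>0, x\<^sub>1, \<dots>\<close> over the complex numbers are finitely supported maps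
  from monomials (finitely supported exponent maps) to coefficients, with the convolution product.\<close>

type_synonym cpoly = "(nat \<Rightarrow>\<^sub>0 nat) \<Rightarrow>\<^sub>0 complex"

definition poly_var :: "nat \<Rightarrow> cpoly" where
  "poly_var i = Poly_Mapping.single (Poly_Mapping.single i 1) 1"

definition poly_const :: "complex \<Rightarrow> cpoly" where
  "poly_const c = Poly_Mapping.single 0 c"

definition rep_pencil :: "nat \<Rightarrow> nat \<Rightarrow> nat \<Rightarrow> (gen word set \<Rightarrow> complex mat) \<Rightarrow> cpoly mat" where
  "rep_pencil r n d \<rho> = mat d d (\<lambda>jk.
       poly_var 0 * 1\<^sub>m d $$ jk
     + (\<Sum>i = 1..n-1. poly_var i * poly_const (\<rho> (s_elt r n i) $$ jk))
     + (\<Sum>i = 1..n. poly_var (n - 1 + i) * poly_const (\<rho> (t_elt r n i) $$ jk)))"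

definition rep_charpoly :: "nat \<Rightarrow> nat \<Rightarrow> nat \<Rightarrow> (gen word set \<Rightarrow> complex mat) \<Rightarrow> cpoly" where
  "rep_charpoly r n d \<rho> = det (rep_pencil r n d \<rho>)"

end

theory Submission
  imports
    Defs
    "Jordan_Normal_Form.Schur_Decomposition"
    "Jordan_Normal_Form.Column_Operations"
begin

text \<open>Specialising the variables turns the characteristic polynomial of \<open>\<rho>\<close> into
\<open>det (x + M)\<close> for an arbitrary complex combination \<open>M\<close> of the matrices of the generators.
Knowing this for all \<open>x\<close> means knowing the eigenvalues of \<open>M\<close>, hence the traces of the powers
\<open>M\<^sup>k\<close>. Expanding \<open>M\<^sup>k\<close> and separating monomials in the coefficients (by a Kronecker
substitution) yields, for every positive word \<open>w\<close> in the generators, the sum of the character of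
\<open>\<rho>\<close> over all rearrangements of \<open>w\<close> (\<open>character_sums_eq\<close>). For a general word this sum
mixes conjugacy classes and the character cannot be read off.

The special feature of \<open>G(r,1,n)\<close> with this large generating set is that every conjugacy class is
represented by a word for which no mixing occurs. These are the block words: products, over
consecutive intervals \<open>[a, b]\<close> that partition \<open>{1..n}\<close>, of \<open>t\<^sub>a\<^sup>c s\<^sub>a s\<^sub>a\<^sub>+\<^sub>1 \<dots> s\<^sub>b\<^sub>-\<^sub>1\<close>;
in the monomial model such a factor is a coloured cycle on the interval. In a block word each
\<open>s\<^sub>i\<close> occurs at most once, and two letters fail to commute only if they are neighbours in the path
\<open>t\<^sub>a, s\<^sub>a, s\<^sub>a\<^sub>+\<^sub>1, \<dots>, s\<^sub>b\<^sub>-\<^sub>1\<close> of their block. As for Coxeter elements of a tree, all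
rearrangements of such a word are then conjugate (\<open>class_function_content\<close>,
\<open>class_function_block_word\<close>), so the sum is a positive multiple of the value of the character.

That block words represent all classes (\<open>block_word_conjugate\<close>) is derived inside the presented
group. Let \<open>G\<^sub>m\<close> be generated by \<open>s\<^sub>1, \<dots>, s\<^sub>m\<^sub>-\<^sub>1, t\<^sub>1, \<dots>, t\<^sub>m\<close>. Then
\<open>G\<^sub>m\<^sub>+\<^sub>1\<close> is the union of \<open>G\<^sub>m t\<^sub>m\<^sub>+\<^sub>1\<^sup>c\<close> and the double coset
\<open>G\<^sub>m s\<^sub>m G\<^sub>m\<close> (\<open>standard_subgroup_double_coset\<close>). This decomposition also shows that the group
is finite.

It remains that complex representations of a finite group with equal characters are equivalent
(\<open>character_determines_rep\<close>). The proof is by induction on the dimension: equality of characters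
provides a nonzero intertwiner, its normal form exhibits a common piece of both representations,
Maschke's theorem splits this piece off, and the complements have equal characters and smaller
dimension. The converse implication is multiplicativity of the determinant
(\<open>rep_charpoly_eq_of_intertwiner\<close>).\<close>

section \<open>Traces, invertible matrices and the rank normal form\<close>

definition mtrace :: "complex mat \<Rightarrow> complex" where
  "mtrace A = (\<Sum>i<dim_row A. A $$ (i, i))"

lemma mat_mult_index:
  "A \<in> carrier_mat p q \<Longrightarrow> B \<in> carrier_mat q s \<Longrightarrow> i < p \<Longrightarrow> j < s \<Longrightarrow>
    (A * B) $$ (i, j) = (\<Sum>k<q. A $$ (i, k) * B $$ (k, j))"
  by (auto simp: scalar_prod_def atLeast0LessThan)

lemma mtrace_comm:
  assumes "A \<in> carrier_mat p q" "B \<in> carrier_mat q p"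
  shows "mtrace (A * B) = mtrace (B * A)"
proof -
  have "mtrace (A * B) = (\<Sum>i<p. \<Sum>k<q. A $$ (i, k) * B $$ (k, i))"
    using assms by (simp add: mtrace_def mat_mult_index del: index_mult_mat(1))
  also have "\<dots> = (\<Sum>k<q. \<Sum>i<p. B $$ (k, i) * A $$ (i, k))"
    by (subst sum.swap) (simp add: mult.commute)
  also have "\<dots> = mtrace (B * A)"
    using assms by (simp add: mtrace_def mat_mult_index del: index_mult_mat(1))
  finally show ?thesis .
qed

lemma mtrace_conj:
  assumes "A \<in> carrier_mat d d" "P \<in> carrier_mat d d" "Q \<in> carrier_mat d d" "Q * P = 1\<^sub>m d"
  shows "mtrace (P * A * Q) = mtrace A"
proof -
  have "mtrace (P * (A * Q)) = mtrace (A * Q * P)"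
    using assms by (intro mtrace_comm[of _ d d]) auto
  also have "A * Q * P = A" using assms by simp
  finally show ?thesis using assms by simp
qed

lemma mtrace_four_block:
  assumes "A \<in> carrier_mat p p" "D \<in> carrier_mat q q"
  shows "mtrace (four_block_mat A B C D) = mtrace A + mtrace D"
proof -
  have "mtrace (four_block_mat A B C D) = (\<Sum>i<p+q. four_block_mat A B C D $$ (i, i))"
    using assms by (simp add: mtrace_def)
  also have "\<dots> = (\<Sum>i<p. four_block_mat A B C D $$ (i, i)) +
      (\<Sum>i<q. four_block_mat A B C D $$ (p + i, p + i))"
    by (simp add: sum.nat_group[symmetric] lessThan_atLeast0 sum.atLeastLessThan_concat[symmetric, of 0 p "p+q"]
      sum.atLeastLessThan_shift_0[of _ p "p+q"] add.commute)
  also have "\<dots> = mtrace A + mtrace D"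
    using assms by (simp add: mtrace_def)
  finally show ?thesis .
qed

lemma mem_GL: "P \<in> carrier (GL d) \<longleftrightarrow> P \<in> carrier_mat d d \<and> det P \<noteq> 0"
proof
  assume P: "P \<in> carrier (GL d)"
  then have "P \<in> Units (ring_mat TYPE(complex) d ())" by (simp add: GL_def units_of_def)
  then show "P \<in> carrier_mat d d \<and> det P \<noteq> 0"
    using unit_imp_det_non_zero by (auto simp: Units_def ring_mat_def)
next
  assume "P \<in> carrier_mat d d \<and> det P \<noteq> 0"
  then show "P \<in> carrier (GL d)"
    using det_non_zero_imp_unit[of P d "()"] by (simp add: GL_def units_of_def)
qed

lemma GL_inverse:
  assumes "P \<in> carrier (GL d)"
  obtains Q where "Q \<in> carrier (GL d)" "P * Q = 1\<^sub>m d" "Q * P = 1\<^sub>m d"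
proof -
  from assms have "P \<in> Units (ring_mat TYPE(complex) d ())" by (simp add: GL_def units_of_def)
  then obtain Q where Q: "Q \<in> carrier_mat d d" "P * Q = 1\<^sub>m d" "Q * P = 1\<^sub>m d" and "P \<in> carrier_mat d d"
    by (auto simp: Units_def ring_mat_def)
  then have "Q \<in> Units (ring_mat TYPE(complex) d ())"
    by (auto simp: Units_def ring_mat_def)
  then show ?thesis using that Q by (simp add: GL_def units_of_def)
qed

lemma GL_of_right_inverse:
  assumes "P \<in> carrier_mat d d" "Q \<in> carrier_mat d d" "P * Q = 1\<^sub>m d"
  shows "P \<in> carrier (GL d)"
  using assms det_mult[of P d Q] by (auto simp: mem_GL)

lemma GL_mult: "P \<in> carrier (GL d) \<Longrightarrow> Q \<in> carrier (GL d) \<Longrightarrow> P * Q \<in> carrier (GL d)"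
  by (auto simp: mem_GL det_mult[of _ d])

lemma GL_one: "1\<^sub>m d \<in> carrier (GL d)"
  by (simp add: mem_GL)

lemma GL_carrier_mat: "P \<in> carrier (GL d) \<Longrightarrow> P \<in> carrier_mat d d"
  by (simp add: mem_GL)

lemma GL_four_block_lower:
  assumes "A \<in> carrier (GL p)" "D \<in> carrier (GL q)" "C \<in> carrier_mat q p"
  shows "four_block_mat A (0\<^sub>m p q) C D \<in> carrier (GL (p + q))"
  using assms det_four_block_mat_upper_right_zero[OF _ refl, of A p C q D] by (auto simp: mem_GL)

lemma GL_four_block_upper:
  assumes "A \<in> carrier (GL p)" "D \<in> carrier (GL q)" "B \<in> carrier_mat p q"
  shows "four_block_mat A B (0\<^sub>m q p) D \<in> carrier (GL (p + q))"
  using assms det_four_block_mat_lower_left_zero[of A p B q _ D] by (auto simp: mem_GL)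

lemma swaprows_GL: "i < d \<Longrightarrow> j < d \<Longrightarrow> swaprows_mat d i j \<in> carrier (GL d)"
  by (intro GL_of_right_inverse[of _ d "swaprows_mat d i j"]) (auto simp: swaprows_mat_inv)

text \<open>One step of two-sided Gaussian elimination: with the entry \<open>U\<close> inverse to the pivot block, the
lower triangular factor clears the first column, the upper triangular factor the first row.\<close>

lemma pivot_normal_form:
  assumes "T \<in> carrier_mat (Suc d) (Suc d)" "T $$ (0, 0) \<noteq> (0 :: complex)"
  shows "\<exists>A\<in>carrier (GL (Suc d)). \<exists>B\<in>carrier (GL (Suc d)). \<exists>D\<in>carrier_mat d d.
    A * T * B = four_block_mat (1\<^sub>m 1) (0\<^sub>m 1 d) (0\<^sub>m d 1) D"
proof -
  obtain T1 T2 T3 T4 where split: "split_block T 1 1 = (T1, T2, T3, T4)"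
    by (metis prod_cases4)
  note T = split_block[OF split, of d d]
  have d: "dim_row T = 1 + d" "dim_col T = 1 + d" using assms(1) by auto
  note T = T[OF d]
  define x where "x = T $$ (0, 0)"
  have T1: "T1 = mat 1 1 (\<lambda>_. x)"
    using split by (auto simp: split_block_def Let_def x_def intro!: eq_matI)
  define U where "U = mat 1 1 (\<lambda>_. inverse x)"
  have U: "U \<in> carrier_mat 1 1" by (simp add: U_def)
  have UT1: "U * T1 = 1\<^sub>m 1" and T1U: "T1 * U = 1\<^sub>m 1"
    using assms(2) by (auto simp: T1 U_def x_def scalar_prod_def intro!: eq_matI)
  let ?A = "four_block_mat U (0\<^sub>m 1 d) (- (T3 * U)) (1\<^sub>m d)"
  let ?B = "four_block_mat (1\<^sub>m 1) (- (U * T2)) (0\<^sub>m d 1) (1\<^sub>m d)"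
  have A: "?A \<in> carrier (GL (1 + d))"
    using U T T1U by (intro GL_four_block_lower GL_one GL_of_right_inverse[OF U T(1) UT1]) auto
  have B: "?B \<in> carrier (GL (1 + d))"
    using U T by (intro GL_four_block_upper GL_one) auto
  let ?D = "T4 - T3 * U * T2"
  have U2: "U * T2 \<in> carrier_mat 1 d" "T3 * U \<in> carrier_mat d 1" using U T by auto
  have "?A * T = four_block_mat (U * T1 + 0\<^sub>m 1 d * T3) (U * T2 + 0\<^sub>m 1 d * T4)
      (- (T3 * U) * T1 + 1\<^sub>m d * T3) (- (T3 * U) * T2 + 1\<^sub>m d * T4)"
    unfolding T(5) using U T(1-4) by (intro mult_four_block_mat) auto
  also have "- (T3 * U) * T1 + 1\<^sub>m d * T3 = 0\<^sub>m d 1"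
  proof -
    have "- (T3 * U) * T1 = - (T3 * (U * T1))" using U T(1-4) by simp
    also have "\<dots> = - T3" using T(3) by (simp add: UT1)
    finally show ?thesis using T(3) by simp
  qed
  also have "- (T3 * U) * T2 + 1\<^sub>m d * T4 = ?D"
    using U T(1-4) by (intro eq_matI) auto
  finally have AT: "?A * T = four_block_mat (1\<^sub>m 1) (U * T2) (0\<^sub>m d 1) ?D"
    using U T(1-4) by (simp add: UT1)
  have "?A * T * ?B = four_block_mat (1\<^sub>m 1 * 1\<^sub>m 1 + U * T2 * 0\<^sub>m d 1) (1\<^sub>m 1 * - (U * T2) + U * T2 * 1\<^sub>m d)
      (0\<^sub>m d 1 * 1\<^sub>m 1 + ?D * 0\<^sub>m d 1) (0\<^sub>m d 1 * - (U * T2) + ?D * 1\<^sub>m d)"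
    unfolding AT using U T(1-4) by (intro mult_four_block_mat) auto
  also have "\<dots> = four_block_mat (1\<^sub>m 1) (0\<^sub>m 1 d) (0\<^sub>m d 1) ?D"
  proof (intro cong_four_block_mat)
    show "1\<^sub>m 1 * 1\<^sub>m 1 + U * T2 * 0\<^sub>m d 1 = 1\<^sub>m 1"
      using right_mult_zero_mat[OF U2(1), of 1] by simp
    have "1\<^sub>m 1 * - X + X * 1\<^sub>m d = 0\<^sub>m 1 d" if "X \<in> carrier_mat 1 d" for X :: "complex mat"
      using that by simp
    from this[OF U2(1)] show "1\<^sub>m 1 * - (U * T2) + U * T2 * 1\<^sub>m d = 0\<^sub>m 1 d" .
    have D: "?D \<in> carrier_mat d d" using U T(1-4) by auto
    from right_mult_zero_mat[OF D, of 1]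
    show "0\<^sub>m d 1 * 1\<^sub>m 1 + ?D * 0\<^sub>m d 1 = 0\<^sub>m d 1" by simp
    have "0\<^sub>m d 1 * - (U * T2) = 0\<^sub>m d d"
      using U2 by (intro left_mult_zero_mat) auto
    then show "0\<^sub>m d 1 * - (U * T2) + ?D * 1\<^sub>m d = ?D"
      using right_mult_one_mat[OF D] left_add_zero_mat[OF D] by simp
  qed
  finally show ?thesis using A B U T(1-4) by (intro bexI[of _ ?A] bexI[of _ ?B] bexI[of _ ?D]) auto
qed

text \<open>Every nonzero entry can be moved to the corner by a row swap and a column swap; one elimination step
then reduces the size by one. Pivots are split off until the remaining block is zero.\<close>

lemma rank_normal_form:
  assumes "T \<in> carrier_mat d d"
  shows "\<exists>A\<in>carrier (GL d). \<exists>B\<in>carrier (GL d). \<exists>k m. d = k + m \<and>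
    A * T * B = four_block_mat (1\<^sub>m k) (0\<^sub>m k m) (0\<^sub>m m k) (0\<^sub>m m m :: complex mat)"
  using assms
proof (induction d arbitrary: T)
  case 0
  then show ?case
    by (intro bexI[of _ "1\<^sub>m 0"] GL_one exI[of _ 0]) (auto intro!: eq_matI)
next
  case (Suc d)
  show ?case
  proof (cases "T = 0\<^sub>m (Suc d) (Suc d)")
    case True
    then show ?thesis
      by (intro bexI[of _ "1\<^sub>m (Suc d)"] GL_one exI[of _ 0] exI[of _ "Suc d"]) (auto intro!: eq_matI)
  next
    case False
    then obtain i j where ij: "i < Suc d" "j < Suc d" "T $$ (i, j) \<noteq> 0"
      using Suc.prems by (metis carrier_matD eq_matI index_zero_mat)
    define S S' where "S = (swaprows_mat (Suc d) 0 i :: complex mat)"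
      and "S' = (swaprows_mat (Suc d) 0 j :: complex mat)"
    have S: "S \<in> carrier (GL (Suc d))" "S' \<in> carrier (GL (Suc d))"
      using ij by (auto simp: S_def S'_def intro!: swaprows_GL)
    have "S * T = swaprows 0 i T"
      unfolding S_def using Suc.prems ij by (intro swaprows_mat[symmetric]) auto
    moreover have "S * T * S' = swapcols 0 j (S * T)"
      unfolding S'_def using Suc.prems ij S GL_carrier_mat
      by (intro swapcols_mat[symmetric]) (auto simp: S_def)
    ultimately have "(S * T * S') $$ (0, 0) = T $$ (i, j)"
      using Suc.prems ij by (auto simp: mat_swapcols_def mat_swaprows_def)
    moreover have "S * T * S' \<in> carrier_mat (Suc d) (Suc d)"
      using S[THEN GL_carrier_mat] Suc.prems by auto
    ultimately obtain A B D where AB: "A \<in> carrier (GL (Suc d))" "B \<in> carrier (GL (Suc d))"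
      and D: "D \<in> carrier_mat d d"
      and eq: "A * (S * T * S') * B = four_block_mat (1\<^sub>m 1) (0\<^sub>m 1 d) (0\<^sub>m d 1) D"
      using pivot_normal_form[of "S * T * S'" d] ij(3) by metis
    obtain A' B' k m where AB': "A' \<in> carrier (GL d)" "B' \<in> carrier (GL d)" and d: "d = k + m"
      and eq': "A' * D * B' = four_block_mat (1\<^sub>m k) (0\<^sub>m k m) (0\<^sub>m m k) (0\<^sub>m m m)"
      using Suc.IH[OF D] by blast
    let ?A = "four_block_mat (1\<^sub>m 1) (0\<^sub>m 1 d) (0\<^sub>m d 1) A'"
    let ?B = "four_block_mat (1\<^sub>m 1) (0\<^sub>m 1 d) (0\<^sub>m d 1) B'"
    have AB'': "?A \<in> carrier (GL (Suc d))" "?B \<in> carrier (GL (Suc d))"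
      using GL_four_block_lower[OF GL_one AB'(1), of "0\<^sub>m d 1" 1]
        GL_four_block_lower[OF GL_one AB'(2), of "0\<^sub>m d 1" 1] by auto
    note c = AB[THEN GL_carrier_mat] AB'[THEN GL_carrier_mat] AB''[THEN GL_carrier_mat]
      S[THEN GL_carrier_mat] Suc.prems D
    have "(?A * A * S) * T * (S' * B * ?B) = ?A * (A * (S * T * S') * B) * ?B"
      using c by (simp add: assoc_mult_mat[of _ "Suc d" "Suc d" _ "Suc d" _ "Suc d"])
    also have "\<dots> = four_block_mat (1\<^sub>m 1) (0\<^sub>m 1 d) (0\<^sub>m d 1) (A' * D * B')"
    proof -
      have *: "four_block_mat (1\<^sub>m 1) (0\<^sub>m 1 d) (0\<^sub>m d 1) X * four_block_mat (1\<^sub>m 1) (0\<^sub>m 1 d) (0\<^sub>m d 1) Y =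
          four_block_mat (1\<^sub>m 1) (0\<^sub>m 1 d) (0\<^sub>m d 1) (X * Y)"
        if "X \<in> carrier_mat d d" "Y \<in> carrier_mat d d" for X Y :: "complex mat"
        using that by (subst mult_four_block_mat) auto
      show ?thesis unfolding eq *[OF c(3) D] using c by (intro *) auto
    qed
    also have "\<dots> = four_block_mat (1\<^sub>m (Suc k)) (0\<^sub>m (Suc k) m) (0\<^sub>m m (Suc k)) (0\<^sub>m m m)"
      unfolding eq' d by (rule eq_matI) auto
    finally show ?thesis
      using GL_mult[OF GL_mult[OF AB''(1) AB(1)] S(1)] GL_mult[OF GL_mult[OF S(2) AB(2)] AB''(2)] d
      by (intro bexI[of _ "?A * A * S"] bexI[of _ "S' * B * ?B"] exI[of _ "Suc k"] exI[of _ m]) auto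
  qed
qed

section \<open>Matrix representations of a group\<close>

text \<open>Only invertibility of the values has to be traded for the condition at the unit: an invertible
idempotent is the identity, and conversely \<open>\<rho> (g\<inverse>)\<close> inverts \<open>\<rho> g\<close>.\<close>

lemma is_rep_iff:
  assumes "group G"
  shows "is_rep G d \<rho> \<longleftrightarrow> (\<forall>g\<in>carrier G. \<rho> g \<in> carrier_mat d d) \<and>
    (\<forall>g\<in>carrier G. \<forall>h\<in>carrier G. \<rho> (g \<otimes>\<^bsub>G\<^esub> h) = \<rho> g * \<rho> h) \<and> \<rho> \<one>\<^bsub>G\<^esub> = 1\<^sub>m d"
    (is "?L \<longleftrightarrow> ?R")
proof -
  interpret group G by fact
  have mult: "A \<otimes>\<^bsub>GL d\<^esub> B = A * B" for A B by (simp add: GL_def units_of_def ring_mat_def)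
  show ?thesis
  proof
    assume ?L
    then have hom: "\<rho> \<in> hom G (GL d)" by (simp add: is_rep_def)
    have GL: "\<rho> g \<in> carrier (GL d)" if "g \<in> carrier G" for g
      using hom that by (auto simp: hom_def)
    then have c: "\<forall>g\<in>carrier G. \<rho> g \<in> carrier_mat d d" using GL_carrier_mat by blast
    have m: "\<forall>g\<in>carrier G. \<forall>h\<in>carrier G. \<rho> (g \<otimes>\<^bsub>G\<^esub> h) = \<rho> g * \<rho> h"
      using hom by (auto simp: hom_def mult)
    obtain Q where Q: "Q \<in> carrier (GL d)" "\<rho> \<one>\<^bsub>G\<^esub> * Q = 1\<^sub>m d"
      using GL_inverse[OF GL[of "\<one>\<^bsub>G\<^esub>"]] by auto
    have "\<rho> \<one>\<^bsub>G\<^esub> * (\<rho> \<one>\<^bsub>G\<^esub> * Q) = \<rho> \<one>\<^bsub>G\<^esub> * \<rho> \<one>\<^bsub>G\<^esub> * Q"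
      using c GL_carrier_mat[OF Q(1)] by (intro assoc_mult_mat[of _ d d _ d _ d, symmetric]) auto
    also have "\<rho> \<one>\<^bsub>G\<^esub> * \<rho> \<one>\<^bsub>G\<^esub> = \<rho> \<one>\<^bsub>G\<^esub>" using m by (metis one_closed l_one)
    finally have "\<rho> \<one>\<^bsub>G\<^esub> * 1\<^sub>m d = 1\<^sub>m d" by (simp add: Q(2))
    moreover have "\<rho> \<one>\<^bsub>G\<^esub> \<in> carrier_mat d d" using c by auto
    ultimately have "\<rho> \<one>\<^bsub>G\<^esub> = 1\<^sub>m d" by simp
    with c m show ?R by blast
  next
    assume R: ?R
    have "\<rho> g \<in> carrier (GL d)" if g: "g \<in> carrier G" for g
    proof (rule GL_of_right_inverse)
      show "\<rho> g * \<rho> (inv\<^bsub>G\<^esub> g) = 1\<^sub>m d" using R g by (metis inv_closed r_inv)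
    qed (use R g in auto)
    then show ?L using R by (auto simp: is_rep_def hom_def mult)
  qed
qed

lemma is_rep_conj:
  assumes G: "group G" and \<rho>: "is_rep G d \<rho>"
    and P: "P \<in> carrier (GL d)" and Q: "Q \<in> carrier_mat d d" and QP: "Q * P = 1\<^sub>m d"
  shows "is_rep G d (\<lambda>g. P * \<rho> g * Q)" "rep_equiv G d \<rho> d (\<lambda>g. P * \<rho> g * Q)"
proof -
  note P' = GL_carrier_mat[OF P]
  note R = \<rho>[unfolded is_rep_iff[OF G]]
  have PQ: "P * Q = 1\<^sub>m d" using mat_mult_left_right_inverse[OF Q P' QP] .
  have "P * (\<rho> g * \<rho> h) * Q = (P * \<rho> g * Q) * (P * \<rho> h * Q)"
    if "g \<in> carrier G" "h \<in> carrier G" for g h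
  proof -
    have c: "\<rho> g \<in> carrier_mat d d" "\<rho> h \<in> carrier_mat d d" using R that by auto
    have "(P * \<rho> g * Q) * (P * \<rho> h * Q) = P * \<rho> g * ((Q * P) * (\<rho> h * Q))"
      using c P' Q by (simp add: assoc_mult_mat[of _ d d _ d _ d] del: QP)
    then show ?thesis using c P' Q by (simp add: QP assoc_mult_mat[of _ d d _ d _ d])
  qed
  then show "is_rep G d (\<lambda>g. P * \<rho> g * Q)"
    unfolding is_rep_iff[OF G] using R P' Q PQ by auto
  have "P * \<rho> g = P * \<rho> g * Q * P" if "g \<in> carrier G" for g
  proof -
    have "\<rho> g \<in> carrier_mat d d" using R that by blast
    then show ?thesis using P' Q by (simp add: QP assoc_mult_mat[of _ d d _ d _ d])
  qed
  then show "rep_equiv G d \<rho> d (\<lambda>g. P * \<rho> g * Q)"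
    using P by (auto simp: rep_equiv_def)
qed

lemma rep_equiv_sym:
  assumes G: "group G" and \<rho>: "is_rep G d\<^sub>1 \<rho>\<^sub>1" "is_rep G d\<^sub>2 \<rho>\<^sub>2" and eq: "rep_equiv G d\<^sub>1 \<rho>\<^sub>1 d\<^sub>2 \<rho>\<^sub>2"
  shows "rep_equiv G d\<^sub>2 \<rho>\<^sub>2 d\<^sub>1 \<rho>\<^sub>1"
proof -
  obtain P where d: "d\<^sub>1 = d\<^sub>2" and P: "P \<in> carrier (GL d\<^sub>1)"
    and *: "\<And>g. g \<in> carrier G \<Longrightarrow> P * \<rho>\<^sub>1 g = \<rho>\<^sub>2 g * P"
    using eq by (auto simp: rep_equiv_def)
  obtain Q where Q: "Q \<in> carrier (GL d\<^sub>1)" "P * Q = 1\<^sub>m d\<^sub>1" "Q * P = 1\<^sub>m d\<^sub>1"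
    using GL_inverse[OF P] .
  have "Q * \<rho>\<^sub>2 g = \<rho>\<^sub>1 g * Q" if "g \<in> carrier G" for g
  proof -
    have c: "\<rho>\<^sub>1 g \<in> carrier_mat d\<^sub>1 d\<^sub>1" "\<rho>\<^sub>2 g \<in> carrier_mat d\<^sub>1 d\<^sub>1"
      "P \<in> carrier_mat d\<^sub>1 d\<^sub>1" "Q \<in> carrier_mat d\<^sub>1 d\<^sub>1"
      using \<rho> that P Q(1) d GL_carrier_mat by (auto simp: is_rep_iff[OF G])
    have "Q * \<rho>\<^sub>2 g = Q * \<rho>\<^sub>2 g * (P * Q)" using c by (simp add: Q(2))
    also have "\<dots> = Q * (\<rho>\<^sub>2 g * P) * Q"
      using c by (simp add: assoc_mult_mat[of _ d\<^sub>1 d\<^sub>1 _ d\<^sub>1 _ d\<^sub>1])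
    also have "\<dots> = (Q * P) * \<rho>\<^sub>1 g * Q"
      using c *[OF that, symmetric] by (simp add: assoc_mult_mat[of _ d\<^sub>1 d\<^sub>1 _ d\<^sub>1 _ d\<^sub>1])
    finally show ?thesis using c by (simp add: Q(3))
  qed
  then show ?thesis using Q d by (auto simp: rep_equiv_def)
qed

lemma rep_equiv_trans:
  assumes G: "group G" and \<rho>: "is_rep G d\<^sub>1 \<rho>\<^sub>1" "is_rep G d\<^sub>2 \<rho>\<^sub>2" "is_rep G d\<^sub>3 \<rho>\<^sub>3"
    and eq: "rep_equiv G d\<^sub>1 \<rho>\<^sub>1 d\<^sub>2 \<rho>\<^sub>2" "rep_equiv G d\<^sub>2 \<rho>\<^sub>2 d\<^sub>3 \<rho>\<^sub>3"
  shows "rep_equiv G d\<^sub>1 \<rho>\<^sub>1 d\<^sub>3 \<rho>\<^sub>3"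
proof -
  obtain P where d: "d\<^sub>1 = d\<^sub>2" and P: "P \<in> carrier (GL d\<^sub>1)"
    and *: "\<And>g. g \<in> carrier G \<Longrightarrow> P * \<rho>\<^sub>1 g = \<rho>\<^sub>2 g * P"
    using eq(1) by (auto simp: rep_equiv_def)
  obtain Q where d': "d\<^sub>3 = d\<^sub>2" and Q: "Q \<in> carrier (GL d\<^sub>1)"
    and **: "\<And>g. g \<in> carrier G \<Longrightarrow> Q * \<rho>\<^sub>2 g = \<rho>\<^sub>3 g * Q"
    using eq(2) d by (auto simp: rep_equiv_def)
  have "Q * P * \<rho>\<^sub>1 g = \<rho>\<^sub>3 g * (Q * P)" if "g \<in> carrier G" for g
  proof -
    have c: "\<rho>\<^sub>1 g \<in> carrier_mat d\<^sub>1 d\<^sub>1" "\<rho>\<^sub>2 g \<in> carrier_mat d\<^sub>1 d\<^sub>1" "\<rho>\<^sub>3 g \<in> carrier_mat d\<^sub>1 d\<^sub>1"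
      "P \<in> carrier_mat d\<^sub>1 d\<^sub>1" "Q \<in> carrier_mat d\<^sub>1 d\<^sub>1"
      using \<rho> that P Q d d' GL_carrier_mat by (auto simp: is_rep_iff[OF G])
    have "Q * P * \<rho>\<^sub>1 g = Q * (P * \<rho>\<^sub>1 g)" using c by simp
    also have "\<dots> = (Q * \<rho>\<^sub>2 g) * P" using c *[OF that] by simp
    also have "\<dots> = \<rho>\<^sub>3 g * (Q * P)" using c **[OF that] by simp
    finally show ?thesis .
  qed
  then show ?thesis using GL_mult[OF Q P] d d' by (auto simp: rep_equiv_def)
qed

section \<open>Averaging over a finite group\<close>

text \<open>Matrices of all sizes form one type, which therefore has no zero matrix that could serve as the
value of an empty sum. The dimensions are passed explicitly.\<close>

definition mat_sum :: "nat \<Rightarrow> nat \<Rightarrow> 'i set \<Rightarrow> ('i \<Rightarrow> complex mat) \<Rightarrow> complex mat" where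
  "mat_sum p q S F = mat p q (\<lambda>ij. \<Sum>h\<in>S. F h $$ ij)"

lemma mat_sum_carrier [simp]: "mat_sum p q S F \<in> carrier_mat p q"
  by (simp add: mat_sum_def)

lemma mat_sum_cong: "(\<And>h. h \<in> S \<Longrightarrow> F h = F' h) \<Longrightarrow> mat_sum p q S F = mat_sum p q S F'"
  unfolding mat_sum_def by (intro eq_matI) (auto intro!: sum.cong)

lemma mat_sum_reindex: "bij_betw f S S' \<Longrightarrow> mat_sum p q S' F = mat_sum p q S (\<lambda>h. F (f h))"
  unfolding mat_sum_def by (intro eq_matI) (auto intro!: sum.reindex_bij_betw[symmetric])

lemma mat_sum_mult_left:
  assumes "A \<in> carrier_mat n p" "\<And>h. h \<in> S \<Longrightarrow> F h \<in> carrier_mat p q"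
  shows "A * mat_sum p q S F = mat_sum n q S (\<lambda>h. A * F h)"
proof (rule eq_matI)
  fix i j assume "i < dim_row (mat_sum n q S (\<lambda>h. A * F h))" "j < dim_col (mat_sum n q S (\<lambda>h. A * F h))"
  then have ij: "i < n" "j < q" by (auto simp: mat_sum_def)
  have "(A * mat_sum p q S F) $$ (i, j) = (\<Sum>k<p. A $$ (i, k) * mat_sum p q S F $$ (k, j))"
    using assms(1) ij by (intro mat_mult_index) auto
  also have "\<dots> = (\<Sum>k<p. \<Sum>h\<in>S. A $$ (i, k) * F h $$ (k, j))"
    using ij by (simp add: mat_sum_def sum_distrib_left)
  also have "\<dots> = (\<Sum>h\<in>S. \<Sum>k<p. A $$ (i, k) * F h $$ (k, j))"
    by (rule sum.swap)
  also have "\<dots> = (\<Sum>h\<in>S. (A * F h) $$ (i, j))"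
    using assms ij by (intro sum.cong refl mat_mult_index[symmetric]) auto
  finally show "(A * mat_sum p q S F) $$ (i, j) = mat_sum n q S (\<lambda>h. A * F h) $$ (i, j)"
    using ij by (simp add: mat_sum_def)
qed (use assms in \<open>auto simp: mat_sum_def\<close>)

lemma mat_sum_mult_right:
  assumes "A \<in> carrier_mat q n" "\<And>h. h \<in> S \<Longrightarrow> F h \<in> carrier_mat p q"
  shows "mat_sum p q S F * A = mat_sum p n S (\<lambda>h. F h * A)"
proof (rule eq_matI)
  fix i j assume "i < dim_row (mat_sum p n S (\<lambda>h. F h * A))" "j < dim_col (mat_sum p n S (\<lambda>h. F h * A))"
  then have ij: "i < p" "j < n" by (auto simp: mat_sum_def)
  have "(mat_sum p q S F * A) $$ (i, j) = (\<Sum>k<q. mat_sum p q S F $$ (i, k) * A $$ (k, j))"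
    using assms(1) ij by (intro mat_mult_index) auto
  also have "\<dots> = (\<Sum>k<q. \<Sum>h\<in>S. F h $$ (i, k) * A $$ (k, j))"
    using ij by (simp add: mat_sum_def sum_distrib_right)
  also have "\<dots> = (\<Sum>h\<in>S. \<Sum>k<q. F h $$ (i, k) * A $$ (k, j))"
    by (rule sum.swap)
  also have "\<dots> = (\<Sum>h\<in>S. (F h * A) $$ (i, j))"
    using assms ij by (intro sum.cong refl mat_mult_index[symmetric]) auto
  finally show "(mat_sum p q S F * A) $$ (i, j) = mat_sum p n S (\<lambda>h. F h * A) $$ (i, j)"
    using ij by (simp add: mat_sum_def)
qed (use assms in \<open>auto simp: mat_sum_def\<close>)

lemma mat_sum_diff:
  assumes "\<And>h. h \<in> S \<Longrightarrow> F h \<in> carrier_mat p q" "\<And>h. h \<in> S \<Longrightarrow> F' h \<in> carrier_mat p q"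
  shows "mat_sum p q S (\<lambda>h. F h - F' h) = mat_sum p q S F - mat_sum p q S F'"
proof (rule eq_matI)
  fix i j assume "i < dim_row (mat_sum p q S F - mat_sum p q S F')" "j < dim_col (mat_sum p q S F - mat_sum p q S F')"
  then have ij: "i < p" "j < q" by (auto simp: mat_sum_def)
  have "(\<Sum>h\<in>S. (F h - F' h) $$ (i, j)) = (\<Sum>h\<in>S. F h $$ (i, j) - F' h $$ (i, j))"
    using assms ij by (intro sum.cong refl) (auto dest!: assms(2))
  then show "mat_sum p q S (\<lambda>h. F h - F' h) $$ (i, j) = (mat_sum p q S F - mat_sum p q S F') $$ (i, j)"
    using ij by (simp add: mat_sum_def sum_subtractf)
qed (auto simp: mat_sum_def)

lemma mat_sum_const:
  assumes "A \<in> carrier_mat p q"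
  shows "mat_sum p q S (\<lambda>_. A) = of_nat (card S) \<cdot>\<^sub>m A"
  using assms unfolding mat_sum_def by (intro eq_matI) auto

definition conj_transpose :: "complex mat \<Rightarrow> complex mat" where
  "conj_transpose A = mat (dim_col A) (dim_row A) (\<lambda>(i, j). cnj (A $$ (j, i)))"

lemma conj_transpose_carrier [simp]: "A \<in> carrier_mat p q \<Longrightarrow> conj_transpose A \<in> carrier_mat q p"
  by (auto simp: conj_transpose_def)

lemma conj_transpose_mult_self_carrier [simp]: "A \<in> carrier_mat p q \<Longrightarrow> conj_transpose A * A \<in> carrier_mat q q"
  by (rule mult_carrier_mat[of _ q p]) auto

lemma conj_transpose_index [simp]: "A \<in> carrier_mat p q \<Longrightarrow> i < q \<Longrightarrow> j < p \<Longrightarrow> conj_transpose A $$ (i, j) = cnj (A $$ (j, i))"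
  by (auto simp: conj_transpose_def)

lemma conj_transpose_mult:
  assumes "A \<in> carrier_mat p q" "B \<in> carrier_mat q s"
  shows "conj_transpose (A * B) = conj_transpose B * conj_transpose A"
proof (rule eq_matI)
  fix i j assume "i < dim_row (conj_transpose B * conj_transpose A)" "j < dim_col (conj_transpose B * conj_transpose A)"
  then have ij: "i < s" "j < p" using assms by (auto simp: conj_transpose_def)
  have "conj_transpose (A * B) $$ (i, j) = cnj ((A * B) $$ (j, i))"
    using assms ij by (intro conj_transpose_index[of _ p s]) auto
  also have "\<dots> = (\<Sum>k<q. conj_transpose B $$ (i, k) * conj_transpose A $$ (k, j))"
    using assms ij by (simp add: mat_mult_index mult.commute del: index_mult_mat(1))
  also have "\<dots> = (conj_transpose B * conj_transpose A) $$ (i, j)"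
    using assms ij by (intro mat_mult_index[symmetric]) auto
  finally show "conj_transpose (A * B) $$ (i, j) = (conj_transpose B * conj_transpose A) $$ (i, j)" .
qed (use assms in \<open>auto simp: conj_transpose_def\<close>)

lemma mtrace_conj_transpose: "A \<in> carrier_mat d d \<Longrightarrow> mtrace (conj_transpose A) = cnj (mtrace A)"
  by (auto simp: mtrace_def conj_transpose_def)

context group
begin

lemma bij_betw_mult_left: "g \<in> carrier G \<Longrightarrow> bij_betw (\<lambda>h. g \<otimes> h) (carrier G) (carrier G)"
  by (rule bij_betw_byWitness[where f' = "\<lambda>h. inv g \<otimes> h"]) (auto simp: m_assoc[symmetric])

lemma bij_betw_mult_right: "g \<in> carrier G \<Longrightarrow> bij_betw (\<lambda>h. h \<otimes> g) (carrier G) (carrier G)"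
  by (rule bij_betw_byWitness[where f' = "\<lambda>h. h \<otimes> inv g"]) (auto simp: m_assoc)

text \<open>Maschke's theorem in the form that the first cohomology vanishes: the average \<open>Y\<close> of
\<open>\<gamma> h \<beta> (h\<inverse>)\<close> exhibits \<open>\<gamma>\<close> as a coboundary, because applying \<open>\<alpha> g\<close> to one term of the sum
gives the term for \<open>g h\<close> times \<open>\<beta> g\<close>, minus \<open>\<gamma> g\<close>. Off-diagonal blocks of block triangular
representations are such cocycles, both below and above the diagonal.\<close>

lemma cocycle_trivial:
  assumes fin: "finite (carrier G)"
    and \<alpha>: "is_rep G p \<alpha>" and \<beta>: "is_rep G q \<beta>"
    and \<gamma>: "\<And>g. g \<in> carrier G \<Longrightarrow> \<gamma> g \<in> carrier_mat p q"
    and cocycle: "\<And>g h. g \<in> carrier G \<Longrightarrow> h \<in> carrier G \<Longrightarrow>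
      \<gamma> (g \<otimes> h) = \<alpha> g * \<gamma> h + \<gamma> g * \<beta> h"
  shows "\<exists>Y\<in>carrier_mat p q. \<forall>g\<in>carrier G. \<gamma> g + \<alpha> g * Y = Y * \<beta> g"
proof -
  note A = \<alpha>[unfolded is_rep_iff[OF is_group]] and B = \<beta>[unfolded is_rep_iff[OF is_group]]
  let ?S = "carrier G"
  define Z where "Z = mat_sum p q ?S (\<lambda>h. \<gamma> h * \<beta> (inv h))"
  define N where "N = (of_nat (card ?S) :: complex)"
  have N: "N \<noteq> 0" using fin one_closed by (auto simp: N_def)
  have \<gamma>\<beta>: "\<gamma> h * \<beta> (inv h) \<in> carrier_mat p q" if "h \<in> carrier G" for h
    using \<gamma> B that by (intro mult_carrier_mat[of _ p q]) auto
  have "\<alpha> g * Z = Z * \<beta> g - N \<cdot>\<^sub>m \<gamma> g" if g: "g \<in> carrier G" for g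
  proof -
    have gc: "\<gamma> g \<in> carrier_mat p q" "\<alpha> g \<in> carrier_mat p p" "\<beta> g \<in> carrier_mat q q" using \<gamma> A B g by auto
    have summand: "\<alpha> g * (\<gamma> h * \<beta> (inv h)) = \<gamma> (g \<otimes> h) * \<beta> (inv (g \<otimes> h)) * \<beta> g - \<gamma> g"
      if h: "h \<in> carrier G" for h
    proof -
      have hc: "\<gamma> h \<in> carrier_mat p q" "\<beta> h \<in> carrier_mat q q" "\<beta> (inv h) \<in> carrier_mat q q"
        "\<gamma> (g \<otimes> h) \<in> carrier_mat p q" "\<beta> (inv (g \<otimes> h)) \<in> carrier_mat q q"
        using \<gamma> B g h by auto
      have 1: "\<beta> (inv (g \<otimes> h)) * \<beta> g = \<beta> (inv h)"
        using B g h by (metis inv_closed inv_mult_group inv_solve_right' l_inv m_assoc m_closed r_one)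
      have 2: "\<beta> h * \<beta> (inv h) = 1\<^sub>m q" using B h by (metis inv_closed r_inv)
      have "\<gamma> (g \<otimes> h) * \<beta> (inv (g \<otimes> h)) * \<beta> g = (\<alpha> g * \<gamma> h + \<gamma> g * \<beta> h) * \<beta> (inv h)"
        using hc gc 1 cocycle[OF g h] by (simp add: assoc_mult_mat[of _ p q _ q _ q])
      also have "\<dots> = \<alpha> g * \<gamma> h * \<beta> (inv h) + \<gamma> g * \<beta> h * \<beta> (inv h)"
        using hc gc by (intro add_mult_distrib_mat) auto
      also have "\<gamma> g * \<beta> h * \<beta> (inv h) = \<gamma> g"
        using hc gc 2 by simp
      also have "\<alpha> g * \<gamma> h * \<beta> (inv h) = \<alpha> g * (\<gamma> h * \<beta> (inv h))"
        using hc gc by simp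
      finally have *: "\<gamma> (g \<otimes> h) * \<beta> (inv (g \<otimes> h)) * \<beta> g = \<alpha> g * (\<gamma> h * \<beta> (inv h)) + \<gamma> g" .
      show ?thesis unfolding * using hc gc by (intro eq_matI) auto
    qed
    have "\<alpha> g * Z = mat_sum p q ?S (\<lambda>h. \<alpha> g * (\<gamma> h * \<beta> (inv h)))"
      unfolding Z_def using gc \<gamma>\<beta> by (intro mat_sum_mult_left) auto
    also have "\<dots> = mat_sum p q ?S (\<lambda>h. \<gamma> (g \<otimes> h) * \<beta> (inv (g \<otimes> h)) * \<beta> g - \<gamma> g)"
      by (intro mat_sum_cong summand)
    also have "\<dots> = mat_sum p q ?S (\<lambda>h. \<gamma> (g \<otimes> h) * \<beta> (inv (g \<otimes> h)) * \<beta> g) - mat_sum p q ?S (\<lambda>h. \<gamma> g)"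
      using \<gamma> B g by (intro mat_sum_diff mult_carrier_mat[of _ p q]) auto
    also have "mat_sum p q ?S (\<lambda>h. \<gamma> (g \<otimes> h) * \<beta> (inv (g \<otimes> h)) * \<beta> g) =
        mat_sum p q ?S (\<lambda>h. \<gamma> h * \<beta> (inv h) * \<beta> g)"
      by (rule mat_sum_reindex[OF bij_betw_mult_left[OF g], symmetric])
    also have "\<dots> = Z * \<beta> g"
      unfolding Z_def using \<gamma>\<beta> gc by (intro mat_sum_mult_right[symmetric]) auto
    finally show ?thesis by (simp add: N_def mat_sum_const[OF gc(1)])
  qed
  note * = this
  define Y where "Y = inverse N \<cdot>\<^sub>m Z"
  have Z: "Z \<in> carrier_mat p q" by (simp add: Z_def)
  then have "Y \<in> carrier_mat p q" by (simp add: Y_def)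
  moreover have "\<gamma> g + \<alpha> g * Y = Y * \<beta> g" if g: "g \<in> carrier G" for g
  proof -
    have gc: "\<gamma> g \<in> carrier_mat p q" "\<alpha> g \<in> carrier_mat p p" "\<beta> g \<in> carrier_mat q q" using \<gamma> A B g by auto
    have 1: "\<alpha> g * Y = inverse N \<cdot>\<^sub>m (Z * \<beta> g - N \<cdot>\<^sub>m \<gamma> g)"
      unfolding Y_def using gc Z *[OF g] by (simp add: mult_smult_distrib[of _ p p])
    have 2: "Y * \<beta> g = inverse N \<cdot>\<^sub>m (Z * \<beta> g)"
      unfolding Y_def using gc Z by (simp add: mult_smult_assoc_mat[of _ p q])
    have gen: "X + inverse N \<cdot>\<^sub>m (W - N \<cdot>\<^sub>m X) = inverse N \<cdot>\<^sub>m W"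
      if "X \<in> carrier_mat p q" "W \<in> carrier_mat p q" for X W
      using that N by (intro eq_matI) (auto simp: right_diff_distrib mult.assoc[symmetric])
    have "Z * \<beta> g \<in> carrier_mat p q" using gc Z by auto
    then show ?thesis unfolding 1 2 by (rule gen[OF gc(1)])
  qed
  ultimately show ?thesis by blast
qed

text \<open>The averaged Hermitian form is positive definite: a vector in its kernel has \<open>\<rho> h v = 0\<close> for all
\<open>h\<close>, in particular for the unit.\<close>

lemma invariant_form_nonsingular:
  assumes fin: "finite (carrier G)" and \<rho>: "is_rep G d \<rho>"
  shows "mat_sum d d (carrier G) (\<lambda>h. conj_transpose (\<rho> h) * \<rho> h) \<in> carrier (GL d)" (is "?H \<in> _")
proof (rule ccontr)
  note R = \<rho>[unfolded is_rep_iff[OF is_group]]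
  assume "?H \<notin> carrier (GL d)"
  then have "det ?H = 0" by (simp add: mem_GL)
  then obtain v where v: "v \<in> carrier_vec d" "v \<noteq> 0\<^sub>v d" and Hv: "?H *\<^sub>v v = 0\<^sub>v d"
    using det_0_iff_vec_prod_zero[of ?H d] by auto
  define V where "V = mat d 1 (\<lambda>(i, _). v $ i)"
  have V: "V \<in> carrier_mat d 1" by (simp add: V_def)
  have HV: "?H * V = 0\<^sub>m d 1"
  proof (rule eq_matI)
    fix i j assume ij: "i < dim_row (0\<^sub>m d 1 :: complex mat)" "j < dim_col (0\<^sub>m d 1 :: complex mat)"
    have "col V 0 = v" using v(1) by (intro eq_vecI) (auto simp: V_def)
    moreover have "(?H *\<^sub>v v) $ i = 0" using Hv ij by simp
    ultimately show "(?H * V) $$ (i, j) = 0\<^sub>m d 1 $$ (i, j)"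
      using ij V by (auto simp: mat_sum_def)
  qed (auto simp: mat_sum_def V_def)
  have c: "\<rho> h \<in> carrier_mat d d" if "h \<in> carrier G" for h using R that by auto
  have c2: "conj_transpose (\<rho> h) * \<rho> h \<in> carrier_mat d d" if "h \<in> carrier G" for h
    using c[OF that] by simp
  have "mat_sum 1 1 (carrier G) (\<lambda>h. conj_transpose (\<rho> h * V) * (\<rho> h * V)) = conj_transpose V * (?H * V)"
  proof -
    have "?H * V = mat_sum d 1 (carrier G) (\<lambda>h. conj_transpose (\<rho> h) * \<rho> h * V)"
      using c2 V by (intro mat_sum_mult_right) auto
    moreover have "conj_transpose V * \<dots> = mat_sum 1 1 (carrier G) (\<lambda>h. conj_transpose V * (conj_transpose (\<rho> h) * \<rho> h * V))"
      by (intro mat_sum_mult_left mult_carrier_mat[OF c2 V] conj_transpose_carrier[OF V])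
    moreover have "conj_transpose (\<rho> h * V) * (\<rho> h * V) = conj_transpose V * (conj_transpose (\<rho> h) * \<rho> h * V)" if "h \<in> carrier G" for h
    proof -
      have "conj_transpose (\<rho> h * V) * (\<rho> h * V) = (conj_transpose V * conj_transpose (\<rho> h)) * (\<rho> h * V)"
        using c[OF that] V by (simp add: conj_transpose_mult)
      also have "\<dots> = conj_transpose V * (conj_transpose (\<rho> h) * (\<rho> h * V))"
        using c[OF that] V by (intro assoc_mult_mat[of _ 1 d _ d _ 1]) auto
      also have "conj_transpose (\<rho> h) * (\<rho> h * V) = conj_transpose (\<rho> h) * \<rho> h * V"
        using c[OF that] V by (intro assoc_mult_mat[of _ d d _ d _ 1, symmetric]) auto
      finally show ?thesis .
    qed
    ultimately show ?thesis by (simp cong: mat_sum_cong)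
  qed
  also have "\<dots> = 0\<^sub>m 1 1" unfolding HV using right_mult_zero_mat[OF conj_transpose_carrier[OF V], of 1] .
  finally have "mat_sum 1 1 (carrier G) (\<lambda>h. conj_transpose (\<rho> h * V) * (\<rho> h * V)) $$ (0, 0) = 0" by simp
  moreover have "(conj_transpose (\<rho> h * V) * (\<rho> h * V)) $$ (0, 0) = of_real (\<Sum>k<d. (cmod ((\<rho> h * V) $$ (k, 0)))\<^sup>2)"
    if h: "h \<in> carrier G" for h
  proof -
    have hV: "\<rho> h * V \<in> carrier_mat d 1" using c[OF h] V by auto
    have "(conj_transpose (\<rho> h * V) * (\<rho> h * V)) $$ (0, 0) = (\<Sum>k<d. conj_transpose (\<rho> h * V) $$ (0, k) * (\<rho> h * V) $$ (k, 0))"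
      by (rule mat_mult_index[OF conj_transpose_carrier[OF hV] hV]) auto
    also have "\<dots> = (\<Sum>k<d. of_real ((cmod ((\<rho> h * V) $$ (k, 0)))\<^sup>2))"
      by (intro sum.cong refl, subst conj_transpose_index[OF hV])
        (simp_all only: complex_norm_square mult.commute lessThan_iff zero_less_one)
    finally show ?thesis by simp
  qed
  ultimately have "of_real (\<Sum>h\<in>carrier G. \<Sum>k<d. (cmod ((\<rho> h * V) $$ (k, 0)))\<^sup>2) = (0 :: complex)"
    by (simp add: mat_sum_def)
  then have "(\<Sum>h\<in>carrier G. \<Sum>k<d. (cmod ((\<rho> h * V) $$ (k, 0)))\<^sup>2) = 0"
    by (simp only: of_real_eq_0_iff)
  then have "(\<Sum>k<d. (cmod ((\<rho> \<one> * V) $$ (k, 0)))\<^sup>2) = 0"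
    using fin by (subst (asm) sum_nonneg_eq_0_iff) (auto intro: sum_nonneg)
  then have "\<forall>k<d. (\<rho> \<one> * V) $$ (k, 0) = 0"
    by (subst (asm) sum_nonneg_eq_0_iff) auto
  moreover have "\<rho> \<one> * V = V" using R V by simp
  ultimately have "v = 0\<^sub>v d" using v(1) by (intro eq_vecI) (auto simp: V_def)
  with v(2) show False by simp
qed

text \<open>The invariant form \<open>H\<close> satisfies \<open>\<rho>(g)\<^sup>* H = H \<rho>(g\<inverse>)\<close>, so \<open>\<rho>(g\<inverse>)\<close> is similar to
the conjugate transpose of \<open>\<rho>(g)\<close>.\<close>

lemma character_inv:
  assumes fin: "finite (carrier G)" and \<rho>: "is_rep G d \<rho>" and g: "g \<in> carrier G"
  shows "mtrace (\<rho> (inv g)) = cnj (mtrace (\<rho> g))"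
proof -
  note R = \<rho>[unfolded is_rep_iff[OF is_group]]
  have c: "\<rho> h \<in> carrier_mat d d" if "h \<in> carrier G" for h using R that by auto
  have c2: "conj_transpose (\<rho> h) * \<rho> h \<in> carrier_mat d d" if "h \<in> carrier G" for h
    using c[OF that] by simp
  define H where "H = mat_sum d d (carrier G) (\<lambda>h. conj_transpose (\<rho> h) * \<rho> h)"
  have HGL: "H \<in> carrier (GL d)" unfolding H_def by (rule invariant_form_nonsingular[OF fin \<rho>])
  obtain K where K: "K \<in> carrier (GL d)" "H * K = 1\<^sub>m d" "K * H = 1\<^sub>m d" using GL_inverse[OF HGL] .
  note Hc = GL_carrier_mat[OF HGL] and Kc = GL_carrier_mat[OF K(1)]
  have "conj_transpose (\<rho> g) * H = mat_sum d d (carrier G) (\<lambda>h. conj_transpose (\<rho> g) * (conj_transpose (\<rho> h) * \<rho> h))"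
    unfolding H_def using c c2 g by (intro mat_sum_mult_left) auto
  also have "\<dots> = mat_sum d d (carrier G) (\<lambda>h. conj_transpose (\<rho> (h \<otimes> g)) * \<rho> (h \<otimes> g) * \<rho> (inv g))"
  proof (rule mat_sum_cong)
    fix h assume h: "h \<in> carrier G"
    have "conj_transpose (\<rho> (h \<otimes> g)) = conj_transpose (\<rho> g) * conj_transpose (\<rho> h)"
      using R g h by (simp add: conj_transpose_mult[of _ d d _ d])
    moreover have "\<rho> (h \<otimes> g) * \<rho> (inv g) = \<rho> h"
      using R g h by (metis inv_closed m_assoc m_closed r_inv r_one)
    moreover have "conj_transpose (\<rho> (h \<otimes> g)) * \<rho> (h \<otimes> g) * \<rho> (inv g) = conj_transpose (\<rho> (h \<otimes> g)) * (\<rho> (h \<otimes> g) * \<rho> (inv g))"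
      using g h by (intro assoc_mult_mat[of _ d d _ d _ d] conj_transpose_carrier c) auto
    moreover have "conj_transpose (\<rho> g) * conj_transpose (\<rho> h) * \<rho> h = conj_transpose (\<rho> g) * (conj_transpose (\<rho> h) * \<rho> h)"
      using g h by (intro assoc_mult_mat[of _ d d _ d _ d] conj_transpose_carrier c) auto
    ultimately show "conj_transpose (\<rho> g) * (conj_transpose (\<rho> h) * \<rho> h) = conj_transpose (\<rho> (h \<otimes> g)) * \<rho> (h \<otimes> g) * \<rho> (inv g)"
      by simp
  qed
  also have "\<dots> = mat_sum d d (carrier G) (\<lambda>h. conj_transpose (\<rho> h) * \<rho> h * \<rho> (inv g))"
    by (rule mat_sum_reindex[OF bij_betw_mult_right[OF g], symmetric])
  also have "\<dots> = H * \<rho> (inv g)"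
    unfolding H_def using c c2 g by (intro mat_sum_mult_right[symmetric]) auto
  finally have eq: "conj_transpose (\<rho> g) * H = H * \<rho> (inv g)" .
  have "cnj (mtrace (\<rho> g)) = mtrace (conj_transpose (\<rho> g))" using c[OF g] by (simp add: mtrace_conj_transpose)
  also have "\<dots> = mtrace (K * (conj_transpose (\<rho> g)) * H)"
  proof -
    have "mtrace (K * (conj_transpose (\<rho> g) * H)) = mtrace (conj_transpose (\<rho> g) * H * K)"
      using conj_transpose_carrier[OF c[OF g]] Hc Kc by (intro mtrace_comm[of _ d d]) auto
    also have "conj_transpose (\<rho> g) * H * K = conj_transpose (\<rho> g)"
      using conj_transpose_carrier[OF c[OF g]] Hc Kc by (simp add: K(2))
    finally show ?thesis using conj_transpose_carrier[OF c[OF g]] Hc Kc by simp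
  qed
  also have "K * (conj_transpose (\<rho> g)) * H = K * H * \<rho> (inv g)"
    using conj_transpose_carrier[OF c[OF g]] c[of "inv g"] Hc Kc g by (simp add: eq)
  also have "\<dots> = \<rho> (inv g)" using c[of "inv g"] g by (simp add: K(3))
  finally show ?thesis by simp
qed

end

section \<open>Characters determine representations\<close>

lemma four_block_mat_inject:
  assumes "four_block_mat A B C D = four_block_mat A' B' C' D'"
    and "A \<in> carrier_mat p q" "B \<in> carrier_mat p q'" "C \<in> carrier_mat p' q" "D \<in> carrier_mat p' q'"
    and "A' \<in> carrier_mat p q" "B' \<in> carrier_mat p q'" "C' \<in> carrier_mat p' q" "D' \<in> carrier_mat p' q'"
  shows "A = A'" "B = B'" "C = C'" "D = D'"
proof -
  have *: "four_block_mat A B C D $$ (i, j) = four_block_mat A' B' C' D' $$ (i, j)" for i j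
    using assms(1) by simp
  show "A = A'"
  proof (rule eq_matI)
    show "A $$ (i, j) = A' $$ (i, j)" if "i < dim_row A'" "j < dim_col A'" for i j
      using *[of i j] that assms(2-) by simp
  qed (use assms in auto)
  show "B = B'"
  proof (rule eq_matI)
    show "B $$ (i, j) = B' $$ (i, j)" if "i < dim_row B'" "j < dim_col B'" for i j
      using *[of i "q + j"] that assms(2-) by simp
  qed (use assms in auto)
  show "C = C'"
  proof (rule eq_matI)
    show "C $$ (i, j) = C' $$ (i, j)" if "i < dim_row C'" "j < dim_col C'" for i j
      using *[of "p + i" j] that assms(2-) by simp
  qed (use assms in auto)
  show "D = D'"
  proof (rule eq_matI)
    show "D $$ (i, j) = D' $$ (i, j)" if "i < dim_row D'" "j < dim_col D'" for i j
      using *[of "p + i" "q + j"] that assms(2-) by simp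
  qed (use assms in auto)
qed

lemma four_block_mult_lower:
  assumes "A \<in> carrier_mat p p" "C \<in> carrier_mat q p" "D \<in> carrier_mat q q"
    "A' \<in> carrier_mat p p" "C' \<in> carrier_mat q p" "D' \<in> carrier_mat q q"
  shows "four_block_mat A (0\<^sub>m p q) C D * four_block_mat A' (0\<^sub>m p q) C' D' =
    four_block_mat (A * A') (0\<^sub>m p q) (C * A' + D * C') (D * D')"
  using assms by (subst mult_four_block_mat[of _ p p _ q _ q]) (auto intro!: cong_four_block_mat)

lemma four_block_mult_upper:
  assumes "A \<in> carrier_mat p p" "B \<in> carrier_mat p q" "D \<in> carrier_mat q q"
    "A' \<in> carrier_mat p p" "B' \<in> carrier_mat p q" "D' \<in> carrier_mat q q"
  shows "four_block_mat A B (0\<^sub>m q p) D * four_block_mat A' B' (0\<^sub>m q p) D' =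
    four_block_mat (A * A') (A * B' + B * D') (0\<^sub>m q p) (D * D')"
  using assms by (subst mult_four_block_mat[of _ p p _ q _ q]) (auto intro!: cong_four_block_mat)

context group
begin

text \<open>The lower left block is a cocycle, so a unipotent block matrix conjugates it away.\<close>

lemma rep_equiv_lower_block:
  assumes fin: "finite (carrier G)"
    and \<rho>: "is_rep G (p + q) (\<lambda>g. four_block_mat (a g) (0\<^sub>m p q) (c g) (e g))"
    and a: "\<And>g. g \<in> carrier G \<Longrightarrow> a g \<in> carrier_mat p p"
    and c: "\<And>g. g \<in> carrier G \<Longrightarrow> c g \<in> carrier_mat q p"
    and e: "\<And>g. g \<in> carrier G \<Longrightarrow> e g \<in> carrier_mat q q"
  shows "is_rep G p a" "is_rep G q e"
    "rep_equiv G (p + q) (\<lambda>g. four_block_mat (a g) (0\<^sub>m p q) (0\<^sub>m q p) (e g))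
      (p + q) (\<lambda>g. four_block_mat (a g) (0\<^sub>m p q) (c g) (e g))"
proof -
  note R = \<rho>[unfolded is_rep_iff[OF is_group]]
  have mult: "a (g \<otimes> h) = a g * a h" "c (g \<otimes> h) = c g * a h + e g * c h" "e (g \<otimes> h) = e g * e h"
    if gh: "g \<in> carrier G" "h \<in> carrier G" for g h
  proof -
    have "four_block_mat (a (g \<otimes> h)) (0\<^sub>m p q) (c (g \<otimes> h)) (e (g \<otimes> h)) =
        four_block_mat (a g) (0\<^sub>m p q) (c g) (e g) * four_block_mat (a h) (0\<^sub>m p q) (c h) (e h)"
      using R gh by blast
    also have "\<dots> = four_block_mat (a g * a h) (0\<^sub>m p q) (c g * a h + e g * c h) (e g * e h)"
      using a c e gh by (intro four_block_mult_lower) auto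
    finally have eq: "four_block_mat (a (g \<otimes> h)) (0\<^sub>m p q) (c (g \<otimes> h)) (e (g \<otimes> h)) =
        four_block_mat (a g * a h) (0\<^sub>m p q) (c g * a h + e g * c h) (e g * e h)" .
    have ghc: "g \<otimes> h \<in> carrier G" using gh by simp
    have car: "a g * a h \<in> carrier_mat p p" "c g * a h + e g * c h \<in> carrier_mat q p" "e g * e h \<in> carrier_mat q q"
      using a[OF gh(1)] a[OF gh(2)] c[OF gh(1)] c[OF gh(2)] e[OF gh(1)] e[OF gh(2)] by auto
    show "a (g \<otimes> h) = a g * a h" "c (g \<otimes> h) = c g * a h + e g * c h" "e (g \<otimes> h) = e g * e h"
      by (rule four_block_mat_inject[OF eq a[OF ghc] zero_carrier_mat c[OF ghc] e[OF ghc]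
          car(1) zero_carrier_mat car(2,3)])+
  qed
  have one: "a \<one> = 1\<^sub>m p" "e \<one> = 1\<^sub>m q"
  proof -
    have eq: "four_block_mat (a \<one>) (0\<^sub>m p q) (c \<one>) (e \<one>) =
        four_block_mat (1\<^sub>m p) (0\<^sub>m p q) (0\<^sub>m q p) (1\<^sub>m q)" using R by simp
    show "a \<one> = 1\<^sub>m p" "e \<one> = 1\<^sub>m q"
      by (rule four_block_mat_inject[OF eq a[OF one_closed] zero_carrier_mat c[OF one_closed] e[OF one_closed]
          one_carrier_mat zero_carrier_mat zero_carrier_mat one_carrier_mat])+
  qed
  show rep: "is_rep G p a" "is_rep G q e"
    using a e mult one by (auto simp: is_rep_iff[OF is_group])
  have cocycle: "c (g \<otimes> h) = e g * c h + c g * a h" if "g \<in> carrier G" "h \<in> carrier G" for g h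
    unfolding mult(2)[OF that]
    by (rule comm_add_mat[OF mult_carrier_mat[OF c[OF that(1)] a[OF that(2)]]
          mult_carrier_mat[OF e[OF that(1)] c[OF that(2)]]])
  obtain Y where Y: "Y \<in> carrier_mat q p" "\<And>g. g \<in> carrier G \<Longrightarrow> c g + e g * Y = Y * a g"
    using cocycle_trivial[OF fin rep(2,1), of c] c cocycle by blast
  let ?P = "four_block_mat (1\<^sub>m p) (0\<^sub>m p q) Y (1\<^sub>m q)"
  have P: "?P \<in> carrier (GL (p + q))" using Y by (intro GL_four_block_lower GL_one)
  have "?P * four_block_mat (a g) (0\<^sub>m p q) (0\<^sub>m q p) (e g) = four_block_mat (a g) (0\<^sub>m p q) (c g) (e g) * ?P"
    if g: "g \<in> carrier G" for g
  proof -
    have "?P * four_block_mat (a g) (0\<^sub>m p q) (0\<^sub>m q p) (e g) = four_block_mat (a g) (0\<^sub>m p q) (Y * a g) (e g)"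
      using a[OF g] e[OF g] Y(1) by (subst four_block_mult_lower) (auto intro!: cong_four_block_mat)
    also have "\<dots> = four_block_mat (a g) (0\<^sub>m p q) (c g) (e g) * ?P"
      using a[OF g] e[OF g] c[OF g] Y(1) Y(2)[OF g]
      by (subst four_block_mult_lower) (auto intro!: cong_four_block_mat)
    finally show ?thesis .
  qed
  then show "rep_equiv G (p + q) (\<lambda>g. four_block_mat (a g) (0\<^sub>m p q) (0\<^sub>m q p) (e g))
      (p + q) (\<lambda>g. four_block_mat (a g) (0\<^sub>m p q) (c g) (e g))"
    using P by (auto simp: rep_equiv_def)
qed

lemma rep_equiv_upper_block:
  assumes fin: "finite (carrier G)"
    and \<rho>: "is_rep G (p + q) (\<lambda>g. four_block_mat (a g) (b g) (0\<^sub>m q p) (e g))"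
    and a: "\<And>g. g \<in> carrier G \<Longrightarrow> a g \<in> carrier_mat p p"
    and b: "\<And>g. g \<in> carrier G \<Longrightarrow> b g \<in> carrier_mat p q"
    and e: "\<And>g. g \<in> carrier G \<Longrightarrow> e g \<in> carrier_mat q q"
  shows "is_rep G p a" "is_rep G q e"
    "rep_equiv G (p + q) (\<lambda>g. four_block_mat (a g) (0\<^sub>m p q) (0\<^sub>m q p) (e g))
      (p + q) (\<lambda>g. four_block_mat (a g) (b g) (0\<^sub>m q p) (e g))"
proof -
  note R = \<rho>[unfolded is_rep_iff[OF is_group]]
  have mult: "a (g \<otimes> h) = a g * a h" "b (g \<otimes> h) = a g * b h + b g * e h" "e (g \<otimes> h) = e g * e h"
    if gh: "g \<in> carrier G" "h \<in> carrier G" for g h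
  proof -
    have "four_block_mat (a (g \<otimes> h)) (b (g \<otimes> h)) (0\<^sub>m q p) (e (g \<otimes> h)) =
        four_block_mat (a g) (b g) (0\<^sub>m q p) (e g) * four_block_mat (a h) (b h) (0\<^sub>m q p) (e h)"
      using R gh by blast
    also have "\<dots> = four_block_mat (a g * a h) (a g * b h + b g * e h) (0\<^sub>m q p) (e g * e h)"
      using a b e gh by (intro four_block_mult_upper) auto
    finally have eq: "four_block_mat (a (g \<otimes> h)) (b (g \<otimes> h)) (0\<^sub>m q p) (e (g \<otimes> h)) =
        four_block_mat (a g * a h) (a g * b h + b g * e h) (0\<^sub>m q p) (e g * e h)" .
    have ghc: "g \<otimes> h \<in> carrier G" using gh by simp
    have car: "a g * a h \<in> carrier_mat p p" "a g * b h + b g * e h \<in> carrier_mat p q" "e g * e h \<in> carrier_mat q q"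
      using a[OF gh(1)] a[OF gh(2)] b[OF gh(1)] b[OF gh(2)] e[OF gh(1)] e[OF gh(2)] by auto
    show "a (g \<otimes> h) = a g * a h" "b (g \<otimes> h) = a g * b h + b g * e h" "e (g \<otimes> h) = e g * e h"
      by (rule four_block_mat_inject[OF eq a[OF ghc] b[OF ghc] zero_carrier_mat e[OF ghc]
          car(1,2) zero_carrier_mat car(3)])+
  qed
  have one: "a \<one> = 1\<^sub>m p" "e \<one> = 1\<^sub>m q"
  proof -
    have eq: "four_block_mat (a \<one>) (b \<one>) (0\<^sub>m q p) (e \<one>) =
        four_block_mat (1\<^sub>m p) (0\<^sub>m p q) (0\<^sub>m q p) (1\<^sub>m q)" using R by simp
    show "a \<one> = 1\<^sub>m p" "e \<one> = 1\<^sub>m q"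
      by (rule four_block_mat_inject[OF eq a[OF one_closed] b[OF one_closed] zero_carrier_mat e[OF one_closed]
          one_carrier_mat zero_carrier_mat zero_carrier_mat one_carrier_mat])+
  qed
  show rep: "is_rep G p a" "is_rep G q e"
    using a e mult one by (auto simp: is_rep_iff[OF is_group])
  obtain Y where Y: "Y \<in> carrier_mat p q" "\<And>g. g \<in> carrier G \<Longrightarrow> b g + a g * Y = Y * e g"
    using cocycle_trivial[OF fin rep(1,2), of b] b mult by blast
  have Y': "a g * Y + b g = Y * e g" if "g \<in> carrier G" for g
    using Y(2)[OF that] comm_add_mat[OF b[OF that], of "a g * Y"] a[OF that] Y(1) by simp
  let ?P = "four_block_mat (1\<^sub>m p) Y (0\<^sub>m q p) (1\<^sub>m q)"
  have P: "?P \<in> carrier (GL (p + q))" using Y by (intro GL_four_block_upper GL_one)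
  have "?P * four_block_mat (a g) (0\<^sub>m p q) (0\<^sub>m q p) (e g) = four_block_mat (a g) (b g) (0\<^sub>m q p) (e g) * ?P"
    if g: "g \<in> carrier G" for g
  proof -
    have "?P * four_block_mat (a g) (0\<^sub>m p q) (0\<^sub>m q p) (e g) = four_block_mat (a g) (Y * e g) (0\<^sub>m q p) (e g)"
      using a[OF g] e[OF g] Y(1) by (subst four_block_mult_upper) (auto intro!: cong_four_block_mat)
    also have "\<dots> = four_block_mat (a g) (b g) (0\<^sub>m q p) (e g) * ?P"
      using a[OF g] e[OF g] b[OF g] Y(1) Y'[OF g]
      by (subst four_block_mult_upper) (auto intro!: cong_four_block_mat)
    finally show ?thesis .
  qed
  then show "rep_equiv G (p + q) (\<lambda>g. four_block_mat (a g) (0\<^sub>m p q) (0\<^sub>m q p) (e g))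
      (p + q) (\<lambda>g. four_block_mat (a g) (b g) (0\<^sub>m q p) (e g))"
    using P by (auto simp: rep_equiv_def)
qed

text \<open>Averaging the matrix unit \<open>E\<^sub>i\<^sub>j\<close>, where the term for \<open>h\<close> is column \<open>i\<close> of \<open>\<rho>\<^sub>2(h)\<close> times
row \<open>j\<close> of \<open>\<rho>\<^sub>1(h\<inverse>)\<close>, gives an intertwiner whose \<open>(i, j)\<close> entry is the sum over \<open>h\<close> of
\<open>\<rho>\<^sub>2(h)\<^sub>i\<^sub>i \<rho>\<^sub>1(h\<inverse>)\<^sub>j\<^sub>j\<close>. If all these vanish, summing over \<open>i\<close> and \<open>j\<close> shows that the squared absolute
values of the common character add up to zero, although its value at the unit is \<open>d > 0\<close>.\<close>

lemma nonzero_intertwiner: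
  assumes fin: "finite (carrier G)"
    and \<rho>: "is_rep G d \<rho>\<^sub>1" "is_rep G d \<rho>\<^sub>2"
    and tr: "\<And>g. g \<in> carrier G \<Longrightarrow> mtrace (\<rho>\<^sub>1 g) = mtrace (\<rho>\<^sub>2 g)"
    and d: "d > 0"
  shows "\<exists>T\<in>carrier_mat d d. T \<noteq> 0\<^sub>m d d \<and> (\<forall>g\<in>carrier G. \<rho>\<^sub>2 g * T = T * \<rho>\<^sub>1 g)"
proof (rule ccontr)
  note R = \<rho>[unfolded is_rep_iff[OF is_group]]
  assume no: "\<not> ?thesis"
  have c: "\<rho>\<^sub>1 g \<in> carrier_mat d d" "\<rho>\<^sub>2 g \<in> carrier_mat d d" if "g \<in> carrier G" for g
    using R that by auto
  have zero: "(\<Sum>h\<in>carrier G. \<rho>\<^sub>2 h $$ (i, i) * \<rho>\<^sub>1 (inv h) $$ (j, j)) = 0" if ij: "i < d" "j < d" for i j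
  proof -
    define A where "A h = mat d 1 (\<lambda>(k, _). \<rho>\<^sub>2 h $$ (k, i))" for h
    define B where "B h = mat 1 d (\<lambda>(_, k). \<rho>\<^sub>1 h $$ (j, k))" for h
    have AB: "A h \<in> carrier_mat d 1" "B h \<in> carrier_mat 1 d" "A h * B h' \<in> carrier_mat d d" for h h'
      by (auto simp: A_def B_def)
    have A: "\<rho>\<^sub>2 g * A h = A (g \<otimes> h)" if "g \<in> carrier G" "h \<in> carrier G" for g h
    proof (rule eq_matI)
      fix k l assume "k < dim_row (A (g \<otimes> h))" "l < dim_col (A (g \<otimes> h))"
      then have kl: "k < d" "l = 0" by (auto simp: A_def)
      have "(\<rho>\<^sub>2 g * A h) $$ (k, 0) = (\<Sum>m<d. \<rho>\<^sub>2 g $$ (k, m) * A h $$ (m, 0))"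
        using c[OF that(1)] AB kl by (intro mat_mult_index) auto
      also have "\<dots> = (\<Sum>m<d. \<rho>\<^sub>2 g $$ (k, m) * \<rho>\<^sub>2 h $$ (m, i))" by (simp add: A_def)
      also have "\<dots> = (\<rho>\<^sub>2 g * \<rho>\<^sub>2 h) $$ (k, i)"
        using c[OF that(1)] c[OF that(2)] kl ij by (intro mat_mult_index[symmetric]) auto
      also have "\<dots> = A (g \<otimes> h) $$ (k, 0)"
        using R that kl by (simp add: A_def del: index_mult_mat)
      finally show "(\<rho>\<^sub>2 g * A h) $$ (k, l) = A (g \<otimes> h) $$ (k, l)" using kl by simp
    qed (use c[OF that(1)] in \<open>auto simp: A_def\<close>)
    have B: "B h * \<rho>\<^sub>1 g = B (h \<otimes> g)" if "g \<in> carrier G" "h \<in> carrier G" for g h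
    proof (rule eq_matI)
      fix k l assume "k < dim_row (B (h \<otimes> g))" "l < dim_col (B (h \<otimes> g))"
      then have kl: "l < d" "k = 0" by (auto simp: B_def)
      have "(B h * \<rho>\<^sub>1 g) $$ (0, l) = (\<Sum>m<d. B h $$ (0, m) * \<rho>\<^sub>1 g $$ (m, l))"
        using c[OF that(1)] AB kl by (intro mat_mult_index[of _ 1 d _ d]) auto
      also have "\<dots> = (\<Sum>m<d. \<rho>\<^sub>1 h $$ (j, m) * \<rho>\<^sub>1 g $$ (m, l))" by (simp add: B_def)
      also have "\<dots> = (\<rho>\<^sub>1 h * \<rho>\<^sub>1 g) $$ (j, l)"
        using c[OF that(1)] c[OF that(2)] kl ij by (intro mat_mult_index[symmetric]) auto
      also have "\<dots> = B (h \<otimes> g) $$ (0, l)"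
        using R that kl by (simp add: B_def del: index_mult_mat)
      finally show "(B h * \<rho>\<^sub>1 g) $$ (k, l) = B (h \<otimes> g) $$ (k, l)" using kl by simp
    qed (use c[OF that(1)] in \<open>auto simp: B_def\<close>)
    define T where "T = mat_sum d d (carrier G) (\<lambda>h. A h * B (inv h))"
    have "\<rho>\<^sub>2 g * T = T * \<rho>\<^sub>1 g" if g: "g \<in> carrier G" for g
    proof -
      have "\<rho>\<^sub>2 g * T = mat_sum d d (carrier G) (\<lambda>h. \<rho>\<^sub>2 g * (A h * B (inv h)))"
        unfolding T_def using c[OF g] AB by (intro mat_sum_mult_left) auto
      also have "\<dots> = mat_sum d d (carrier G) (\<lambda>h. A (g \<otimes> h) * B (inv (g \<otimes> h)) * \<rho>\<^sub>1 g)"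
      proof (rule mat_sum_cong)
        fix h assume h: "h \<in> carrier G"
        have "\<rho>\<^sub>2 g * (A h * B (inv h)) = \<rho>\<^sub>2 g * A h * B (inv h)"
          using c[OF g] AB by (intro assoc_mult_mat[of _ d d _ 1 _ d, symmetric]) auto
        moreover have "A (g \<otimes> h) * B (inv (g \<otimes> h)) * \<rho>\<^sub>1 g = A (g \<otimes> h) * (B (inv (g \<otimes> h)) * \<rho>\<^sub>1 g)"
          using c[OF g] AB by (intro assoc_mult_mat[of _ d 1 _ d _ d]) auto
        moreover have "B (inv (g \<otimes> h)) * \<rho>\<^sub>1 g = B (inv h)"
          using g h by (simp add: B inv_mult_group m_assoc)
        ultimately show "\<rho>\<^sub>2 g * (A h * B (inv h)) = A (g \<otimes> h) * B (inv (g \<otimes> h)) * \<rho>\<^sub>1 g"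
          using A[OF g h] by simp
      qed
      also have "\<dots> = mat_sum d d (carrier G) (\<lambda>h. A h * B (inv h) * \<rho>\<^sub>1 g)"
        by (rule mat_sum_reindex[OF bij_betw_mult_left[OF g], symmetric])
      also have "\<dots> = T * \<rho>\<^sub>1 g"
        unfolding T_def using c[OF g] AB by (intro mat_sum_mult_right[symmetric]) auto
      finally show ?thesis .
    qed
    moreover have "T \<in> carrier_mat d d" by (simp add: T_def)
    ultimately have "T = 0\<^sub>m d d" using no by blast
    then have "T $$ (i, j) = 0" using ij by simp
    moreover have "(A h * B (inv h)) $$ (i, j) = \<rho>\<^sub>2 h $$ (i, i) * \<rho>\<^sub>1 (inv h) $$ (j, j)" for h
      using ij by (subst mat_mult_index[OF AB(1,2)]) (auto simp: A_def B_def)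
    ultimately show ?thesis using ij by (simp add: T_def mat_sum_def del: index_mult_mat)
  qed
  have "(\<Sum>h\<in>carrier G. mtrace (\<rho>\<^sub>2 h) * mtrace (\<rho>\<^sub>1 (inv h))) =
      (\<Sum>h\<in>carrier G. \<Sum>i<d. \<Sum>j<d. \<rho>\<^sub>2 h $$ (i, i) * \<rho>\<^sub>1 (inv h) $$ (j, j))"
    using c by (intro sum.cong refl) (simp add: mtrace_def sum_product carrier_matD[OF c(1)] carrier_matD[OF c(2)])
  also have "\<dots> = (\<Sum>i<d. \<Sum>h\<in>carrier G. \<Sum>j<d. \<rho>\<^sub>2 h $$ (i, i) * \<rho>\<^sub>1 (inv h) $$ (j, j))"
    by (rule sum.swap)
  also have "\<dots> = (\<Sum>i<d. \<Sum>j<d. \<Sum>h\<in>carrier G. \<rho>\<^sub>2 h $$ (i, i) * \<rho>\<^sub>1 (inv h) $$ (j, j))"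
    by (intro sum.cong refl sum.swap)
  also have "\<dots> = 0" using zero by simp
  finally have "(\<Sum>h\<in>carrier G. mtrace (\<rho>\<^sub>2 h) * mtrace (\<rho>\<^sub>1 (inv h))) = 0" .
  moreover have "mtrace (\<rho>\<^sub>2 h) * mtrace (\<rho>\<^sub>1 (inv h)) = of_real ((cmod (mtrace (\<rho>\<^sub>1 h)))\<^sup>2)"
    if "h \<in> carrier G" for h
    using tr[OF that] character_inv[OF fin \<rho>(1) that] by (simp only: complex_norm_square)
  ultimately have "of_real (\<Sum>h\<in>carrier G. (cmod (mtrace (\<rho>\<^sub>1 h)))\<^sup>2) = (0 :: complex)"
    by simp
  then have "(\<Sum>h\<in>carrier G. (cmod (mtrace (\<rho>\<^sub>1 h)))\<^sup>2) = 0"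
    by (simp only: of_real_eq_0_iff)
  then have "(cmod (mtrace (\<rho>\<^sub>1 \<one>)))\<^sup>2 = 0"
    using fin by (subst (asm) sum_nonneg_eq_0_iff) auto
  moreover have "mtrace (\<rho>\<^sub>1 \<one>) = of_nat d" using R by (simp add: mtrace_def)
  ultimately show False using d by simp
qed

text \<open>After changes of basis a nonzero intertwiner becomes \<open>J = diag (1\<^sub>k, 0)\<close> with \<open>k > 0\<close>. Comparing
blocks in \<open>\<sigma>\<^sub>2 J = J \<sigma>\<^sub>1\<close> shows that \<open>\<sigma>\<^sub>1\<close> is lower and \<open>\<sigma>\<^sub>2\<close> upper block triangular with the
same upper left block \<open>a\<^sub>1\<close>. The lower right blocks have equal characters and dimension
\<open>m < d\<close>, so the induction hypothesis applies to them.\<close>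

theorem character_determines_rep:
  assumes fin: "finite (carrier G)"
    and "is_rep G d \<rho>\<^sub>1" "is_rep G d \<rho>\<^sub>2"
    and "\<And>g. g \<in> carrier G \<Longrightarrow> mtrace (\<rho>\<^sub>1 g) = mtrace (\<rho>\<^sub>2 g)"
  shows "rep_equiv G d \<rho>\<^sub>1 d \<rho>\<^sub>2"
  using assms(2-)
proof (induction d arbitrary: \<rho>\<^sub>1 \<rho>\<^sub>2 rule: less_induct)
  case (less d)
  note rep = less.prems(1,2) and tr = less.prems(3)
  note R = rep[unfolded is_rep_iff[OF is_group]]
  show ?case
  proof (cases "d = 0")
    case True
    have "1\<^sub>m d * \<rho>\<^sub>1 g = \<rho>\<^sub>2 g * 1\<^sub>m d" if "g \<in> carrier G" for g
      using R that True by (intro eq_matI) auto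
    then show ?thesis unfolding rep_equiv_def using GL_one by blast
  next
    case False
    then obtain T where T: "T \<in> carrier_mat d d" "T \<noteq> 0\<^sub>m d d"
      and inter: "\<And>g. g \<in> carrier G \<Longrightarrow> \<rho>\<^sub>2 g * T = T * \<rho>\<^sub>1 g"
      using nonzero_intertwiner[OF fin rep tr] by blast
    obtain A B k m where A: "A \<in> carrier (GL d)" and B: "B \<in> carrier (GL d)" and d: "d = k + m"
      and ATB: "A * T * B = four_block_mat (1\<^sub>m k) (0\<^sub>m k m) (0\<^sub>m m k) (0\<^sub>m m m)" (is "_ = ?J")
      using rank_normal_form[OF T(1)] by blast
    obtain A' where A': "A' \<in> carrier (GL d)" "A * A' = 1\<^sub>m d" "A' * A = 1\<^sub>m d" using GL_inverse[OF A] .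
    obtain B' where B': "B' \<in> carrier (GL d)" "B * B' = 1\<^sub>m d" "B' * B = 1\<^sub>m d" using GL_inverse[OF B] .
    note AB = A[THEN GL_carrier_mat] B[THEN GL_carrier_mat] A'(1)[THEN GL_carrier_mat] B'(1)[THEN GL_carrier_mat]
    note as = assoc_mult_mat[of _ d d _ d _ d]
    \<comment> \<open>The common block is nontrivial, which makes the complement smaller.\<close>
    have k: "k > 0"
    proof (rule ccontr)
      assume "\<not> k > 0"
      then have "?J = 0\<^sub>m d d" by (intro eq_matI) (auto simp: d)
      then have "A' * (A * T * B) * B' = 0\<^sub>m d d" unfolding ATB using AB by simp
      moreover have "A' * (A * T * B) * B' = (A' * A) * T * (B * B')" using AB T by (simp add: as)
      ultimately show False using T by (simp add: A' B')
    qed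
    define \<sigma>\<^sub>1 where "\<sigma>\<^sub>1 g = B' * \<rho>\<^sub>1 g * B" for g
    define \<sigma>\<^sub>2 where "\<sigma>\<^sub>2 g = A * \<rho>\<^sub>2 g * A'" for g
    have \<sigma>: "is_rep G d \<sigma>\<^sub>1" "rep_equiv G d \<rho>\<^sub>1 d \<sigma>\<^sub>1" "is_rep G d \<sigma>\<^sub>2" "rep_equiv G d \<rho>\<^sub>2 d \<sigma>\<^sub>2"
      using is_rep_conj[OF is_group rep(1) B'(1) AB(2) B'(2)] is_rep_conj[OF is_group rep(2) A AB(3) A'(3)]
      by (simp_all add: \<sigma>\<^sub>1_def[abs_def] \<sigma>\<^sub>2_def[abs_def])
    have \<sigma>c: "\<sigma>\<^sub>1 g \<in> carrier_mat d d" "\<sigma>\<^sub>2 g \<in> carrier_mat d d" if "g \<in> carrier G" for g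
      using \<sigma>(1,3) that by (auto simp: is_rep_iff[OF is_group])
    have \<sigma>tr: "mtrace (\<sigma>\<^sub>1 g) = mtrace (\<sigma>\<^sub>2 g)" if "g \<in> carrier G" for g
    proof -
      have c: "\<rho>\<^sub>1 g \<in> carrier_mat d d" "\<rho>\<^sub>2 g \<in> carrier_mat d d" using R that by auto
      show ?thesis unfolding \<sigma>\<^sub>1_def \<sigma>\<^sub>2_def
        using mtrace_conj[OF c(1) AB(4,2) B'(2)] mtrace_conj[OF c(2) AB(1,3) A'(3)] tr[OF that] by simp
    qed
    have \<sigma>J: "\<sigma>\<^sub>2 g * ?J = ?J * \<sigma>\<^sub>1 g" if "g \<in> carrier G" for g
    proof -
      have c: "\<rho>\<^sub>1 g \<in> carrier_mat d d" "\<rho>\<^sub>2 g \<in> carrier_mat d d" using R that by auto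
      have "\<sigma>\<^sub>2 g * ?J = A * \<rho>\<^sub>2 g * (A' * A) * T * B"
        unfolding \<sigma>\<^sub>2_def ATB[symmetric] using AB T c by (simp add: as del: A'(3))
      also have "\<dots> = A * (\<rho>\<^sub>2 g * T) * B" using AB T c by (simp add: as A'(3))
      also have "\<dots> = A * (T * \<rho>\<^sub>1 g) * B" by (simp only: inter[OF that])
      also have "\<dots> = A * T * (B * B') * \<rho>\<^sub>1 g * B" using AB T c by (simp add: as B'(2))
      also have "\<dots> = ?J * \<sigma>\<^sub>1 g"
        unfolding \<sigma>\<^sub>1_def ATB[symmetric] using AB T c by (simp add: as)
      finally show ?thesis .
    qed
    define a\<^sub>1 where "a\<^sub>1 g = mat k k (\<lambda>(i, j). \<sigma>\<^sub>1 g $$ (i, j))" for g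
    define c\<^sub>1 where "c\<^sub>1 g = mat m k (\<lambda>(i, j). \<sigma>\<^sub>1 g $$ (k + i, j))" for g
    define e\<^sub>1 where "e\<^sub>1 g = mat m m (\<lambda>(i, j). \<sigma>\<^sub>1 g $$ (k + i, k + j))" for g
    define b\<^sub>2 where "b\<^sub>2 g = mat k m (\<lambda>(i, j). \<sigma>\<^sub>2 g $$ (i, k + j))" for g
    define e\<^sub>2 where "e\<^sub>2 g = mat m m (\<lambda>(i, j). \<sigma>\<^sub>2 g $$ (k + i, k + j))" for g
    have blocks: "\<sigma>\<^sub>1 g = four_block_mat (a\<^sub>1 g) (0\<^sub>m k m) (c\<^sub>1 g) (e\<^sub>1 g)"
      "\<sigma>\<^sub>2 g = four_block_mat (a\<^sub>1 g) (b\<^sub>2 g) (0\<^sub>m m k) (e\<^sub>2 g)" if g: "g \<in> carrier G" for g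
    proof -
      define b\<^sub>1 where "b\<^sub>1 = mat k m (\<lambda>(i, j). \<sigma>\<^sub>1 g $$ (i, k + j))"
      define a\<^sub>2 where "a\<^sub>2 = mat k k (\<lambda>(i, j). \<sigma>\<^sub>2 g $$ (i, j))"
      define c\<^sub>2 where "c\<^sub>2 = mat m k (\<lambda>(i, j). \<sigma>\<^sub>2 g $$ (k + i, j))"
      have 1: "\<sigma>\<^sub>1 g = four_block_mat (a\<^sub>1 g) b\<^sub>1 (c\<^sub>1 g) (e\<^sub>1 g)"
        using \<sigma>c[OF g] by (intro eq_matI) (auto simp: d a\<^sub>1_def b\<^sub>1_def c\<^sub>1_def e\<^sub>1_def)
      have 2: "\<sigma>\<^sub>2 g = four_block_mat a\<^sub>2 (b\<^sub>2 g) c\<^sub>2 (e\<^sub>2 g)"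
        using \<sigma>c[OF g] by (intro eq_matI) (auto simp: d a\<^sub>2_def b\<^sub>2_def c\<^sub>2_def e\<^sub>2_def)
      have car: "a\<^sub>1 g \<in> carrier_mat k k" "b\<^sub>1 \<in> carrier_mat k m" "c\<^sub>1 g \<in> carrier_mat m k"
        "e\<^sub>1 g \<in> carrier_mat m m" "a\<^sub>2 \<in> carrier_mat k k" "b\<^sub>2 g \<in> carrier_mat k m"
        "c\<^sub>2 \<in> carrier_mat m k" "e\<^sub>2 g \<in> carrier_mat m m"
        by (auto simp: a\<^sub>1_def b\<^sub>1_def c\<^sub>1_def e\<^sub>1_def a\<^sub>2_def b\<^sub>2_def c\<^sub>2_def e\<^sub>2_def)
      have "\<sigma>\<^sub>2 g * ?J = four_block_mat a\<^sub>2 (0\<^sub>m k m) c\<^sub>2 (0\<^sub>m m m)"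
        unfolding 2 using car by (subst mult_four_block_mat[of _ k k _ m _ m]) (auto intro!: cong_four_block_mat)
      moreover have "?J * \<sigma>\<^sub>1 g = four_block_mat (a\<^sub>1 g) b\<^sub>1 (0\<^sub>m m k) (0\<^sub>m m m)"
        unfolding 1 using car by (subst mult_four_block_mat[of _ k k _ m _ m]) (auto intro!: cong_four_block_mat)
      ultimately have eq: "four_block_mat a\<^sub>2 (0\<^sub>m k m) c\<^sub>2 (0\<^sub>m m m) =
          four_block_mat (a\<^sub>1 g) b\<^sub>1 (0\<^sub>m m k) (0\<^sub>m m m)"
        using \<sigma>J[OF g] by simp
      have "a\<^sub>2 = a\<^sub>1 g" "0\<^sub>m k m = b\<^sub>1" "c\<^sub>2 = 0\<^sub>m m k"
        using four_block_mat_inject[OF eq, of k k m m] car by auto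
      then show "\<sigma>\<^sub>1 g = four_block_mat (a\<^sub>1 g) (0\<^sub>m k m) (c\<^sub>1 g) (e\<^sub>1 g)"
        "\<sigma>\<^sub>2 g = four_block_mat (a\<^sub>1 g) (b\<^sub>2 g) (0\<^sub>m m k) (e\<^sub>2 g)" using 1 2 by auto
    qed
    have car: "a\<^sub>1 g \<in> carrier_mat k k" "c\<^sub>1 g \<in> carrier_mat m k"
      "e\<^sub>1 g \<in> carrier_mat m m" "b\<^sub>2 g \<in> carrier_mat k m" "e\<^sub>2 g \<in> carrier_mat m m" for g
      by (auto simp: a\<^sub>1_def c\<^sub>1_def e\<^sub>1_def b\<^sub>2_def e\<^sub>2_def)
    let ?\<sigma>\<^sub>1 = "\<lambda>g. four_block_mat (a\<^sub>1 g) (0\<^sub>m k m) (c\<^sub>1 g) (e\<^sub>1 g)"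
    let ?\<sigma>\<^sub>2 = "\<lambda>g. four_block_mat (a\<^sub>1 g) (b\<^sub>2 g) (0\<^sub>m m k) (e\<^sub>2 g)"
    let ?\<tau>\<^sub>1 = "\<lambda>g. four_block_mat (a\<^sub>1 g) (0\<^sub>m k m) (0\<^sub>m m k) (e\<^sub>1 g)"
    let ?\<tau>\<^sub>2 = "\<lambda>g. four_block_mat (a\<^sub>1 g) (0\<^sub>m k m) (0\<^sub>m m k) (e\<^sub>2 g)"
    have \<sigma>': "is_rep G d ?\<sigma>\<^sub>1" "rep_equiv G d \<rho>\<^sub>1 d ?\<sigma>\<^sub>1" "is_rep G d ?\<sigma>\<^sub>2" "rep_equiv G d \<rho>\<^sub>2 d ?\<sigma>\<^sub>2"
      using \<sigma> blocks by (auto simp: is_rep_iff[OF is_group] rep_equiv_def)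
    note L = rep_equiv_lower_block[OF fin \<sigma>'(1)[unfolded d] car(1,2,3)]
    note U = rep_equiv_upper_block[OF fin \<sigma>'(3)[unfolded d] car(1,4,5)]
    have "mtrace (e\<^sub>1 g) = mtrace (e\<^sub>2 g)" if "g \<in> carrier G" for g
      using \<sigma>tr[OF that] mtrace_four_block[OF car(1) car(3)] mtrace_four_block[OF car(1) car(5)]
      by (simp add: blocks[OF that])
    then have "rep_equiv G m e\<^sub>1 m e\<^sub>2"
      using L(2) U(2) k d by (intro less.IH) auto
    then obtain P where P: "P \<in> carrier (GL m)" and Pe: "\<And>g. g \<in> carrier G \<Longrightarrow> P * e\<^sub>1 g = e\<^sub>2 g * P"
      by (auto simp: rep_equiv_def)
    have \<tau>: "is_rep G d ?\<tau>\<^sub>1" "is_rep G d ?\<tau>\<^sub>2"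
      using L(1,2) U(2) unfolding is_rep_iff[OF is_group] d
      by (auto simp: four_block_mult_lower[OF car(1) zero_carrier_mat car(3) car(1) zero_carrier_mat car(3)]
         four_block_mult_lower[OF car(1) zero_carrier_mat car(5) car(1) zero_carrier_mat car(5)]
         left_mult_zero_mat[OF car(1)] right_mult_zero_mat[OF car(3)] right_mult_zero_mat[OF car(5)])
    have "rep_equiv G d ?\<tau>\<^sub>1 d ?\<tau>\<^sub>2"
    proof -
      let ?Q = "four_block_mat (1\<^sub>m k) (0\<^sub>m k m) (0\<^sub>m m k) P"
      have "?Q \<in> carrier (GL d)" unfolding d using P by (intro GL_four_block_lower GL_one) auto
      moreover have "?Q * ?\<tau>\<^sub>1 g = ?\<tau>\<^sub>2 g * ?Q" if "g \<in> carrier G" for g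
      proof -
        note Pc = GL_carrier_mat[OF P]
        have "?Q * ?\<tau>\<^sub>1 g = four_block_mat (a\<^sub>1 g) (0\<^sub>m k m) (0\<^sub>m m k) (P * e\<^sub>1 g)"
          using car[of g] Pc by (subst four_block_mult_lower) (auto intro!: cong_four_block_mat)
        also have "\<dots> = ?\<tau>\<^sub>2 g * ?Q"
          unfolding Pe[OF that]
          using car[of g] Pc by (subst four_block_mult_lower) (auto intro!: cong_four_block_mat)
        finally show ?thesis .
      qed
      ultimately show ?thesis by (auto simp: rep_equiv_def)
    qed
    note trans = rep_equiv_trans[OF is_group] and sym = rep_equiv_sym[OF is_group]
    have "rep_equiv G d \<rho>\<^sub>1 d ?\<tau>\<^sub>1"
      using trans[OF rep(1) \<sigma>'(1) \<tau>(1) \<sigma>'(2)] sym[OF \<tau>(1) \<sigma>'(1)] L(3) d by simp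
    then have 1: "rep_equiv G d \<rho>\<^sub>1 d ?\<tau>\<^sub>2"
      using trans[OF rep(1) \<tau>(1) \<tau>(2)] \<open>rep_equiv G d ?\<tau>\<^sub>1 d ?\<tau>\<^sub>2\<close> by blast
    have "rep_equiv G d ?\<tau>\<^sub>2 d ?\<sigma>\<^sub>2" using U(3) d by simp
    then have "rep_equiv G d ?\<tau>\<^sub>2 d \<rho>\<^sub>2"
      using trans[OF \<tau>(2) \<sigma>'(3) rep(2)] sym[OF rep(2) \<sigma>'(3) \<sigma>'(4)] by blast
    then show ?thesis using trans[OF rep(1) \<tau>(2) rep(2) 1] by blast
  qed
qed

end

section \<open>Words, commutation and class functions\<close>

context monoid
begin

lemma pow_commute_self: "x \<in> carrier G \<Longrightarrow> x \<otimes> x [^] (c :: nat) = x [^] c \<otimes> x"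
  by (metis nat_pow_Suc nat_pow_Suc2)

definition word_prod :: "('l \<Rightarrow> 'a) \<Rightarrow> 'l list \<Rightarrow> 'a" where
  "word_prod \<phi> w = foldr (\<lambda>x y. \<phi> x \<otimes> y) w \<one>"

lemma word_prod_simps [simp]:
  "word_prod \<phi> [] = \<one>" "word_prod \<phi> (x # w) = \<phi> x \<otimes> word_prod \<phi> w"
  by (simp_all add: word_prod_def)

lemma word_prod_closed [simp, intro]:
  "(\<And>x. x \<in> set w \<Longrightarrow> \<phi> x \<in> carrier G) \<Longrightarrow> word_prod \<phi> w \<in> carrier G"
  by (induction w) auto

lemma word_prod_append:
  assumes "\<And>x. \<phi> x \<in> carrier G"
  shows "word_prod \<phi> (u @ v) = word_prod \<phi> u \<otimes> word_prod \<phi> v"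
  using assms by (induction u) (auto simp: m_assoc)

lemma word_prod_replicate:
  assumes "\<phi> x \<in> carrier G"
  shows "word_prod \<phi> (replicate c x) = \<phi> x [^] c"
  using assms by (induction c) (auto simp: pow_commute_self)

lemma word_prod_cong:
  assumes "\<And>x. x \<in> set w \<Longrightarrow> \<phi> x = \<psi> x"
  shows "word_prod \<phi> w = word_prod \<psi> w"
  using assms by (induction w) auto

definition commute :: "'a \<Rightarrow> 'a \<Rightarrow> bool" where
  "commute x y \<longleftrightarrow> x \<otimes> y = y \<otimes> x"

lemma commute_sym: "commute x y \<Longrightarrow> commute y x"
  by (simp add: commute_def)

lemma commute_refl [simp]: "commute x x"
  by (simp add: commute_def)

lemma commute_one [simp]: "x \<in> carrier G \<Longrightarrow> commute x \<one>"
  by (simp add: commute_def)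

lemma commute_mult:
  assumes "commute x y" "commute x z" "x \<in> carrier G" "y \<in> carrier G" "z \<in> carrier G"
  shows "commute x (y \<otimes> z)"
  using assms unfolding commute_def by (metis m_assoc)

lemma commute_pow:
  assumes "commute x y" "x \<in> carrier G" "y \<in> carrier G"
  shows "commute x (y [^] (c :: nat))"
  using assms by (induction c) (auto intro: commute_mult)

lemma commute_word_prod:
  assumes "\<And>y. y \<in> set w \<Longrightarrow> commute x (\<phi> y)" "x \<in> carrier G" "\<And>y. \<phi> y \<in> carrier G"
  shows "commute x (word_prod \<phi> w)"
  using assms(1) by (induction w) (use assms(2,3) in \<open>auto intro!: commute_mult\<close>)

lemma commute_conj_involution:
  assumes "commute x y" "s \<otimes> s = \<one>" "x \<in> carrier G" "y \<in> carrier G" "s \<in> carrier G"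
  shows "commute (s \<otimes> x \<otimes> s) (s \<otimes> y \<otimes> s)"
proof -
  have *: "s \<otimes> x \<otimes> s \<otimes> (s \<otimes> y \<otimes> s) = s \<otimes> (x \<otimes> y) \<otimes> s"
    if "x \<in> carrier G" "y \<in> carrier G" for x y
  proof -
    have "s \<otimes> x \<otimes> s \<otimes> (s \<otimes> y \<otimes> s) = s \<otimes> x \<otimes> (s \<otimes> s) \<otimes> (y \<otimes> s)"
      using that assms(5) by (simp add: m_assoc)
    also have "\<dots> = s \<otimes> (x \<otimes> y) \<otimes> s"
      using that assms(2,5) by (simp add: m_assoc)
    finally show ?thesis .
  qed
  show ?thesis
    using *[of x y] *[of y x] assms by (simp add: commute_def)
qed

lemma conj_involution_commute:
  assumes "commute s x" "s \<otimes> s = \<one>" "x \<in> carrier G" "s \<in> carrier G"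
  shows "s \<otimes> x \<otimes> s = x"
  using assms unfolding commute_def by (simp add: m_assoc)

lemma word_prod_removeAll:
  assumes "\<And>y. y \<in> set w \<Longrightarrow> commute (\<phi> x) (\<phi> y)" "\<And>y. \<phi> y \<in> carrier G"
  shows "word_prod \<phi> w = \<phi> x [^] count (mset w) x \<otimes> word_prod \<phi> (removeAll x w)"
  using assms(1)
proof (induction w)
  case Nil
  then show ?case by simp
next
  case (Cons z w)
  let ?c = "count (mset w) x" and ?w = "word_prod \<phi> (removeAll x w)"
  have IH: "word_prod \<phi> w = \<phi> x [^] ?c \<otimes> ?w"
    using Cons by auto
  have cl: "?w \<in> carrier G" "\<phi> x [^] ?c \<in> carrier G" "\<phi> z \<in> carrier G" "\<phi> x \<in> carrier G"
    using assms(2) by auto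
  show ?case
  proof (cases "z = x")
    case True
    then show ?thesis using IH cl by (simp add: m_assoc[symmetric] pow_commute_self)
  next
    case False
    have "commute (\<phi> z) (\<phi> x [^] ?c)"
      using Cons.prems[of z] cl by (auto intro: commute_pow commute_sym)
    then have "\<phi> z \<otimes> (\<phi> x [^] ?c \<otimes> ?w) = \<phi> x [^] ?c \<otimes> (\<phi> z \<otimes> ?w)"
      using cl unfolding commute_def by (metis m_assoc)
    then show ?thesis using False IH by simp
  qed
qed

text \<open>Since \<open>y\<close> occurs only once, a cyclic rotation, invisible to \<open>f\<close>, brings it to the front. All
occurrences of \<open>x\<close> can then be collected directly behind \<open>y\<close>, as \<open>x\<close> commutes with every other letter.
The letter \<open>x\<close> is thereby eliminated and absorbed into the value assigned to \<open>y\<close>.\<close>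

lemma class_function_gather:
  fixes f :: "'a \<Rightarrow> 'c"
  assumes f: "\<And>a b. a \<in> carrier G \<Longrightarrow> b \<in> carrier G \<Longrightarrow> f (a \<otimes> b) = f (b \<otimes> a)"
    and \<phi>: "\<And>z. \<phi> z \<in> carrier G"
    and y: "count (mset u) y = 1" "x \<noteq> y"
    and comm: "\<And>z. z \<in> set u \<Longrightarrow> z \<noteq> y \<Longrightarrow> commute (\<phi> x) (\<phi> z)"
  shows "f (word_prod \<phi> u) =
    f (word_prod (\<phi>(y := \<phi> y \<otimes> \<phi> x [^] count (mset u) x)) (removeAll x u))"
proof -
  have "y \<in> set u"
    using y(1) count_eq_zero_iff[of "mset u" y] by simp
  then obtain p q where u: "u = p @ y # q"
    by (meson split_list)
  have "count (mset p) y = 0" "count (mset q) y = 0"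
    using y(1) unfolding u by simp_all
  then have np: "y \<notin> set p" and nq: "y \<notin> set q"
    by (simp_all add: count_eq_zero_iff)
  let ?c = "count (mset u) x"
  let ?\<phi> = "\<phi>(y := \<phi> y \<otimes> \<phi> x [^] ?c)"
  have cl: "?\<phi> z \<in> carrier G" for z using \<phi> by auto
  have c: "count (mset (q @ p)) x = ?c" using u y(2) by auto
  have same: "word_prod ?\<phi> (removeAll x w) = word_prod \<phi> (removeAll x w)" if "y \<notin> set w" for w
    using that by (intro word_prod_cong) auto
  have "f (word_prod \<phi> u) = f (word_prod \<phi> p \<otimes> word_prod \<phi> (y # q))"
    unfolding u by (subst word_prod_append) (auto intro: \<phi>)
  also have "\<dots> = f (word_prod \<phi> (y # q) \<otimes> word_prod \<phi> p)"
    by (intro f) (auto intro: \<phi>)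
  also have "word_prod \<phi> (y # q) \<otimes> word_prod \<phi> p = \<phi> y \<otimes> word_prod \<phi> (q @ p)"
    using \<phi> by (simp add: word_prod_append m_assoc)
  also have "word_prod \<phi> (q @ p) = \<phi> x [^] ?c \<otimes> word_prod \<phi> (removeAll x (q @ p))"
  proof -
    have "commute (\<phi> x) (\<phi> z)" if "z \<in> set (q @ p)" for z
      using comm[of z] that u nq np by auto
    then show ?thesis
      using word_prod_removeAll[of "q @ p" \<phi> x] \<phi> unfolding c by blast
  qed
  also have "\<phi> y \<otimes> \<dots> = word_prod ?\<phi> (y # removeAll x q) \<otimes> word_prod ?\<phi> (removeAll x p)"
    using \<phi> nq np by (simp add: word_prod_append m_assoc same)
  also have "f \<dots> = f (word_prod ?\<phi> (removeAll x p) \<otimes> word_prod ?\<phi> (y # removeAll x q))"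
    using cl by (intro f word_prod_closed) (auto simp del: fun_upd_apply)
  also have "word_prod ?\<phi> (removeAll x p) \<otimes> word_prod ?\<phi> (y # removeAll x q) =
      word_prod ?\<phi> (removeAll x u)"
  proof -
    have "removeAll x u = removeAll x p @ y # removeAll x q" using u y(2) by simp
    then show ?thesis by (simp only: word_prod_append[of ?\<phi>, OF cl])
  qed
  finally show ?thesis .
qed

text \<open>The letters listed in \<open>L\<close> form a rooted tree, where \<open>par\<close> is the parent map and the root comes last;
a letter need not commute with its parent, but with all other letters after it in the list. The
letters are absorbed into their parents one by one. This works because a letter only has to be
collected next to the unique occurrence of its parent; a letter that is not itself a parent may
occur arbitrarily often. The new value at the parent still commutes with whatever it
commuted with before, since the absorbed letter does. What remains in the end is a power of the root,
which depends only on the multiplicities.\<close>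

lemma class_function_content:
  fixes f :: "'a \<Rightarrow> 'c" and par :: "'l \<Rightarrow> 'l"
  assumes f: "\<And>a b. a \<in> carrier G \<Longrightarrow> b \<in> carrier G \<Longrightarrow> f (a \<otimes> b) = f (b \<otimes> a)"
  shows "\<lbrakk>\<And>z. \<phi> z \<in> carrier G; distinct L; mset u = mset v; set u \<subseteq> set L;
    \<And>i. Suc i < length L \<Longrightarrow> par (L ! i) \<in> set (drop (Suc i) L) \<and> count (mset u) (par (L ! i)) = 1;
    \<And>i j. i < j \<Longrightarrow> j < length L \<Longrightarrow> L ! j \<noteq> par (L ! i) \<Longrightarrow> commute (\<phi> (L ! i)) (\<phi> (L ! j))\<rbrakk>
    \<Longrightarrow> f (word_prod \<phi> u) = f (word_prod \<phi> v)"
proof (induction L arbitrary: \<phi> u v)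
  case Nil
  then show ?case by auto
next
  case (Cons x L)
  show ?case
  proof (cases "L = []")
    case True
    then have "u = replicate (length u) x" "v = replicate (length v) x"
      using Cons.prems(3,4) mset_eq_setD[OF Cons.prems(3)]
      by (auto intro!: replicate_length_same[symmetric])
    moreover have "length u = length v"
      using Cons.prems(3) by (rule mset_eq_length)
    ultimately show ?thesis by metis
  next
    case False
    let ?y = "par x"
    have y: "?y \<in> set L" "count (mset u) ?y = 1"
      using Cons.prems(5)[of 0] False by auto
    with Cons.prems(2) have xy: "x \<noteq> ?y" by auto
    have su: "set u = set v" using mset_eq_setD Cons.prems(3) by blast
    have comm: "commute (\<phi> x) (\<phi> z)" if z: "z \<in> set (x # L)" "z \<noteq> ?y" for z
    proof (cases "z = x")
      case False
      then obtain j where "j < length L" "L ! j = z"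
        using z by (auto simp: in_set_conv_nth)
      then show ?thesis using Cons.prems(6)[of 0 "Suc j"] z by auto
    qed auto
    define \<psi> where "\<psi> = \<phi>(?y := \<phi> ?y \<otimes> \<phi> x [^] count (mset u) x)"
    have "f (word_prod \<phi> u) = f (word_prod \<psi> (removeAll x u))"
      unfolding \<psi>_def using Cons.prems(1,4) comm y xy by (intro class_function_gather f) auto
    moreover have "f (word_prod \<phi> v) = f (word_prod \<psi> (removeAll x v))"
      unfolding \<psi>_def Cons.prems(3)
      using Cons.prems(1,4) comm y xy su Cons.prems(3) by (intro class_function_gather f) auto
    moreover have "f (word_prod \<psi> (removeAll x u)) = f (word_prod \<psi> (removeAll x v))"
    proof (rule Cons.IH)
      show "\<psi> z \<in> carrier G" for z using Cons.prems(1) by (auto simp: \<psi>_def)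
      show "distinct L" "set (removeAll x u) \<subseteq> set L"
        using Cons.prems by auto
      show "mset (removeAll x u) = mset (removeAll x v)"
        by (simp only: mset_removeAll_eq Cons.prems(3))
      show "par (L ! i) \<in> set (drop (Suc i) L) \<and> count (mset (removeAll x u)) (par (L ! i)) = 1"
        if i: "Suc i < length L" for i
      proof -
        have *: "par (L ! i) \<in> set (drop (Suc i) L)" "count (mset u) (par (L ! i)) = 1"
          using Cons.prems(5)[of "Suc i"] i by auto
        then have "par (L ! i) \<noteq> x"
          using Cons.prems(2) in_set_dropD by fastforce
        with * show ?thesis by (simp add: mset_removeAll_eq)
      qed
      show "commute (\<psi> (L ! i)) (\<psi> (L ! j))"
        if ij: "i < j" "j < length L" "L ! j \<noteq> par (L ! i)" for i j
      proof -
        have ne: "L ! i \<noteq> L ! j"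
          using Cons.prems(2) ij by (simp add: nth_eq_iff_index_eq)
        have c: "commute (\<phi> (L ! i)) (\<phi> (L ! j))"
          using Cons.prems(6)[of "Suc i" "Suc j"] ij by auto
        have mem: "L ! i \<in> set (x # L)" "L ! j \<in> set (x # L)" using ij by auto
        consider "L ! i = ?y" "L ! j \<noteq> ?y" | "L ! j = ?y" "L ! i \<noteq> ?y" | "L ! i \<noteq> ?y" "L ! j \<noteq> ?y"
          using ne by metis
        then show ?thesis
        proof cases
          case 1
          have "commute (\<phi> (L ! j)) (\<phi> (L ! i) \<otimes> \<phi> x [^] count (mset u) x)"
            using 1 c comm[OF mem(2)] Cons.prems(1)
            by (intro commute_mult commute_pow) (auto intro: commute_sym)
          then show ?thesis using 1 by (auto simp: \<psi>_def intro: commute_sym)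
        next
          case 2
          have "commute (\<phi> (L ! i)) (\<phi> (L ! j) \<otimes> \<phi> x [^] count (mset u) x)"
            using 2 c comm[OF mem(1)] Cons.prems(1)
            by (intro commute_mult commute_pow) (auto intro: commute_sym)
          then show ?thesis using 2 by (auto simp: \<psi>_def)
        next
          case 3
          then show ?thesis using c by (simp add: \<psi>_def)
        qed
      qed
    qed
    ultimately show ?thesis by simp
  qed
qed

end

section \<open>Consequences of the relations\<close>

lemma mem_imprim_gens [simp]:
  "Gs i \<in> imprim_gens m \<longleftrightarrow> 1 \<le> i \<and> i < m" "Gt i \<in> imprim_gens m \<longleftrightarrow> 1 \<le> i \<and> i \<le> m"
  by (auto simp: imprim_gens_def)

lemma imprim_gens_mono: "m \<le> m' \<Longrightarrow> imprim_gens m \<subseteq> imprim_gens m'"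
  by (auto simp: imprim_gens_def)

lemma imprim_gens_Suc:
  "imprim_gens (Suc m) = insert (Gt (Suc m)) (imprim_gens m \<union> (if m = 0 then {} else {Gs m}))"
proof (rule Set.set_eqI)
  show "x \<in> imprim_gens (Suc m) \<longleftrightarrow>
      x \<in> insert (Gt (Suc m)) (imprim_gens m \<union> (if m = 0 then {} else {Gs m}))" for x
    by (cases x) auto
qed

text \<open>The relations in the form used below. The map \<open>\<phi>\<close> is total, and \<open>\<phi> (Gs n) = \<one>\<close> provides an
additional letter \<open>s\<^sub>n\<close> of trivial value, so that every \<open>t\<^sub>i\<close> and every \<open>s\<^sub>i\<close> with \<open>i < n\<close> has a
successor in the elimination argument for words.\<close>

locale imprimitive_relations = group G for G (structure) +
  fixes n r :: nat and \<phi> :: "gen \<Rightarrow> 'a"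
  assumes closed [simp]: "\<phi> x \<in> carrier G"
    and r_pos: "r > 0"
    and s_s_far: "1 \<le> i \<Longrightarrow> i + 1 < j \<Longrightarrow> j < n \<Longrightarrow> commute (\<phi> (Gs i)) (\<phi> (Gs j))"
    and braid: "1 \<le> i \<Longrightarrow> i + 1 < n \<Longrightarrow>
      \<phi> (Gs i) \<otimes> \<phi> (Gs (i + 1)) \<otimes> \<phi> (Gs i) = \<phi> (Gs (i + 1)) \<otimes> \<phi> (Gs i) \<otimes> \<phi> (Gs (i + 1))"
    and t_t_last: "2 \<le> n \<Longrightarrow> commute (\<phi> (Gt (n - 1))) (\<phi> (Gt n))"
    and s_t_last: "1 \<le> i \<Longrightarrow> i + 1 < n \<Longrightarrow> commute (\<phi> (Gs i)) (\<phi> (Gt n))"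
    and s_square: "1 \<le> i \<Longrightarrow> i < n \<Longrightarrow> \<phi> (Gs i) \<otimes> \<phi> (Gs i) = \<one>"
    and t_power: "1 \<le> j \<Longrightarrow> j \<le> n \<Longrightarrow> \<phi> (Gt j) [^] r = \<one>"
    and t_conj: "1 \<le> i \<Longrightarrow> i < n \<Longrightarrow> \<phi> (Gt i) = \<phi> (Gs i) \<otimes> \<phi> (Gt (i + 1)) \<otimes> \<phi> (Gs i)"
    and s_n: "\<phi> (Gs n) = \<one>"
    and generated: "carrier G = word_prod \<phi> ` lists (imprim_gens n)"
begin

lemma t_conj': assumes "1 \<le> i" "i < n"
  shows "\<phi> (Gt (i + 1)) = \<phi> (Gs i) \<otimes> \<phi> (Gt i) \<otimes> \<phi> (Gs i)"
proof -
  let ?s = "\<phi> (Gs i)" and ?t = "\<phi> (Gt (i + 1))"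
  have "?s \<otimes> (?s \<otimes> ?t \<otimes> ?s) \<otimes> ?s = (?s \<otimes> ?s) \<otimes> ?t \<otimes> (?s \<otimes> ?s)"
    by (simp add: m_assoc)
  then show ?thesis using t_conj[OF assms] s_square[OF assms] by simp
qed

lemma s_t_swap: assumes "1 \<le> i" "i < n"
  shows "\<phi> (Gs i) \<otimes> \<phi> (Gt i) = \<phi> (Gt (i + 1)) \<otimes> \<phi> (Gs i)"
    and "\<phi> (Gs i) \<otimes> \<phi> (Gt (i + 1)) = \<phi> (Gt i) \<otimes> \<phi> (Gs i)"
proof -
  let ?s = "\<phi> (Gs i)"
  have *: "?s \<otimes> (?s \<otimes> x \<otimes> ?s) = x \<otimes> ?s" if "x \<in> carrier G" for x
  proof -
    have "?s \<otimes> (?s \<otimes> x \<otimes> ?s) = (?s \<otimes> ?s) \<otimes> x \<otimes> ?s"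
      using that by (simp add: m_assoc)
    then show ?thesis using that s_square[OF assms] by simp
  qed
  show "?s \<otimes> \<phi> (Gt i) = \<phi> (Gt (i + 1)) \<otimes> ?s" "?s \<otimes> \<phi> (Gt (i + 1)) = \<phi> (Gt i) \<otimes> ?s"
    using *[of "\<phi> (Gt (i + 1))"] *[of "\<phi> (Gt i)"] t_conj[OF assms] t_conj'[OF assms] by simp_all
qed

lemma s_s_commute:
  assumes "1 \<le> i" "i < n" "1 \<le> j" "j < n" "i \<noteq> j + 1" "j \<noteq> i + 1"
  shows "commute (\<phi> (Gs i)) (\<phi> (Gs j))"
proof -
  consider "i + 1 < j" | "j + 1 < i" | "i = j" using assms(5,6) by linarith
  then show ?thesis
    by cases (use assms s_s_far commute_sym in auto)
qed

lemma s_t_commute_above: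
  assumes "1 \<le> i" "i + 1 < j" "j \<le> n"
  shows "commute (\<phi> (Gs i)) (\<phi> (Gt j))"
  using assms(3,2)
proof (induction j rule: inc_induct)
  case base
  then show ?case using s_t_last assms(1) by simp
next
  case (step j)
  have "commute (\<phi> (Gs i)) (\<phi> (Gs j) \<otimes> \<phi> (Gt (j + 1)) \<otimes> \<phi> (Gs j))"
    using step s_s_far[of i j] assms(1) by (intro commute_mult) auto
  then show ?case using t_conj[of j] step by simp
qed

text \<open>For \<open>i = j + 1\<close>, conjugation by \<open>s\<^sub>j s\<^sub>j\<^sub>+\<^sub>1\<close> carries the commuting pair \<open>(s\<^sub>j, t\<^sub>j\<^sub>+\<^sub>2)\<close> to
\<open>(s\<^sub>j\<^sub>+\<^sub>1, t\<^sub>j)\<close> by the braid relation. Smaller \<open>j\<close> follow from \<open>t\<^sub>j = s\<^sub>j t\<^sub>j\<^sub>+\<^sub>1 s\<^sub>j\<close>.\<close>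

lemma s_t_commute_below:
  assumes "1 \<le> j" "j < i" "i < n"
  shows "commute (\<phi> (Gs i)) (\<phi> (Gt j))"
proof -
  obtain k where i: "i = Suc k" using assms(2) by (cases i) auto
  have "j \<le> k" using assms i by simp
  then show ?thesis using assms(1)
  proof (induction j rule: inc_induct)
    case base
    have "commute (\<phi> (Gs k)) (\<phi> (Gt (k + 2)))"
      using base assms i by (intro s_t_commute_above) auto
    then have "commute (\<phi> (Gs (k+1)) \<otimes> \<phi> (Gs k) \<otimes> \<phi> (Gs (k+1)))
        (\<phi> (Gs (k+1)) \<otimes> \<phi> (Gt (k + 2)) \<otimes> \<phi> (Gs (k+1)))"
      using s_square[of "k+1"] assms i by (intro commute_conj_involution) auto
    then have "commute (\<phi> (Gs k) \<otimes> \<phi> (Gs (k+1)) \<otimes> \<phi> (Gs k)) (\<phi> (Gt (k + 1)))"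
      using braid[of k] t_conj[of "k+1"] base assms i by simp
    then have "commute (\<phi> (Gs k) \<otimes> (\<phi> (Gs k) \<otimes> \<phi> (Gs (k+1)) \<otimes> \<phi> (Gs k)) \<otimes> \<phi> (Gs k))
        (\<phi> (Gs k) \<otimes> \<phi> (Gt (k + 1)) \<otimes> \<phi> (Gs k))"
      using s_square[of k] assms i base by (intro commute_conj_involution) auto
    moreover have "\<phi> (Gs k) \<otimes> (\<phi> (Gs k) \<otimes> \<phi> (Gs (k+1)) \<otimes> \<phi> (Gs k)) \<otimes> \<phi> (Gs k) =
        (\<phi> (Gs k) \<otimes> \<phi> (Gs k)) \<otimes> \<phi> (Gs (k+1)) \<otimes> (\<phi> (Gs k) \<otimes> \<phi> (Gs k))"
      by (simp add: m_assoc)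
    ultimately show ?case
      using t_conj[of k] s_square[of k] i base assms by simp
  next
    case (step j)
    have "commute (\<phi> (Gs i)) (\<phi> (Gs j) \<otimes> \<phi> (Gt (j + 1)) \<otimes> \<phi> (Gs j))"
      using step s_s_commute[of i j] assms i by (intro commute_mult) auto
    then show ?case using t_conj[of j] step assms i by simp
  qed
qed

lemma s_t_commute:
  assumes "1 \<le> i" "i < n" "1 \<le> j" "j \<le> n" "j \<noteq> i" "j \<noteq> i + 1"
  shows "commute (\<phi> (Gs i)) (\<phi> (Gt j))"
  using assms s_t_commute_above[of i j] s_t_commute_below[of j i] by (cases "j < i") auto

text \<open>Downward induction from the relation for \<open>t\<^sub>n\<close>: conjugating the commuting pair
\<open>(t\<^sub>i\<^sub>+\<^sub>1, t\<^sub>i\<^sub>+\<^sub>2)\<close> by \<open>s\<^sub>i\<close> gives \<open>(t\<^sub>i, t\<^sub>i\<^sub>+\<^sub>2)\<close>, and then by \<open>s\<^sub>i\<^sub>+\<^sub>1\<close> gives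
\<open>(t\<^sub>i, t\<^sub>i\<^sub>+\<^sub>1)\<close>.\<close>

lemma t_t_commute_next:
  assumes "1 \<le> i" "i < n"
  shows "commute (\<phi> (Gt i)) (\<phi> (Gt (i + 1)))"
proof -
  obtain k where n: "n = Suc k" using assms(2) by (cases n) auto
  have "i \<le> k" using assms n by simp
  then show ?thesis using assms(1)
  proof (induction i rule: inc_induct)
    case base
    then show ?case using t_t_last n by simp
  next
    case (step i)
    let ?t = "\<lambda>i. \<phi> (Gt i)" and ?s = "\<lambda>i. \<phi> (Gs i)"
    have i: "1 \<le> i" "i + 1 < n" using step n by auto
    have "commute (?t (i + 1)) (?t (i + 2))"
      using step by simp
    then have "commute (?s i \<otimes> ?t (i + 1) \<otimes> ?s i) (?s i \<otimes> ?t (i + 2) \<otimes> ?s i)"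
      using i s_square[of i] by (intro commute_conj_involution) auto
    moreover have "?s i \<otimes> ?t (i + 2) \<otimes> ?s i = ?t (i + 2)"
      using i by (intro conj_involution_commute s_t_commute s_square) auto
    ultimately have "commute (?t i) (?t (i + 2))"
      using t_conj[of i] i by simp
    then have "commute (?s (i + 1) \<otimes> ?t i \<otimes> ?s (i + 1)) (?s (i + 1) \<otimes> ?t (i + 2) \<otimes> ?s (i + 1))"
      using i s_square[of "i + 1"] by (intro commute_conj_involution) auto
    moreover have "?s (i + 1) \<otimes> ?t i \<otimes> ?s (i + 1) = ?t i"
      using i by (intro conj_involution_commute s_t_commute s_square) auto
    ultimately show ?case
      using t_conj[of "i + 1"] i by simp
  qed
qed

lemma t_t_commute_less:
  assumes "1 \<le> i" "i < j" "j \<le> n"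
  shows "commute (\<phi> (Gt i)) (\<phi> (Gt j))"
proof -
  have "Suc i \<le> j" using assms by simp
  then show ?thesis using assms(3)
  proof (induction j rule: dec_induct)
    case base
    then show ?case using t_t_commute_next assms by simp
  next
    case (step j)
    have "commute (\<phi> (Gs j) \<otimes> \<phi> (Gt i) \<otimes> \<phi> (Gs j)) (\<phi> (Gs j) \<otimes> \<phi> (Gt j) \<otimes> \<phi> (Gs j))"
      using step s_square[of j] assms by (intro commute_conj_involution) auto
    moreover have "\<phi> (Gs j) \<otimes> \<phi> (Gt i) \<otimes> \<phi> (Gs j) = \<phi> (Gt i)"
      using step assms by (intro conj_involution_commute s_t_commute s_square) auto
    ultimately show ?case using t_conj'[of j] step assms by simp
  qed
qed

lemma t_t_commute:
  assumes "1 \<le> i" "i \<le> n" "1 \<le> j" "j \<le> n"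
  shows "commute (\<phi> (Gt i)) (\<phi> (Gt j))"
  using assms t_t_commute_less[of i j] t_t_commute_less[of j i]
  by (cases i j rule: linorder_cases) (auto intro: commute_sym)

text \<open>Positive words suffice for a subgroup because the generators have finite order.\<close>

definition standard_subgroup :: "nat \<Rightarrow> 'a set" where
  "standard_subgroup m = word_prod \<phi> ` lists (imprim_gens m)"

lemma standard_subgroup_closed: "h \<in> standard_subgroup m \<Longrightarrow> h \<in> carrier G"
  by (auto simp: standard_subgroup_def)

lemma standard_subgroup_one: "\<one> \<in> standard_subgroup m"
  unfolding standard_subgroup_def by (intro image_eqI[of _ _ "[]"]) auto

lemma standard_subgroup_mult:
  assumes "g \<in> standard_subgroup m" "h \<in> standard_subgroup m"
  shows "g \<otimes> h \<in> standard_subgroup m"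
proof -
  obtain u v where "u \<in> lists (imprim_gens m)" "v \<in> lists (imprim_gens m)"
    "g = word_prod \<phi> u" "h = word_prod \<phi> v"
    using assms by (auto simp: standard_subgroup_def)
  then show ?thesis
    unfolding standard_subgroup_def by (intro image_eqI[of _ _ "u @ v"]) (auto simp: word_prod_append)
qed

lemma standard_subgroup_gen: "x \<in> imprim_gens m \<Longrightarrow> \<phi> x \<in> standard_subgroup m"
  unfolding standard_subgroup_def by (intro image_eqI[of _ _ "[x]"]) auto

lemma standard_subgroup_mono: "m \<le> m' \<Longrightarrow> standard_subgroup m \<subseteq> standard_subgroup m'"
  unfolding standard_subgroup_def using imprim_gens_mono lists_mono by (intro image_mono) blast

lemma standard_subgroup_0: "standard_subgroup 0 = {\<one>}"
  by (auto simp: standard_subgroup_def imprim_gens_def)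

lemma standard_subgroup_commute_s:
  assumes "h \<in> standard_subgroup m" "m < i" "i < n"
  shows "commute (\<phi> (Gs i)) h"
proof -
  have "commute (\<phi> (Gs i)) (\<phi> x)" if "x \<in> imprim_gens m" for x
    using that assms by (cases x) (auto intro!: s_s_commute s_t_commute)
  then show ?thesis
    using assms(1) unfolding standard_subgroup_def by (auto intro!: commute_word_prod)
qed

lemma standard_subgroup_commute_t:
  assumes "h \<in> standard_subgroup m" "m < i" "i \<le> n"
  shows "commute (\<phi> (Gt i)) h"
proof -
  have "commute (\<phi> (Gt i)) (\<phi> x)" if "x \<in> imprim_gens m" for x
    using that assms by (cases x) (auto intro!: t_t_commute commute_sym[OF s_t_commute])
  then show ?thesis
    using assms(1) unfolding standard_subgroup_def by (auto intro!: commute_word_prod)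
qed

text \<open>The union on the right contains the unit, so it is enough that right multiplication by generators
preserves it. The only case with content is \<open>h s\<^sub>m k s\<^sub>m\<close> with \<open>k\<close> in the subgroup one level below:
apply the decomposition to \<open>k\<close>. Either \<open>k = k' t\<^sub>m\<^sup>c\<close>, and conjugation by \<open>s\<^sub>m\<close> turns
\<open>t\<^sub>m\<close> into \<open>t\<^sub>m\<^sub>+\<^sub>1\<close>, or \<open>k = a s\<^sub>m\<^sub>-\<^sub>1 b\<close>, and the braid relation applies.\<close>

lemma standard_subgroup_double_coset:
  assumes "g \<in> standard_subgroup (Suc m)" "Suc m \<le> n"
  shows "(\<exists>h\<in>standard_subgroup m. \<exists>c. g = h \<otimes> \<phi> (Gt (Suc m)) [^] (c :: nat)) \<or>
    (m > 0 \<and> (\<exists>h\<in>standard_subgroup m. \<exists>k\<in>standard_subgroup m. g = h \<otimes> \<phi> (Gs m) \<otimes> k))" (is "?P m g")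
  using assms
proof (induction m arbitrary: g)
  case 0
  have step: "\<exists>c. word_prod \<phi> w = \<phi> (Gt 1) [^] (c :: nat)"
    if "w \<in> lists (imprim_gens 1)" for w
    using that
  proof (induction w)
    case Nil
    show ?case by (intro exI[of _ 0]) simp
  next
    case (Cons x w)
    then obtain c :: nat where "word_prod \<phi> w = \<phi> (Gt 1) [^] c" by auto
    moreover have "x = Gt 1" using Cons by (auto simp: imprim_gens_def)
    ultimately show ?case by (intro exI[of _ "Suc c"]) (simp add: pow_commute_self)
  qed
  from 0 obtain w where "w \<in> lists (imprim_gens 1)" "g = word_prod \<phi> w"
    by (auto simp: standard_subgroup_def)
  with step obtain c :: nat where "g = \<phi> (Gt 1) [^] c" by metis
  then have "g = \<one> \<otimes> \<phi> (Gt (Suc 0)) [^] c" by simp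
  then show ?case using standard_subgroup_one by blast
next
  case (Suc m)
  let ?s = "\<phi> (Gs (Suc m))" and ?t = "\<phi> (Gt (Suc (Suc m)))"
  have n: "Suc (Suc m) \<le> n" by fact
  have tH: "commute ?t h" if "h \<in> standard_subgroup (Suc m)" for h
    using that n by (intro standard_subgroup_commute_t) auto
  have sH: "commute ?s h" if "h \<in> standard_subgroup m" for h
    using that n by (intro standard_subgroup_commute_s) auto
  have HmHSm: "h \<in> standard_subgroup (Suc m)" if "h \<in> standard_subgroup m" for h
    using that standard_subgroup_mono[of m "Suc m"] by auto
  have ss: "?s \<otimes> ?s = \<one>" using n by (intro s_square) auto
  have sts: "?s \<otimes> \<phi> (Gt (Suc m)) = ?t \<otimes> ?s" "?s \<otimes> ?t = \<phi> (Gt (Suc m)) \<otimes> ?s"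
    using s_t_swap[of "Suc m"] n by auto
  have spow: "?s \<otimes> \<phi> (Gt (Suc m)) [^] c = ?t [^] c \<otimes> ?s" "?s \<otimes> ?t [^] c = \<phi> (Gt (Suc m)) [^] c \<otimes> ?s"
    for c :: nat
  proof (induction c)
    case (Suc c)
    case 1
    have "?s \<otimes> \<phi> (Gt (Suc m)) [^] Suc c = (?s \<otimes> \<phi> (Gt (Suc m)) [^] c) \<otimes> \<phi> (Gt (Suc m))"
      by (simp add: m_assoc)
    also have "\<dots> = ?t [^] c \<otimes> (?s \<otimes> \<phi> (Gt (Suc m)))"
      by (simp add: Suc m_assoc)
    finally show ?case by (simp add: sts m_assoc)
    case 2
    have "?s \<otimes> ?t [^] Suc c = (?s \<otimes> ?t [^] c) \<otimes> ?t"
      by (simp add: m_assoc)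
    also have "\<dots> = \<phi> (Gt (Suc m)) [^] c \<otimes> (?s \<otimes> ?t)"
      by (simp add: Suc m_assoc)
    finally show ?case by (simp add: sts m_assoc)
  qed auto
  \<comment> \<open>The union is stable under right multiplication by the generators of the larger subgroup.\<close>
  have right_mult: "?P (Suc m) (g \<otimes> \<phi> x)"
    if g: "?P (Suc m) g" and x: "x \<in> imprim_gens (Suc (Suc m))" for g x
    using g
  proof (elim disjE bexE exE conjE)
    fix h and c :: nat
    assume h: "h \<in> standard_subgroup (Suc m)" and g: "g = h \<otimes> ?t [^] c"
    have hc: "h \<in> carrier G" using h standard_subgroup_closed by blast
    from x consider "x = Gt (Suc (Suc m))" | "x = Gs (Suc m)" | "x \<in> imprim_gens (Suc m)"
      unfolding imprim_gens_Suc[of "Suc m"] by auto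
    then show ?thesis
    proof cases
      case 1
      then have "g \<otimes> \<phi> x = h \<otimes> ?t [^] Suc c" using g hc by (simp add: m_assoc)
      then show ?thesis using h by blast
    next
      case 2
      have "?t [^] c \<otimes> ?s = ?s \<otimes> \<phi> (Gt (Suc m)) [^] c" by (simp add: spow)
      then have "g \<otimes> \<phi> x = h \<otimes> ?s \<otimes> \<phi> (Gt (Suc m)) [^] c"
        using g 2 hc by (simp add: m_assoc)
      moreover have "\<phi> (Gt (Suc m)) [^] c \<in> standard_subgroup (Suc m)"
        by (induction c) (auto intro!: standard_subgroup_mult standard_subgroup_gen intro: standard_subgroup_one)
      ultimately show ?thesis using h by blast
    next
      case 3
      have "commute (\<phi> x) (?t [^] c)"
        using tH[OF standard_subgroup_gen[OF 3]] by (intro commute_pow) (auto intro: commute_sym)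
      then have "g \<otimes> \<phi> x = h \<otimes> \<phi> x \<otimes> ?t [^] c"
        using g hc by (simp add: m_assoc commute_def)
      then show ?thesis using standard_subgroup_mult[OF h standard_subgroup_gen[OF 3]] by blast
    qed
  next
    fix h k
    assume h: "h \<in> standard_subgroup (Suc m)" and k: "k \<in> standard_subgroup (Suc m)" and g: "g = h \<otimes> ?s \<otimes> k"
    have cl: "h \<in> carrier G" "k \<in> carrier G" using h k standard_subgroup_closed by blast+
    from x consider "x = Gt (Suc (Suc m))" | "x = Gs (Suc m)" | "x \<in> imprim_gens (Suc m)"
      unfolding imprim_gens_Suc[of "Suc m"] by auto
    then show ?thesis
    proof cases
      case 1
      have "g \<otimes> \<phi> x = h \<otimes> ?s \<otimes> (?t \<otimes> k)"
        using tH[OF k] g 1 cl by (simp add: m_assoc commute_def)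
      also have "\<dots> = h \<otimes> (?s \<otimes> ?t) \<otimes> k"
        using cl by (simp add: m_assoc)
      also have "\<dots> = (h \<otimes> \<phi> (Gt (Suc m))) \<otimes> ?s \<otimes> k"
        using cl by (simp add: sts m_assoc)
      finally show ?thesis using k standard_subgroup_mult[OF h standard_subgroup_gen[of "Gt (Suc m)"]] by auto
    next
      case 2
      from Suc.IH[OF k] n have "?P m k" by simp
      then show ?thesis
      proof (elim disjE bexE exE conjE)
        fix k' and c :: nat
        assume k': "k' \<in> standard_subgroup m" and keq: "k = k' \<otimes> \<phi> (Gt (Suc m)) [^] c"
        have cl': "k' \<in> carrier G" using k' standard_subgroup_closed by blast
        have "g \<otimes> \<phi> x = h \<otimes> (?s \<otimes> k') \<otimes> (\<phi> (Gt (Suc m)) [^] c \<otimes> ?s)"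
          using g 2 cl cl' by (simp add: keq m_assoc)
        also have "\<dots> = h \<otimes> (k' \<otimes> ?s) \<otimes> (?s \<otimes> ?t [^] c)"
          using sH[OF k'] by (simp add: spow commute_def)
        also have "\<dots> = h \<otimes> k' \<otimes> (?s \<otimes> ?s) \<otimes> ?t [^] c"
          using cl cl' by (simp add: m_assoc)
        also have "\<dots> = h \<otimes> k' \<otimes> ?t [^] c"
          using cl cl' ss by simp
        finally show ?thesis using standard_subgroup_mult[OF h HmHSm[OF k']] by blast
      next
        fix a b
        assume m: "m > 0" and a: "a \<in> standard_subgroup m" and b: "b \<in> standard_subgroup m" and keq: "k = a \<otimes> \<phi> (Gs m) \<otimes> b"
        have cl': "a \<in> carrier G" "b \<in> carrier G" using a b standard_subgroup_closed by blast+
        have "g \<otimes> \<phi> x = h \<otimes> (?s \<otimes> a) \<otimes> \<phi> (Gs m) \<otimes> (b \<otimes> ?s)"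
          using g 2 cl cl' by (simp add: keq m_assoc)
        also have "\<dots> = h \<otimes> (a \<otimes> ?s) \<otimes> \<phi> (Gs m) \<otimes> (?s \<otimes> b)"
          using sH[OF a] sH[OF b] by (simp add: commute_def)
        also have "\<dots> = h \<otimes> a \<otimes> (?s \<otimes> \<phi> (Gs m) \<otimes> ?s) \<otimes> b"
          using cl cl' by (simp add: m_assoc)
        also have "?s \<otimes> \<phi> (Gs m) \<otimes> ?s = \<phi> (Gs m) \<otimes> ?s \<otimes> \<phi> (Gs m)"
          using braid[of m] m n by simp
        also have "h \<otimes> a \<otimes> (\<phi> (Gs m) \<otimes> ?s \<otimes> \<phi> (Gs m)) \<otimes> b =
            (h \<otimes> a \<otimes> \<phi> (Gs m)) \<otimes> ?s \<otimes> (\<phi> (Gs m) \<otimes> b)"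
          using cl cl' by (simp add: m_assoc)
        finally have "g \<otimes> \<phi> x = (h \<otimes> a \<otimes> \<phi> (Gs m)) \<otimes> ?s \<otimes> (\<phi> (Gs m) \<otimes> b)" .
        moreover have "\<phi> (Gs m) \<in> standard_subgroup (Suc m)" using m by (intro standard_subgroup_gen) auto
        then have "h \<otimes> a \<otimes> \<phi> (Gs m) \<in> standard_subgroup (Suc m)" "\<phi> (Gs m) \<otimes> b \<in> standard_subgroup (Suc m)"
          using h a b HmHSm standard_subgroup_mult by auto
        ultimately show ?thesis by blast
      qed
    next
      case 3
      have "g \<otimes> \<phi> x = h \<otimes> ?s \<otimes> (k \<otimes> \<phi> x)"
        using g cl by (simp add: m_assoc)
      then show ?thesis using h standard_subgroup_mult[OF k standard_subgroup_gen[OF 3]] by blast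
    qed
  qed
  have "?P (Suc m) (word_prod \<phi> w)" if "w \<in> lists (imprim_gens (Suc (Suc m)))" for w
    using that
  proof (induction w rule: rev_induct)
    case Nil
    have "\<one> = \<one> \<otimes> ?t [^] (0 :: nat)" by simp
    then show ?case using standard_subgroup_one by (metis word_prod_simps(1))
  next
    case (snoc x w)
    then have "?P (Suc m) (word_prod \<phi> w \<otimes> \<phi> x)"
      by (intro right_mult) auto
    then show ?case by (simp add: word_prod_append)
  qed
  then show ?case using Suc.prems(1) unfolding standard_subgroup_def[of "Suc (Suc m)"] by blast
qed

lemma t_pow_mod:
  assumes "1 \<le> j" "j \<le> n"
  shows "\<phi> (Gt j) [^] c = \<phi> (Gt j) [^] (c mod r)"
proof -
  have "\<phi> (Gt j) [^] c = \<phi> (Gt j) [^] (r * (c div r) + c mod r)" by simp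
  also have "\<dots> = (\<phi> (Gt j) [^] r) [^] (c div r) \<otimes> \<phi> (Gt j) [^] (c mod r)"
    by (simp only: nat_pow_mult[symmetric] nat_pow_pow closed)
  finally show ?thesis using t_power[OF assms] by simp
qed

lemma finite_standard_subgroup: "m \<le> n \<Longrightarrow> finite (standard_subgroup m)"
proof (induction m)
  case 0
  then show ?case by (simp add: standard_subgroup_0)
next
  case (Suc m)
  let ?A = "(\<lambda>(h, c). h \<otimes> \<phi> (Gt (Suc m)) [^] c) ` (standard_subgroup m \<times> {..<r})"
  let ?B = "(\<lambda>(h, k). h \<otimes> \<phi> (Gs m) \<otimes> k) ` (standard_subgroup m \<times> standard_subgroup m)"
  have "standard_subgroup (Suc m) \<subseteq> ?A \<union> ?B"
  proof
    fix g assume "g \<in> standard_subgroup (Suc m)"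
    from standard_subgroup_double_coset[OF this Suc.prems] show "g \<in> ?A \<union> ?B"
    proof (elim disjE bexE exE conjE)
      fix h and c :: nat assume h: "h \<in> standard_subgroup m" "g = h \<otimes> \<phi> (Gt (Suc m)) [^] c"
      then have "g = h \<otimes> \<phi> (Gt (Suc m)) [^] (c mod r)"
        using t_pow_mod[of "Suc m" c] Suc.prems by simp
      then have "g \<in> ?A" using h r_pos by (intro image_eqI[of _ _ "(h, c mod r)"]) auto
      then show ?thesis by blast
    next
      fix h k assume "h \<in> standard_subgroup m" "k \<in> standard_subgroup m" "g = h \<otimes> \<phi> (Gs m) \<otimes> k"
      then have "g \<in> ?B" by (intro image_eqI[of _ _ "(h, k)"]) auto
      then show ?thesis by blast
    qed
  qed
  moreover have "finite (?A \<union> ?B)" using Suc by auto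
  ultimately show ?case by (rule finite_subset)
qed

lemma finite_carrier: "finite (carrier G)"
  using finite_standard_subgroup[of n] generated by (simp add: standard_subgroup_def)

end

section \<open>Block words represent all conjugacy classes\<close>

text \<open>The words \<open>t\<^sub>a\<^sup>c s\<^sub>a \<dots> s\<^sub>b\<^sub>-\<^sub>1\<close> over consecutive intervals \<open>[a, b]\<close>, concatenated from left to
right; in the rule the new interval is \<open>[a + 1, b]\<close>.\<close>

inductive block_word :: "nat \<Rightarrow> gen list \<Rightarrow> bool" where
  block_word_Nil: "block_word 0 []"
| block_word_append: "block_word a w \<Longrightarrow> a < b \<Longrightarrow>
    block_word b (w @ replicate c (Gt (Suc a)) @ map Gs [Suc a..<b])"

text \<open>The last property says that \<open>t\<^sub>i\<^sub>+\<^sub>1\<close> occurs only if a block starts at \<open>i + 1\<close>, in which case the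
letter \<open>s\<^sub>i\<close> joining it to the previous index is absent.\<close>

lemma block_word_content:
  assumes "block_word m w"
  shows "set w \<subseteq> imprim_gens m" "count (mset w) (Gs i) \<le> 1"
    "Gt (Suc i) \<in> set w \<Longrightarrow> Gs i \<notin> set w"
  using assms
proof (induction arbitrary: i)
  case (block_word_append a w b c)
  { case 1 show ?case using block_word_append imprim_gens_mono[of a b] by auto
  next
    case 2
    let ?v = "map Gs [Suc a..<b]"
    have "distinct ?v" by (simp add: distinct_map inj_on_def)
    then have "count (mset ?v) (Gs i) \<le> 1"
      unfolding distinct_count_atmost_1 by simp
    moreover have "count (mset w) (Gs i) = 0 \<or> count (mset ?v) (Gs i) = 0"
    proof (cases "Gs i \<in> set ?v")
      case True
      then have "Gs i \<notin> set w" using block_word_append.IH(1) by force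
      then show ?thesis by (simp only: count_mset_0_iff simp_thms)
    qed (simp only: count_mset_0_iff simp_thms)
    moreover have "count (mset (w @ replicate c (Gt (Suc a)) @ ?v)) (Gs i) =
        count (mset w) (Gs i) + count (mset ?v) (Gs i)"
      by simp
    ultimately show ?case using block_word_append.IH(2)[of i] by linarith
  next
    case 3
    then show ?case using block_word_append.IH(1) block_word_append.IH(3)[of i] by force
  }
qed auto

context imprimitive_relations
begin

text \<open>Elements of the form \<open>h s\<^sub>j\<^sub>+\<^sub>1 \<dots> s\<^sub>m\<^sub>-\<^sub>1\<close> with \<open>h\<close> in \<open>G\<^sub>j\<^sub>+\<^sub>1\<close> are treated by induction on
\<open>j\<close>. Decompose \<open>h\<close>. If \<open>h = h' t\<^sub>j\<^sub>+\<^sub>1\<^sup>c\<close>, then \<open>h'\<close> lies in \<open>G\<^sub>j\<close>, which commutes with the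
remaining factor, a complete block; the outer induction brings \<open>h'\<close> into block form. If
\<open>h = a s\<^sub>j b\<close>, then \<open>b\<close> commutes with \<open>s\<^sub>j\<^sub>+\<^sub>1 \<dots> s\<^sub>m\<^sub>-\<^sub>1\<close> and can be moved cyclically to the front,
which leaves \<open>b a s\<^sub>j \<dots> s\<^sub>m\<^sub>-\<^sub>1\<close> with \<open>b a\<close> one level further down.\<close>

lemma block_word_conjugate:
  assumes "m \<le> n" "g \<in> standard_subgroup m"
  shows "\<exists>z\<in>standard_subgroup m. \<exists>w. block_word m w \<and> g \<otimes> z = z \<otimes> word_prod \<phi> w"
  using assms
proof (induction m arbitrary: g rule: less_induct)
  case (less m)
  show ?case
  proof (cases m)
    case 0
    then have "g = \<one>" using less by (simp add: standard_subgroup_0)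
    then show ?thesis using 0 block_word_Nil standard_subgroup_one by (metis standard_subgroup_closed l_one r_one word_prod_simps(1))
  next
    case (Suc m')
    let ?C = "\<lambda>j. word_prod \<phi> (map Gs [Suc j..<m])"
    have C: "?C j = \<phi> (Gs (Suc j)) \<otimes> ?C (Suc j)" if "Suc j < m" for j
      using that by (simp add: upt_conv_Cons)
    have CH: "?C j \<in> standard_subgroup m" for j
      unfolding standard_subgroup_def by (intro image_eqI[OF refl]) auto
    have "\<exists>z\<in>standard_subgroup m. \<exists>w. block_word m w \<and> h \<otimes> ?C j \<otimes> z = z \<otimes> word_prod \<phi> w"
      if "h \<in> standard_subgroup (Suc j)" "j < m" for j h
      using that
    proof (induction j arbitrary: h)
      case 0
      from standard_subgroup_double_coset[OF 0(1)] 0 less.prems obtain c :: nat where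
        "h = \<phi> (Gt (Suc 0)) [^] c" by (auto simp: standard_subgroup_0)
      then have "h \<otimes> ?C 0 \<otimes> \<one> = \<one> \<otimes> word_prod \<phi> ([] @ replicate c (Gt (Suc 0)) @ map Gs [Suc 0..<m])"
        by (simp add: word_prod_append word_prod_replicate)
      moreover have "block_word m ([] @ replicate c (Gt (Suc 0)) @ map Gs [Suc 0..<m])"
        using 0 by (intro block_word_append block_word_Nil)
      ultimately show ?case using standard_subgroup_one by blast
    next
      case (Suc j)
      have jn: "Suc (Suc j) \<le> n" using Suc.prems less.prems by simp
      from standard_subgroup_double_coset[OF Suc.prems(1) jn] show ?case
      proof (elim disjE bexE exE conjE)
        fix h' and c :: nat
        assume h': "h' \<in> standard_subgroup (Suc j)" and h: "h = h' \<otimes> \<phi> (Gt (Suc (Suc j))) [^] c"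
        let ?v = "replicate c (Gt (Suc (Suc j))) @ map Gs [Suc (Suc j)..<m]"
        from less.IH[of "Suc j" h'] h' Suc.prems less.prems
        obtain z w where z: "z \<in> standard_subgroup (Suc j)" and w: "block_word (Suc j) w"
          and zw: "h' \<otimes> z = z \<otimes> word_prod \<phi> w" by auto
        have cl: "h' \<in> carrier G" "z \<in> carrier G" using h' z standard_subgroup_closed by blast+
        have "commute z (word_prod \<phi> ?v)"
          using Suc.prems less.prems standard_subgroup_commute_s[OF z] standard_subgroup_commute_t[OF z] cl
          by (intro commute_word_prod) (auto intro: commute_sym)
        moreover have "h \<otimes> ?C (Suc j) = h' \<otimes> word_prod \<phi> ?v"
          using cl by (simp add: h word_prod_append word_prod_replicate m_assoc)
        ultimately have "h \<otimes> ?C (Suc j) \<otimes> z = h' \<otimes> (z \<otimes> word_prod \<phi> ?v)"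
          using cl by (simp add: commute_def m_assoc)
        also have "\<dots> = (h' \<otimes> z) \<otimes> word_prod \<phi> ?v"
          using cl by (simp add: m_assoc)
        also have "\<dots> = z \<otimes> word_prod \<phi> (w @ ?v)"
          unfolding zw using cl by (simp add: word_prod_append m_assoc)
        finally have "h \<otimes> ?C (Suc j) \<otimes> z = z \<otimes> word_prod \<phi> (w @ ?v)" .
        moreover have "block_word m (w @ ?v)"
          using w Suc.prems by (intro block_word_append) auto
        moreover have "z \<in> standard_subgroup m" using z standard_subgroup_mono[of "Suc j" m] Suc.prems by auto
        ultimately show ?thesis by blast
      next
        fix a b
        assume a: "a \<in> standard_subgroup (Suc j)" and b: "b \<in> standard_subgroup (Suc j)" and h: "h = a \<otimes> \<phi> (Gs (Suc j)) \<otimes> b"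
        have cl: "a \<in> carrier G" "b \<in> carrier G" using a b standard_subgroup_closed by blast+
        from Suc.IH[of "b \<otimes> a"] a b standard_subgroup_mult Suc.prems obtain z w where
          z: "z \<in> standard_subgroup m" and w: "block_word m w" and zw: "b \<otimes> a \<otimes> ?C j \<otimes> z = z \<otimes> word_prod \<phi> w"
          by auto
        have zc: "z \<in> carrier G" using z standard_subgroup_closed by blast
        have "commute b (?C (Suc j))"
          using Suc.prems less.prems standard_subgroup_commute_s[OF b] cl
          by (intro commute_word_prod) (auto intro: commute_sym)
        then have "h \<otimes> ?C (Suc j) = a \<otimes> \<phi> (Gs (Suc j)) \<otimes> (?C (Suc j) \<otimes> b)"
          using cl by (simp add: h m_assoc commute_def)
        also have "\<dots> = a \<otimes> ?C j \<otimes> b"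
          using cl C[of j] Suc.prems by (simp add: m_assoc)
        finally have hC: "h \<otimes> ?C (Suc j) = a \<otimes> ?C j \<otimes> b" .
        have "h \<otimes> ?C (Suc j) \<otimes> (a \<otimes> ?C j \<otimes> z) = a \<otimes> ?C j \<otimes> (b \<otimes> a \<otimes> ?C j \<otimes> z)"
          unfolding hC using cl zc by (simp add: m_assoc)
        also have "\<dots> = (a \<otimes> ?C j \<otimes> z) \<otimes> word_prod \<phi> w"
          unfolding zw using cl zc by (simp add: m_assoc)
        finally have "h \<otimes> ?C (Suc j) \<otimes> (a \<otimes> ?C j \<otimes> z) = (a \<otimes> ?C j \<otimes> z) \<otimes> word_prod \<phi> w" .
        moreover have "a \<otimes> ?C j \<otimes> z \<in> standard_subgroup m"
          using a standard_subgroup_mono[of "Suc j" m] Suc.prems CH z by (intro standard_subgroup_mult) auto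
        ultimately show ?thesis using w by blast
      qed
    qed
    from this[of g m'] less.prems Suc show ?thesis
      using standard_subgroup_closed[of g] by simp
  qed
qed

text \<open>The elimination order is \<open>t\<^sub>1, \<dots>, t\<^sub>n, s\<^sub>1, \<dots>, s\<^sub>n\<close>, where the parent of \<open>t\<^sub>i\<close> is \<open>s\<^sub>i\<close> and the
parent of \<open>s\<^sub>i\<close> is \<open>s\<^sub>i\<^sub>+\<^sub>1\<close>. Letters \<open>s\<^sub>i\<close> missing from the word are inserted with value \<open>\<one>\<close>, so
that every parent occurs exactly once. The one further pair of letters that need not commute in the
group, \<open>t\<^sub>i\<^sub>+\<^sub>1\<close> and \<open>s\<^sub>i\<close>, never occurs together in a block word.\<close>

lemma class_function_block_word:
  fixes f :: "'a \<Rightarrow> 'c"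
  assumes f: "\<And>a b. a \<in> carrier G \<Longrightarrow> b \<in> carrier G \<Longrightarrow> f (a \<otimes> b) = f (b \<otimes> a)"
    and w: "block_word n w" and uw: "mset u = mset w" and n: "n > 0"
  shows "f (word_prod \<phi> u) = f (word_prod \<phi> w)"
proof -
  \<comment> \<open>The missing letters \<open>s\<^sub>i\<close>, always including \<open>s\<^sub>n\<close>; under \<open>\<psi>\<close> they have value \<open>\<one>\<close>.\<close>
  define M where "M = filter (\<lambda>x. x \<notin> set w) (map Gs [1..<Suc n])"
  define \<psi> where "\<psi> x = (if x \<in> set w then \<phi> x else \<one>)" for x
  define par where "par x = (case x of Gt i \<Rightarrow> Gs i | Gs i \<Rightarrow> Gs (Suc i))" for x
  define L where "L = map Gt [1..<Suc n] @ map Gs [1..<Suc n]"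
  have su: "set u = set w" using uw mset_eq_setD by blast
  have \<psi>: "\<psi> x \<in> carrier G" for x by (simp add: \<psi>_def)
  have drop_M: "word_prod \<psi> (M @ v) = word_prod \<phi> v" if "set v = set w" for v
  proof -
    have "word_prod \<psi> ys = \<one>" if "set ys \<subseteq> set M" for ys
      using that by (induction ys) (auto simp: \<psi>_def M_def)
    then have "word_prod \<psi> M = \<one>" by blast
    moreover have "word_prod \<psi> v = word_prod \<phi> v"
      using that by (intro word_prod_cong) (auto simp: \<psi>_def)
    ultimately show ?thesis by (simp add: word_prod_append \<psi>)
  qed
  note cont = block_word_content[OF w]
  have s_once: "count (mset (M @ u)) (Gs i) = 1" if "1 \<le> i" "i \<le> n" for i
  proof (cases "Gs i \<in> set w")
    case True
    then have "count (mset w) (Gs i) = 1"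
      using cont(2)[of i] count_mset_0_iff[of w "Gs i"] by linarith
    moreover have "Gs i \<notin> set M" using True by (auto simp: M_def)
    then have "count (mset M) (Gs i) = 0" by (simp only: count_mset_0_iff simp_thms)
    ultimately show ?thesis by (simp add: uw)
  next
    case False
    have "distinct M" by (auto simp: M_def distinct_map inj_on_def)
    moreover have "Gs i \<in> set M" using False that by (auto simp: M_def simp del: upt_Suc)
    ultimately have "count (mset M) (Gs i) = 1" by (simp add: distinct_count_atmost_1)
    moreover have "count (mset w) (Gs i) = 0" using False by (simp only: count_mset_0_iff simp_thms)
    ultimately show ?thesis by (simp add: uw)
  qed
  have len: "length L = 2 * n" by (simp add: L_def)
  have nth: "L ! i = (if i < n then Gt (Suc i) else Gs (Suc (i - n)))" if "i < 2 * n" for i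
    using that by (auto simp: L_def nth_append simp del: upt_Suc)
  have comm: "commute (\<psi> x) (\<psi> y)"
    if "x \<in> set w \<Longrightarrow> y \<in> set w \<Longrightarrow> commute (\<phi> x) (\<phi> y)" for x y
    using that by (auto simp: \<psi>_def commute_def)
  have "f (word_prod \<psi> (M @ u)) = f (word_prod \<psi> (M @ w))"
  proof (rule class_function_content[where f = f and \<phi> = \<psi> and L = L and par = par])
    show "f (a \<otimes> b) = f (b \<otimes> a)" if "a \<in> carrier G" "b \<in> carrier G" for a b
      using that by (rule f)
    show "\<psi> z \<in> carrier G" for z by (rule \<psi>)
    show "distinct L" by (auto simp: L_def distinct_map inj_on_def simp del: upt_Suc)
    show "mset (M @ u) = mset (M @ w)" using uw by simp
    have "x \<in> set L" if "x \<in> imprim_gens n" for x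
      using that by (cases x) (auto simp: L_def simp del: upt_Suc)
    then show "set (M @ u) \<subseteq> set L"
      using cont(1) su by (auto simp: M_def L_def simp del: upt_Suc)
    show "par (L ! i) \<in> set (drop (Suc i) L) \<and> count (mset (M @ u)) (par (L ! i)) = 1"
      if i: "Suc i < length L" for i
    proof -
      define j where "j = (if i < n then n + i else Suc i)"
      have j: "i < j" "j < 2 * n" using i n by (auto simp: j_def len)
      have par: "par (L ! i) = L ! j"
        using i j by (auto simp: nth len par_def j_def split: if_splits)
      have "drop (Suc i) L ! (j - Suc i) \<in> set (drop (Suc i) L)"
        using j by (intro nth_mem) (auto simp: len)
      then have "L ! j \<in> set (drop (Suc i) L)" using j by (simp add: len)
      moreover have "count (mset (M @ u)) (L ! j) = 1"
        using s_once[of "Suc (j - n)"] j by (auto simp: nth j_def)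
      ultimately show ?thesis using par by simp
    qed
    show "commute (\<psi> (L ! i)) (\<psi> (L ! j))"
      if ij: "i < j" "j < length L" "L ! j \<noteq> par (L ! i)" for i j
    proof (rule comm)
      assume mem: "L ! i \<in> set w" "L ! j \<in> set w"
      then have gens: "L ! i \<in> imprim_gens n" "L ! j \<in> imprim_gens n" using cont(1) by auto
      consider "j < n" | "i < n" "n \<le> j" | "n \<le> i" by linarith
      then show "commute (\<phi> (L ! i)) (\<phi> (L ! j))"
      proof cases
        case 1
        then show ?thesis using ij by (auto simp: nth intro!: t_t_commute)
      next
        case 2
        have "Suc i \<noteq> Suc (Suc (j - n))"
          using mem cont(3)[of "Suc (j - n)"] ij 2 by (auto simp: nth len)
        then show ?thesis using ij 2 gens
          by (auto simp: nth len par_def intro!: commute_sym[OF s_t_commute])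
      next
        case 3
        then show ?thesis using ij gens by (auto simp: nth len par_def intro!: s_s_commute)
      qed
    qed
  qed
  then show ?thesis using drop_M[of u] drop_M[of w] su by simp
qed

end

section \<open>From determinants to sums of characters over rearrangements\<close>

lemma upper_triangular_mult:
  assumes "A \<in> carrier_mat d d" "B \<in> carrier_mat d d" "upper_triangular A" "upper_triangular B"
  shows "upper_triangular (A * B)" "\<And>i. i < d \<Longrightarrow> (A * B) $$ (i, i) = A $$ (i, i) * B $$ (i, i)"
proof -
  have zero: "A $$ (i, k) * B $$ (k, j) = 0" if "i < d" "k < d" "k < i \<or> j < k" for i j k
    using that assms upper_triangularD[OF assms(3), of k i] upper_triangularD[OF assms(4), of j k] by auto
  show "upper_triangular (A * B)"
  proof (rule upper_triangularI)
    fix i j assume "j < i" "i < dim_row (A * B)"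
    then have ij: "j < i" "i < d" "j < d" using assms by auto
    have "(A * B) $$ (i, j) = (\<Sum>k<d. A $$ (i, k) * B $$ (k, j))"
      using ij by (intro mat_mult_index[OF assms(1,2)]) auto
    also have "\<dots> = 0"
      using ij by (intro sum.neutral ballI zero) auto
    finally show "(A * B) $$ (i, j) = 0" .
  qed
  show "(A * B) $$ (i, i) = A $$ (i, i) * B $$ (i, i)" if i: "i < d" for i
  proof -
    have "(A * B) $$ (i, i) = (\<Sum>k<d. A $$ (i, k) * B $$ (k, i))"
      using i by (intro mat_mult_index[OF assms(1,2)]) auto
    also have "\<dots> = (\<Sum>k\<in>{i}. A $$ (i, k) * B $$ (k, i))"
    proof (rule sum.mono_neutral_right)
      show "\<forall>k\<in>{..<d} - {i}. A $$ (i, k) * B $$ (k, i) = 0"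
        using i by (auto simp del: mult_eq_0_iff intro!: zero)
    qed (use i in auto)
    finally show ?thesis by simp
  qed
qed

lemma upper_triangular_pow:
  assumes "A \<in> carrier_mat d d" "upper_triangular A"
  shows "upper_triangular (A ^\<^sub>m k) \<and> (\<forall>i<d. (A ^\<^sub>m k) $$ (i, i) = A $$ (i, i) ^ k)"
proof (induction k)
  case 0
  then show ?case using assms by (auto simp: upper_triangular_def)
next
  case (Suc k)
  then show ?case
    using upper_triangular_mult[OF pow_carrier_mat[OF assms(1)] assms(1) _ assms(2), of k] by (simp add: power_commutes)
qed

lemma mtrace_pow_eigenvalues:
  assumes A: "A \<in> carrier_mat d d" and as: "char_poly A = (\<Prod>a\<leftarrow>as. [:- a, 1:])"
  shows "mtrace (A ^\<^sub>m k) = (\<Sum>a\<leftarrow>as. a ^ k)"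
proof -
  obtain U P Q where "schur_decomposition A as = (U, P, Q)" by (cases "schur_decomposition A as") auto
  from schur_decomposition[OF A as this] have sim: "similar_mat_wit A U P Q"
    and U: "upper_triangular U" "diag_mat U = as" by auto
  note w = similar_mat_witD2[OF A sim]
  have "mtrace (A ^\<^sub>m k) = mtrace (P * U ^\<^sub>m k * Q)"
    by (simp add: similar_mat_wit_pow_id[OF sim])
  also have "\<dots> = mtrace (U ^\<^sub>m k)"
    using w by (intro mtrace_conj[of _ d]) auto
  also have "\<dots> = (\<Sum>i<d. U $$ (i, i) ^ k)"
    using upper_triangular_pow[OF w(5) U(1), of k] w(5) by (simp add: mtrace_def)
  also have "\<dots> = (\<Sum>a\<leftarrow>as. a ^ k)"
    using w(5) unfolding U(2)[symmetric] diag_mat_def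
    by (simp add: sum_list_sum_nth atLeast0LessThan)
  finally show ?thesis .
qed

text \<open>Evaluating the characteristic polynomial at \<open>x\<close> is evaluating the determinant at \<open>- x\<close>, up to sign;
the power traces are the power sums of its roots.\<close>

lemma mtrace_pow_cong_det:
  assumes A: "A \<in> carrier_mat d d" and B: "B \<in> carrier_mat d d"
    and det: "\<And>x. det (x \<cdot>\<^sub>m 1\<^sub>m d + A) = det (x \<cdot>\<^sub>m 1\<^sub>m d + B)"
  shows "mtrace (A ^\<^sub>m k) = mtrace (B ^\<^sub>m k)"
proof -
  have *: "poly (char_poly M) x = (-1) ^ d * det ((- x) \<cdot>\<^sub>m 1\<^sub>m d + M)"
    if M: "M \<in> carrier_mat d d" for M :: "complex mat" and x
  proof -
    have "- char_matrix M x = (-1) \<cdot>\<^sub>m ((- x) \<cdot>\<^sub>m 1\<^sub>m d + M)"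
      using M by (intro eq_matI) (auto simp: char_matrix_def)
    then show ?thesis
      using char_poly_matrix[OF M, of x] M by (simp add: det_smult)
  qed
  have "char_poly A = char_poly B"
    by (rule poly_eq_poly_eq_iff[THEN iffD1]) (auto simp: *[OF A] *[OF B] det)
  with char_poly_factorized[OF A] show ?thesis
    using mtrace_pow_eigenvalues[OF A] mtrace_pow_eigenvalues[OF B] by metis
qed

lemma mat_sum_mat_sum:
  "mat_sum p q S (\<lambda>w. mat_sum p q I (F w)) = mat_sum p q (S \<times> I) (\<lambda>(w, x). F w x)"
  by (intro eq_matI) (auto simp: mat_sum_def sum.cartesian_product case_prod_unfold)

definition lists_of_length :: "'l set \<Rightarrow> nat \<Rightarrow> 'l list set" where
  "lists_of_length X k = {w. set w \<subseteq> X \<and> length w = k}"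

lemma bij_betw_snoc_lists_of_length: "bij_betw (\<lambda>(w, x). w @ [x]) (lists_of_length X k \<times> X) (lists_of_length X (Suc k))"
proof (rule bij_betwI[where g = "\<lambda>w. (butlast w, last w)"])
  show "(\<lambda>(w, x). w @ [x]) \<in> lists_of_length X k \<times> X \<rightarrow> lists_of_length X (Suc k)"
    by (auto simp: lists_of_length_def)
  show "(\<lambda>w. (butlast w, last w)) \<in> lists_of_length X (Suc k) \<rightarrow> lists_of_length X k \<times> X"
  proof (rule funcsetI)
    fix w assume w: "w \<in> lists_of_length X (Suc k)"
    then have "w \<noteq> []" by (auto simp: lists_of_length_def)
    then have "last w \<in> set w" by simp
    with w show "(butlast w, last w) \<in> lists_of_length X k \<times> X"
      by (auto simp: lists_of_length_def dest: in_set_butlastD)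
  qed
  show "(\<lambda>(w, x). w @ [x]) (butlast w, last w) = w" if "w \<in> lists_of_length X (Suc k)" for w
  proof -
    have "w \<noteq> []" using that by (auto simp: lists_of_length_def)
    then show ?thesis by simp
  qed
qed auto

lemma (in group) rep_pow_expand:
  assumes \<rho>: "is_rep G d \<rho>" and \<phi>: "\<And>x. \<phi> x \<in> carrier G"
  shows "mat_sum d d X (\<lambda>x. c x \<cdot>\<^sub>m \<rho> (\<phi> x)) ^\<^sub>m k =
    mat_sum d d (lists_of_length X k) (\<lambda>w. prod_list (map c w) \<cdot>\<^sub>m \<rho> (word_prod \<phi> w))"
    (is "?M ^\<^sub>m k = _")
proof (induction k)
  note R = \<rho>[unfolded is_rep_iff[OF is_group]]
  have M: "?M \<in> carrier_mat d d" by simp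
  {
    case 0
    have "lists_of_length X 0 = {[]}" by (auto simp: lists_of_length_def)
    then show ?case using R by (intro eq_matI) (auto simp: mat_sum_def)
  next
    case (Suc k)
    have smult_smult: "a \<cdot>\<^sub>m (b \<cdot>\<^sub>m W) = (a * b) \<cdot>\<^sub>m W" for a b and W :: "complex mat"
      by (intro eq_matI) auto
    have car: "\<rho> (\<phi> x) \<in> carrier_mat d d" "\<rho> (word_prod \<phi> w) \<in> carrier_mat d d" for x w
      using R \<phi> by auto
    let ?C = "\<lambda>w. prod_list (map c w)"
    have "?M ^\<^sub>m Suc k = mat_sum d d (lists_of_length X k) (\<lambda>w. ?C w \<cdot>\<^sub>m \<rho> (word_prod \<phi> w)) * ?M"
      using Suc by simp
    also have "\<dots> = mat_sum d d (lists_of_length X k) (\<lambda>w. (?C w \<cdot>\<^sub>m \<rho> (word_prod \<phi> w)) * ?M)"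
      using car by (intro mat_sum_mult_right M) auto
    also have "\<dots> = mat_sum d d (lists_of_length X k) (\<lambda>w. mat_sum d d X (\<lambda>x. (?C w \<cdot>\<^sub>m \<rho> (word_prod \<phi> w)) * (c x \<cdot>\<^sub>m \<rho> (\<phi> x))))"
      using car by (intro mat_sum_cong mat_sum_mult_left) auto
    also have "\<dots> = mat_sum d d (lists_of_length X k \<times> X) (\<lambda>(w, x). (?C w \<cdot>\<^sub>m \<rho> (word_prod \<phi> w)) * (c x \<cdot>\<^sub>m \<rho> (\<phi> x)))"
      by (rule mat_sum_mat_sum)
    also have "\<dots> = mat_sum d d (lists_of_length X k \<times> X) (\<lambda>wx. ?C (case wx of (w, x) \<Rightarrow> w @ [x]) \<cdot>\<^sub>m
        \<rho> (word_prod \<phi> (case wx of (w, x) \<Rightarrow> w @ [x])))"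
    proof (rule mat_sum_cong)
      fix wx assume "wx \<in> lists_of_length X k \<times> X"
      obtain w x where wx: "wx = (w, x)" by (cases wx)
      have "\<rho> (word_prod \<phi> (w @ [x])) = \<rho> (word_prod \<phi> w) * \<rho> (\<phi> x)"
        using R \<phi> by (simp add: word_prod_append)
      moreover have "(?C w \<cdot>\<^sub>m \<rho> (word_prod \<phi> w)) * (c x \<cdot>\<^sub>m \<rho> (\<phi> x)) =
          (?C w * c x) \<cdot>\<^sub>m (\<rho> (word_prod \<phi> w) * \<rho> (\<phi> x))"
        unfolding mult_smult_assoc_mat[OF car(2) smult_carrier_mat[OF car(1)]] mult_smult_distrib[OF car(2,1)]
        by (rule smult_smult)
      ultimately show "(case wx of (w, x) \<Rightarrow> (?C w \<cdot>\<^sub>m \<rho> (word_prod \<phi> w)) * (c x \<cdot>\<^sub>m \<rho> (\<phi> x))) =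
          ?C (case wx of (w, x) \<Rightarrow> w @ [x]) \<cdot>\<^sub>m \<rho> (word_prod \<phi> (case wx of (w, x) \<Rightarrow> w @ [x]))"
        by (simp add: wx)
    qed
    also have "\<dots> = mat_sum d d (lists_of_length X (Suc k)) (\<lambda>w. ?C w \<cdot>\<^sub>m \<rho> (word_prod \<phi> w))"
      by (rule mat_sum_reindex[OF bij_betw_snoc_lists_of_length, symmetric])
    finally show ?case .
  }
qed

lemma mtrace_mat_sum:
  assumes "\<And>h. h \<in> S \<Longrightarrow> F h \<in> carrier_mat d d"
  shows "mtrace (mat_sum d d S (\<lambda>h. c h \<cdot>\<^sub>m F h)) = (\<Sum>h\<in>S. c h * mtrace (F h))"
proof -
  have "mtrace (mat_sum d d S (\<lambda>h. c h \<cdot>\<^sub>m F h)) = (\<Sum>i<d. \<Sum>h\<in>S. c h * F h $$ (i, i))"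
  proof -
    have "(c h \<cdot>\<^sub>m F h) $$ (i, i) = c h * F h $$ (i, i)" if "h \<in> S" "i < d" for h i
      using assms[OF that(1)] that by auto
    then show ?thesis by (auto simp: mtrace_def mat_sum_def intro!: sum.cong)
  qed
  also have "\<dots> = (\<Sum>h\<in>S. \<Sum>i<d. c h * F h $$ (i, i))" by (rule sum.swap)
  also have "\<dots> = (\<Sum>h\<in>S. c h * mtrace (F h))"
    using assms by (intro sum.cong refl) (auto simp: mtrace_def sum_distrib_left)
  finally show ?thesis .
qed

text \<open>Both sides of the hypothesis are values of polynomials in \<open>y\<close>, whose coefficients are the sums in the
conclusion.\<close>

lemma graded_sum_eq:
  fixes a b :: "'i \<Rightarrow> complex" and wt :: "'i \<Rightarrow> nat"
  assumes fin: "finite S" and eq: "\<And>y. (\<Sum>w\<in>S. y ^ wt w * a w) = (\<Sum>w\<in>S. y ^ wt w * b w)"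
  shows "(\<Sum>w | w \<in> S \<and> wt w = m. a w) = (\<Sum>w | w \<in> S \<and> wt w = m. b w)"
proof -
  let ?p = "\<lambda>a. \<Sum>w\<in>S. monom (a w) (wt w)"
  have "poly (?p a) y = (\<Sum>w\<in>S. y ^ wt w * a w)" for a :: "'i \<Rightarrow> complex" and y
    by (simp add: poly_sum Polynomial.poly_monom mult.commute)
  then have "poly (?p a) = poly (?p b)" using eq by auto
  then have "?p a = ?p b" by (simp add: poly_eq_poly_eq_iff)
  moreover have "coeff (?p a) m = (\<Sum>w | w \<in> S \<and> wt w = m. a w)" for a :: "'i \<Rightarrow> complex"
    using fin by (simp add: coeff_sum sum.inter_filter)
  ultimately show ?thesis by metis
qed

lemma base_expansion_unique:
  fixes a b :: "nat \<Rightarrow> nat"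
  assumes "\<And>j. j < m \<Longrightarrow> a j < N" "\<And>j. j < m \<Longrightarrow> b j < N"
    and "(\<Sum>j<m. a j * N ^ j) = (\<Sum>j<m. b j * N ^ j)" and "j < m"
  shows "a j = b j"
  using assms
proof (induction m arbitrary: j)
  case (Suc m)
  have lt: "(\<Sum>j<m. c j * N ^ j) < N ^ m" if "\<And>j. j < m \<Longrightarrow> c j < N" for c m
    using that
  proof (induction m)
    case (Suc m)
    have "(\<Sum>j<Suc m. c j * N ^ j) < N ^ m + c m * N ^ m"
      using Suc by simp
    also have "\<dots> = Suc (c m) * N ^ m" by simp
    also have "\<dots> \<le> N * N ^ m" using Suc.prems[of m] by (intro mult_right_mono) auto
    finally show ?case by simp
  qed auto
  have N: "N > 0" using Suc.prems(1)[of 0] by simp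
  let ?A = "\<Sum>j<m. a j * N ^ j" and ?B = "\<Sum>j<m. b j * N ^ j"
  have AB: "?A < N ^ m" "?B < N ^ m" using Suc.prems(1,2) by (auto intro!: lt)
  have eq: "?A + a m * N ^ m = ?B + b m * N ^ m" using Suc.prems(3) by simp
  have "(?A + a m * N ^ m) div N ^ m = a m" "(?B + b m * N ^ m) div N ^ m = b m"
    using AB N by simp_all
  with eq have m: "a m = b m" by metis
  with eq have "?A = ?B" by simp
  with Suc m show ?case by (cases "j = m") auto
qed auto

text \<open>The weight of a word is the number whose digits in base \<open>N\<close> are the multiplicities of its letters,
which are smaller than \<open>N\<close>.\<close>

lemma kronecker_weight_inj:
  fixes ix :: "'l \<Rightarrow> nat"
  assumes inj: "inj_on ix X" and X: "set u \<subseteq> X" "set v \<subseteq> X"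
    and len: "length u < N" "length v < N"
    and eq: "(\<Sum>x\<leftarrow>u. N ^ ix x) = (\<Sum>x\<leftarrow>v. N ^ ix x)"
  shows "mset u = mset v"
proof -
  define m where "m = Suc (Max (insert 0 (ix ` (set u \<union> set v))))"
  have ub: "ix x < m" if "x \<in> set u \<union> set v" for x
    using that by (auto simp: m_def less_Suc_eq_le intro!: Max_ge)
  have sum: "(\<Sum>x\<leftarrow>w. N ^ ix x) = (\<Sum>j<m. count (mset (map ix w)) j * N ^ j)"
    if "\<forall>x\<in>set w. ix x < m" for w
    using that
  proof (induction w)
    case (Cons x w)
    have "(\<Sum>j<m. count (mset (map ix (x # w))) j * N ^ j) =
        (\<Sum>j<m. (if j = ix x then N ^ j else 0) + count (mset (map ix w)) j * N ^ j)"
      by (intro sum.cong) auto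
    also have "\<dots> = N ^ ix x + (\<Sum>j<m. count (mset (map ix w)) j * N ^ j)"
      using Cons.prems by (simp add: sum.distrib)
    finally show ?case using Cons by simp
  qed auto
  have cnt: "count (mset w) x \<le> length w" for w and x :: 'b by (metis count_le_size size_mset)
  have "count (mset (map ix u)) j = count (mset (map ix v)) j" for j
  proof (cases "j < m")
    case True
    show ?thesis
    proof (rule base_expansion_unique[of m "count (mset (map ix u))" N "count (mset (map ix v))"])
      show "count (mset (map ix u)) j < N" "count (mset (map ix v)) j < N" for j
        using cnt[of "map ix u" j] cnt[of "map ix v" j] len by auto
      show "(\<Sum>j<m. count (mset (map ix u)) j * N ^ j) = (\<Sum>j<m. count (mset (map ix v)) j * N ^ j)"
        using eq sum[of u] sum[of v] ub by simp
    qed fact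
  next
    case False
    then have "j \<notin> ix ` set u" "j \<notin> ix ` set v" using ub by auto
    then show ?thesis by (simp add: count_eq_zero_iff[THEN iffD2])
  qed
  then have "image_mset ix (mset u) = image_mset ix (mset v)"
    by (intro multiset_eqI) simp
  then have "image_mset (the_inv_into X ix) (image_mset ix (mset u)) =
      image_mset (the_inv_into X ix) (image_mset ix (mset v))" by simp
  moreover have "image_mset (the_inv_into X ix) (image_mset ix (mset w)) = mset w" if "set w \<subseteq> X" for w
    unfolding multiset.map_comp o_def
    using that by (intro multiset.map_ident_strong the_inv_into_f_f[OF inj]) auto
  ultimately show ?thesis using X by simp
qed

section \<open>Evaluating the characteristic polynomial\<close>

definition monomial_eval :: "(nat \<Rightarrow> complex) \<Rightarrow> (nat \<Rightarrow>\<^sub>0 nat) \<Rightarrow> complex" where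
  "monomial_eval f m = (\<Prod>i\<in>Poly_Mapping.keys m. f i ^ Poly_Mapping.lookup m i)"

definition cpoly_eval :: "(nat \<Rightarrow> complex) \<Rightarrow> cpoly \<Rightarrow> complex" where
  "cpoly_eval f p = (\<Sum>m\<in>Poly_Mapping.keys p. Poly_Mapping.lookup p m * monomial_eval f m)"

lemma monomial_eval_superset:
  "finite A \<Longrightarrow> Poly_Mapping.keys m \<subseteq> A \<Longrightarrow> monomial_eval f m = (\<Prod>i\<in>A. f i ^ Poly_Mapping.lookup m i)"
  unfolding monomial_eval_def by (rule prod.mono_neutral_left) (auto simp: in_keys_iff)

lemma monomial_eval_add: "monomial_eval f (m + m') = monomial_eval f m * monomial_eval f m'"
proof -
  let ?A = "Poly_Mapping.keys m \<union> Poly_Mapping.keys m'"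
  have "monomial_eval f (m + m') = (\<Prod>i\<in>?A. f i ^ Poly_Mapping.lookup (m + m') i)"
    using keys_add[of m m'] by (intro monomial_eval_superset) auto
  also have "\<dots> = (\<Prod>i\<in>?A. f i ^ Poly_Mapping.lookup m i) * (\<Prod>i\<in>?A. f i ^ Poly_Mapping.lookup m' i)"
    by (simp add: lookup_add power_add prod.distrib)
  finally show ?thesis
    using monomial_eval_superset[of ?A m f] monomial_eval_superset[of ?A m' f] by simp
qed

lemma cpoly_eval_single: "cpoly_eval f (Poly_Mapping.single m c) = c * monomial_eval f m"
  by (simp add: cpoly_eval_def)

lemma cpoly_eval_zero: "cpoly_eval f 0 = 0"
  by (simp add: cpoly_eval_def)

lemma cpoly_eval_add: "cpoly_eval f (p + q) = cpoly_eval f p + cpoly_eval f q"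
  unfolding cpoly_eval_def
  by (rule setsum_keys_plus_distrib[where f = "\<lambda>m c. c * monomial_eval f m"]) (auto simp: algebra_simps)

lemma cpoly_eval_sum: "cpoly_eval f (\<Sum>i\<in>I. p i) = (\<Sum>i\<in>I. cpoly_eval f (p i))"
  by (induction I rule: infinite_finite_induct) (auto simp: cpoly_eval_zero cpoly_eval_add)

lemma cpoly_monomials: "p = (\<Sum>m\<in>Poly_Mapping.keys p. Poly_Mapping.single m (Poly_Mapping.lookup p m))"
proof (rule poly_mapping_eqI)
  show "Poly_Mapping.lookup p k = Poly_Mapping.lookup (\<Sum>m\<in>Poly_Mapping.keys p. Poly_Mapping.single m (Poly_Mapping.lookup p m)) k" for k
    by (simp add: lookup_sum lookup_single when_def in_keys_iff)
qed

lemma cpoly_eval_mult: "cpoly_eval f (p * q) = cpoly_eval f p * cpoly_eval f q"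
proof -
  have "p * q = (\<Sum>m\<in>Poly_Mapping.keys p. Poly_Mapping.single m (Poly_Mapping.lookup p m)) *
      (\<Sum>l\<in>Poly_Mapping.keys q. Poly_Mapping.single l (Poly_Mapping.lookup q l))"
    by (simp only: cpoly_monomials[symmetric])
  also have "\<dots> = (\<Sum>m\<in>Poly_Mapping.keys p. \<Sum>l\<in>Poly_Mapping.keys q. Poly_Mapping.single (m + l) (Poly_Mapping.lookup p m * Poly_Mapping.lookup q l))"
    by (simp add: sum_product mult_single)
  also have "cpoly_eval f \<dots> =
      (\<Sum>m\<in>Poly_Mapping.keys p. \<Sum>l\<in>Poly_Mapping.keys q. (Poly_Mapping.lookup p m * monomial_eval f m) * (Poly_Mapping.lookup q l * monomial_eval f l))"
    by (simp add: cpoly_eval_sum cpoly_eval_single monomial_eval_add mult_ac)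
  also have "\<dots> = cpoly_eval f p * cpoly_eval f q"
    by (simp add: cpoly_eval_def sum_product)
  finally show ?thesis .
qed

lemma cpoly_eval_hom: "comm_ring_hom (cpoly_eval f)"
proof
  have "cpoly_eval f (Poly_Mapping.single 0 1) = 1"
    by (simp only: cpoly_eval_single) (simp add: monomial_eval_def)
  then show "cpoly_eval f 1 = 1" by simp
qed (auto simp: cpoly_eval_add cpoly_eval_mult cpoly_eval_zero)

lemma cpoly_eval_var: "cpoly_eval f (poly_var i) = f i"
  by (simp add: poly_var_def cpoly_eval_single monomial_eval_def)

lemma cpoly_eval_const: "cpoly_eval f (poly_const c) = c"
  by (simp add: poly_const_def cpoly_eval_single monomial_eval_def)

lemma poly_const_hom: "inj_comm_ring_hom poly_const"
proof unfold_locales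
  show "x = 0" if "poly_const x = 0" for x
    using that unfolding poly_const_def by (metis lookup_single_eq lookup_zero)
qed (auto simp: poly_const_def single_add mult_single)

fun variable_index :: "nat \<Rightarrow> gen \<Rightarrow> nat" where
  "variable_index n (Gs i) = i"
| "variable_index n (Gt i) = n - 1 + i"

definition gen_elt :: "nat \<Rightarrow> nat \<Rightarrow> gen \<Rightarrow> gen word set" where
  "gen_elt r n x = pres_class (imprim_gens n) (imprim_word_rels r n) [(x, True)]"

lemma variable_index_inj: "inj_on (variable_index n) (imprim_gens n)"
  by (auto simp: inj_on_def imprim_gens_def)

lemma variable_index_pos: "x \<in> imprim_gens n \<Longrightarrow> variable_index n x > 0"
  by (auto simp: imprim_gens_def)

lemma finite_imprim_gens: "finite (imprim_gens n)"
  by (simp add: imprim_gens_def)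

lemma rep_pencil_entry:
  assumes "j < d" "k < d"
  shows "rep_pencil r n d \<rho> $$ (j, k) = poly_var 0 * 1\<^sub>m d $$ (j, k) +
    (\<Sum>x\<in>imprim_gens n. poly_var (variable_index n x) * poly_const (\<rho> (gen_elt r n x) $$ (j, k)))"
proof -
  have "(\<Sum>x\<in>imprim_gens n. poly_var (variable_index n x) * poly_const (\<rho> (gen_elt r n x) $$ (j, k))) =
      (\<Sum>x\<in>Gs ` {1..n-1}. poly_var (variable_index n x) * poly_const (\<rho> (gen_elt r n x) $$ (j, k))) +
      (\<Sum>x\<in>Gt ` {1..n}. poly_var (variable_index n x) * poly_const (\<rho> (gen_elt r n x) $$ (j, k)))"
    unfolding imprim_gens_def by (rule sum.union_disjoint) auto
  also have "\<dots> = (\<Sum>i = 1..n-1. poly_var i * poly_const (\<rho> (s_elt r n i) $$ (j, k))) +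
      (\<Sum>i = 1..n. poly_var (n - 1 + i) * poly_const (\<rho> (t_elt r n i) $$ (j, k)))"
    by (simp add: sum.reindex inj_on_def gen_elt_def s_elt_def t_elt_def)
  finally show ?thesis
    using assms by (simp add: rep_pencil_def add.assoc)
qed

lemma rep_pencil_carrier: "rep_pencil r n d \<rho> \<in> carrier_mat d d"
  by (simp add: rep_pencil_def)

lemma eval_rep_charpoly:
  assumes "\<And>x. x \<in> imprim_gens n \<Longrightarrow> \<rho> (gen_elt r n x) \<in> carrier_mat d d"
  shows "cpoly_eval f (rep_charpoly r n d \<rho>) = det (f 0 \<cdot>\<^sub>m 1\<^sub>m d +
    mat_sum d d (imprim_gens n) (\<lambda>x. f (variable_index n x) \<cdot>\<^sub>m \<rho> (gen_elt r n x)))"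
proof -
  interpret comm_ring_hom "cpoly_eval f" by (rule cpoly_eval_hom)
  have "map_mat (cpoly_eval f) (rep_pencil r n d \<rho>) = f 0 \<cdot>\<^sub>m 1\<^sub>m d +
    mat_sum d d (imprim_gens n) (\<lambda>x. f (variable_index n x) \<cdot>\<^sub>m \<rho> (gen_elt r n x))" (is "?L = ?R")
  proof (rule eq_matI)
    fix j k assume "j < dim_row ?R" "k < dim_col ?R"
    then have jk: "j < d" "k < d" by (auto simp: mat_sum_def)
    have "?L $$ (j, k) = f 0 * 1\<^sub>m d $$ (j, k) +
        (\<Sum>x\<in>imprim_gens n. f (variable_index n x) * \<rho> (gen_elt r n x) $$ (j, k))"
      using jk rep_pencil_carrier[of r n d \<rho>]
      by (simp add: rep_pencil_entry cpoly_eval_add cpoly_eval_sum cpoly_eval_mult cpoly_eval_var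
        cpoly_eval_const)
    also have "(\<Sum>x\<in>imprim_gens n. f (variable_index n x) * \<rho> (gen_elt r n x) $$ (j, k)) =
        (\<Sum>x\<in>imprim_gens n. (f (variable_index n x) \<cdot>\<^sub>m \<rho> (gen_elt r n x)) $$ (j, k))"
      using jk by (intro sum.cong refl) (auto dest!: assms)
    finally show "?L $$ (j, k) = ?R $$ (j, k)" using jk by (simp add: mat_sum_def)
  qed (auto simp: mat_sum_def rep_pencil_def)
  then show ?thesis by (simp add: rep_charpoly_def flip: hom_det)
qed

text \<open>The constant matrix \<open>P\<close> intertwines the two pencils over the polynomial ring, and its determinant can
be cancelled there.\<close>

lemma rep_charpoly_eq_of_intertwiner:
  assumes \<rho>: "\<And>x. x \<in> imprim_gens n \<Longrightarrow> \<rho>\<^sub>1 (gen_elt r n x) \<in> carrier_mat d d"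
    "\<And>x. x \<in> imprim_gens n \<Longrightarrow> \<rho>\<^sub>2 (gen_elt r n x) \<in> carrier_mat d d"
    and P: "P \<in> carrier_mat d d" "det P \<noteq> 0"
    and inter: "\<And>x. x \<in> imprim_gens n \<Longrightarrow> P * \<rho>\<^sub>1 (gen_elt r n x) = \<rho>\<^sub>2 (gen_elt r n x) * P"
  shows "rep_charpoly r n d \<rho>\<^sub>1 = rep_charpoly r n d \<rho>\<^sub>2"
proof -
  interpret C: inj_comm_ring_hom poly_const by (rule poly_const_hom)
  let ?P = "map_mat poly_const P" and ?A = "rep_pencil r n d \<rho>\<^sub>1" and ?B = "rep_pencil r n d \<rho>\<^sub>2"
  let ?X = "imprim_gens n" and ?v = "\<lambda>x. poly_var (variable_index n x)"
  have Pc: "?P \<in> carrier_mat d d" using P by simp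
  have entry: "(A * B) $$ (j, k) = (\<Sum>l<d. A $$ (j, l) * B $$ (l, k))"
    if "A \<in> carrier_mat d d" "B \<in> carrier_mat d d" "j < d" "k < d" for A B :: "'z :: comm_ring_1 mat" and j k
    using that by (auto simp: scalar_prod_def atLeast0LessThan)
  have "?P * ?A = ?B * ?P"
  proof (rule eq_matI)
    fix j k assume "j < dim_row (?B * ?P)" "k < dim_col (?B * ?P)"
    then have jk: "j < d" "k < d" using P by (auto simp: rep_pencil_def)
    have "(?P * ?A) $$ (j, k) = (\<Sum>l<d. ?P $$ (j, l) * ?A $$ (l, k))"
      by (rule entry[OF Pc rep_pencil_carrier jk])
    also have "\<dots> = (\<Sum>l<d. poly_var 0 * (poly_const (P $$ (j, l)) * 1\<^sub>m d $$ (l, k)) +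
        (\<Sum>x\<in>?X. ?v x * poly_const (P $$ (j, l) * \<rho>\<^sub>1 (gen_elt r n x) $$ (l, k))))"
      using jk P by (intro sum.cong refl) (simp add: rep_pencil_entry distrib_left sum_distrib_left
          C.hom_mult mult_ac)
    also have "\<dots> = poly_var 0 * (\<Sum>l<d. poly_const (P $$ (j, l)) * 1\<^sub>m d $$ (l, k)) +
        (\<Sum>x\<in>?X. ?v x * poly_const (\<Sum>l<d. P $$ (j, l) * \<rho>\<^sub>1 (gen_elt r n x) $$ (l, k)))"
      by (simp add: sum.distrib sum_distrib_left C.hom_sum) (rule sum.swap)
    also have "(\<Sum>l<d. poly_const (P $$ (j, l)) * 1\<^sub>m d $$ (l, k)) = poly_const (P $$ (j, k))"
      using jk by (simp add: if_distrib[where f = "\<lambda>z. _ * z"] cong: if_cong)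
    also have "\<dots> = (\<Sum>l<d. 1\<^sub>m d $$ (j, l) * poly_const (P $$ (l, k)))"
      using jk by (simp add: if_distrib[where f = "\<lambda>z. z * _"] cong: if_cong)
    also have "(\<Sum>x\<in>?X. ?v x * poly_const (\<Sum>l<d. P $$ (j, l) * \<rho>\<^sub>1 (gen_elt r n x) $$ (l, k))) =
        (\<Sum>x\<in>?X. ?v x * poly_const (\<Sum>l<d. \<rho>\<^sub>2 (gen_elt r n x) $$ (j, l) * P $$ (l, k)))"
    proof (intro sum.cong refl)
      fix x assume x: "x \<in> ?X"
      show "?v x * poly_const (\<Sum>l<d. P $$ (j, l) * \<rho>\<^sub>1 (gen_elt r n x) $$ (l, k)) =
          ?v x * poly_const (\<Sum>l<d. \<rho>\<^sub>2 (gen_elt r n x) $$ (j, l) * P $$ (l, k))"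
        using inter[OF x] entry[OF P(1) \<rho>(1)[OF x] jk] entry[OF \<rho>(2)[OF x] P(1) jk] by simp
    qed
    also have "poly_var 0 * (\<Sum>l<d. 1\<^sub>m d $$ (j, l) * poly_const (P $$ (l, k))) + \<dots> =
        (\<Sum>l<d. poly_var 0 * (1\<^sub>m d $$ (j, l) * poly_const (P $$ (l, k))) +
        (\<Sum>x\<in>?X. ?v x * poly_const (\<rho>\<^sub>2 (gen_elt r n x) $$ (j, l) * P $$ (l, k))))"
      by (simp add: sum.distrib sum_distrib_left C.hom_sum) (rule sum.swap)
    also have "\<dots> = (\<Sum>l<d. ?B $$ (j, l) * ?P $$ (l, k))"
      using jk P by (intro sum.cong refl) (simp add: rep_pencil_entry algebra_simps sum_distrib_left sum_distrib_right
          C.hom_mult)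
    also have "\<dots> = (?B * ?P) $$ (j, k)"
      by (rule entry[OF rep_pencil_carrier Pc jk, symmetric])
    finally show "(?P * ?A) $$ (j, k) = (?B * ?P) $$ (j, k)" .
  qed (use P in \<open>auto simp: rep_pencil_def\<close>)
  then have "det ?P * det ?A = det ?B * det ?P"
    using det_mult[OF Pc rep_pencil_carrier] det_mult[OF rep_pencil_carrier Pc] by metis
  moreover have "det ?P \<noteq> 0" using P(2) by simp
  ultimately show ?thesis by (simp add: rep_charpoly_def mult.commute)
qed

section \<open>The presented group satisfies the relations\<close>

text \<open>Outside the generating set the value \<open>\<one>\<close> is chosen; this makes the map total and gives the letter
\<open>s\<^sub>n\<close> its trivial value.\<close>

definition gen_ext :: "nat \<Rightarrow> nat \<Rightarrow> gen \<Rightarrow> gen word set" where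
  "gen_ext r n x = (if x \<in> imprim_gens n then gen_elt r n x else \<one>\<^bsub>imprim_group r n\<^esub>)"

lemma group_imprim_group: "group (imprim_group r n)"
  unfolding imprim_group_def by (rule group_presented_group)

lemma gen_ext_closed: "gen_ext r n x \<in> carrier (imprim_group r n)"
proof (cases "x \<in> imprim_gens n")
  case True
  then show ?thesis
    by (auto simp: gen_ext_def gen_elt_def imprim_group_def carrier_presented_group words_def)
next
  case False
  interpret group "imprim_group r n" by (rule group_imprim_group)
  show ?thesis using False by (simp add: gen_ext_def)
qed

lemma one_imprim_group:
  "\<one>\<^bsub>imprim_group r n\<^esub> = pres_class (imprim_gens n) (imprim_word_rels r n) []"
  by (simp add: imprim_group_def one_presented_group)

lemma mult_imprim_group:
  assumes "u \<in> words (imprim_gens n)" "v \<in> words (imprim_gens n)"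
  shows "pres_class (imprim_gens n) (imprim_word_rels r n) u \<otimes>\<^bsub>imprim_group r n\<^esub>
      pres_class (imprim_gens n) (imprim_word_rels r n) v =
    pres_class (imprim_gens n) (imprim_word_rels r n) (u @ v)"
  unfolding imprim_group_def by (rule mult_presented_group[OF assms])

lemma word_prod_pos_word:
  assumes "u \<in> lists (imprim_gens n)"
  shows "monoid.word_prod (imprim_group r n) (gen_ext r n) u =
    pres_class (imprim_gens n) (imprim_word_rels r n) (pos_word u)"
proof -
  interpret group "imprim_group r n" by (rule group_imprim_group)
  show ?thesis using assms
  proof (induction u)
    case Nil
    show ?case by (simp add: one_imprim_group pos_word_def)
  next
    case (Cons x u)
    have "pos_word u \<in> words (imprim_gens n)" "[(x, True)] \<in> words (imprim_gens n)"
      using Cons by (auto simp: pos_word_def words_def)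
    from mult_imprim_group[OF this(2,1), of r] show ?case
      using Cons by (simp add: gen_ext_def[of r n x] gen_elt_def pos_word_def)
  qed
qed

lemma word_prod_relation:
  assumes "(u, v) \<in> imprim_rels r n" "u \<in> lists (imprim_gens n)" "v \<in> lists (imprim_gens n)"
  shows "monoid.word_prod (imprim_group r n) (gen_ext r n) u =
    monoid.word_prod (imprim_group r n) (gen_ext r n) v"
proof -
  have w: "pos_word u \<in> words (imprim_gens n)" "pos_word v \<in> words (imprim_gens n)"
    using assms(2,3) by (auto simp: pos_word_def words_def)
  have "(pos_word u, pos_word v) \<in> imprim_word_rels r n"
    unfolding imprim_word_rels_def using assms(1) by force
  then have "(pos_word u, pos_word v) \<in> pres_rel (imprim_gens n) (imprim_word_rels r n)"
    using w by (intro pres_rel.pres_rel)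
  then show ?thesis
    using assms w by (simp add: word_prod_pos_word pres_class_eq_iff)
qed

text \<open>Two points need an argument. The relation expressing \<open>t\<^sub>i\<close> through \<open>t\<^sub>n\<close> is turned into the recursion
\<open>t\<^sub>i = s\<^sub>i t\<^sub>i\<^sub>+\<^sub>1 s\<^sub>i\<close>, and inverse letters are replaced by positive powers, since the
generators have finite order.\<close>

lemma imprim_group_relations:
  assumes "r > 0"
  shows "imprimitive_relations (imprim_group r n) n r (gen_ext r n)"
proof -
  interpret group "imprim_group r n" by (rule group_imprim_group)
  let ?\<phi> = "gen_ext r n" and ?G = "imprim_group r n"
  have cl [simp]: "?\<phi> x \<in> carrier ?G" for x by (rule gen_ext_closed)
  note rel = word_prod_relation[of _ _ r n]
  have sq: "?\<phi> (Gs i) \<otimes>\<^bsub>?G\<^esub> ?\<phi> (Gs i) = \<one>\<^bsub>?G\<^esub>" if "1 \<le> i" "i < n" for i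
    using rel[of "[Gs i, Gs i]" "[]"] that by (fastforce simp: imprim_rels_def)
  have tp: "?\<phi> (Gt j) [^]\<^bsub>?G\<^esub> r = \<one>\<^bsub>?G\<^esub>" if "1 \<le> j" "j \<le> n" for j
  proof -
    have "(replicate r (Gt j), []) \<in> imprim_rels r n" using that by (fastforce simp: imprim_rels_def)
    from rel[OF this] show ?thesis using that by (simp add: word_prod_replicate in_lists_conv_set)
  qed
  have tc: "?\<phi> (Gt i) = ?\<phi> (Gs i) \<otimes>\<^bsub>?G\<^esub> ?\<phi> (Gt (i + 1)) \<otimes>\<^bsub>?G\<^esub> ?\<phi> (Gs i)"
    if i: "1 \<le> i" "i < n" for i
  proof -
    let ?W = "\<lambda>i. map Gs [i..<n] @ [Gt n] @ rev (map Gs [i..<n])"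
    have t: "?\<phi> (Gt j) = word_prod ?\<phi> (?W j)" if j: "1 \<le> j" "j \<le> n" for j
    proof (cases "j = n")
      case False
      then have "([Gt j], ?W j) \<in> imprim_rels r n" using j by (fastforce simp: imprim_rels_def)
      from rel[OF this] show ?thesis using j by (auto simp: in_lists_conv_set)
    qed auto
    have "?W i = Gs i # ?W (i + 1) @ [Gs i]" using i by (simp add: upt_conv_Cons)
    then have "?\<phi> (Gt i) = word_prod ?\<phi> (Gs i # ?W (i + 1) @ [Gs i])" using t[of i] i by simp
    also have "\<dots> = ?\<phi> (Gs i) \<otimes>\<^bsub>?G\<^esub> (word_prod ?\<phi> (?W (i + 1)) \<otimes>\<^bsub>?G\<^esub> ?\<phi> (Gs i))"
      using word_prod_append[of ?\<phi> "?W (i + 1)" "[Gs i]", OF cl] by simp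
    also have "word_prod ?\<phi> (?W (i + 1)) = ?\<phi> (Gt (i + 1))" using t[of "i + 1"] i by simp
    finally show ?thesis by (simp add: m_assoc)
  qed
  have gen: "carrier ?G = word_prod ?\<phi> ` lists (imprim_gens n)"
  proof
    show "word_prod ?\<phi> ` lists (imprim_gens n) \<subseteq> carrier ?G" by auto
    let ?cls = "pres_class (imprim_gens n) (imprim_word_rels r n)"
    have letter: "\<exists>v\<in>lists (imprim_gens n). ?cls [(x, b)] = word_prod ?\<phi> v"
      if x: "x \<in> imprim_gens n" for x b
    proof (cases b)
      case True
      have "[x] \<in> lists (imprim_gens n)" using x by simp
      moreover from word_prod_pos_word[OF this, of r] have "?cls [(x, b)] = word_prod ?\<phi> [x]"
        using True unfolding pos_word_def by (simp del: word_prod_simps)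
      ultimately show ?thesis by blast
    next
      case False
      have w: "[(x, False)] \<in> words (imprim_gens n)" "[(x, True)] \<in> words (imprim_gens n)"
        using x by (auto simp: words_def)
      have "?cls [(x, False)] \<otimes>\<^bsub>?G\<^esub> ?\<phi> x = ?cls [(x, False), (x, True)]"
        using mult_imprim_group[OF w, of r] x by (simp add: gen_ext_def gen_elt_def)
      also have "\<dots> = ?cls []"
        using pres_rel.pres_cancel[OF x, of False "imprim_word_rels r n"] x
        by (subst pres_class_eq_iff) (auto simp: words_def)
      finally have inv: "?cls [(x, False)] \<otimes>\<^bsub>?G\<^esub> ?\<phi> x = \<one>\<^bsub>?G\<^esub>"
        by (simp add: one_imprim_group)
      have car: "?cls [(x, False)] \<in> carrier ?G"
        using w by (auto simp: imprim_group_def carrier_presented_group)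
      have "\<exists>k. ?\<phi> x [^]\<^bsub>?G\<^esub> (k :: nat) \<otimes>\<^bsub>?G\<^esub> ?\<phi> x = \<one>\<^bsub>?G\<^esub>"
      proof (cases x)
        case (Gs i)
        then show ?thesis using sq[of i] x by (intro exI[of _ 1]) simp
      next
        case (Gt j)
        then have "?\<phi> x [^]\<^bsub>?G\<^esub> Suc (r - 1) = \<one>\<^bsub>?G\<^esub>" using tp[of j] x assms by simp
        then show ?thesis by (intro exI[of _ "r - 1"]) simp
      qed
      then obtain k :: nat where k: "?\<phi> x [^]\<^bsub>?G\<^esub> k \<otimes>\<^bsub>?G\<^esub> ?\<phi> x = \<one>\<^bsub>?G\<^esub>" by blast
      have "?cls [(x, False)] = inv\<^bsub>?G\<^esub> ?\<phi> x"
        by (rule inv_equality[OF inv cl car, symmetric])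
      moreover have "?\<phi> x [^]\<^bsub>?G\<^esub> k = inv\<^bsub>?G\<^esub> ?\<phi> x"
        by (rule inv_equality[OF k cl, symmetric]) simp
      ultimately have "?cls [(x, b)] = word_prod ?\<phi> (replicate k x)"
        using False by (simp add: word_prod_replicate)
      moreover have "replicate k x \<in> lists (imprim_gens n)"
        using x by (auto simp: in_lists_conv_set)
      ultimately show ?thesis by blast
    qed
    have "?cls w \<in> word_prod ?\<phi> ` lists (imprim_gens n)" if "w \<in> words (imprim_gens n)" for w
      using that
    proof (induction w)
      case Nil
      then show ?case
        by (intro image_eqI[of _ _ "[]"]) (auto simp: one_imprim_group)
    next
      case (Cons l w)
      obtain x b where l: "l = (x, b)" by (cases l)
      have w: "w \<in> words (imprim_gens n)" "[(x, b)] \<in> words (imprim_gens n)" "x \<in> imprim_gens n"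
        using Cons.prems by (auto simp: words_def l)
      obtain v where v: "v \<in> lists (imprim_gens n)" "?cls [(x, b)] = word_prod ?\<phi> v"
        using letter[OF w(3)] by blast
      obtain v' where v': "v' \<in> lists (imprim_gens n)" "?cls w = word_prod ?\<phi> v'"
        using Cons.IH[OF w(1)] by blast
      have "?cls (l # w) = ?cls [(x, b)] \<otimes>\<^bsub>?G\<^esub> ?cls w"
        using mult_imprim_group[OF w(2,1), of r] by (simp add: l)
      also have "\<dots> = word_prod ?\<phi> (v @ v')" by (simp add: v v' word_prod_append)
      finally show ?case using v v' by (intro image_eqI[of _ _ "v @ v'"]) auto
    qed
    then show "carrier ?G \<subseteq> word_prod ?\<phi> ` lists (imprim_gens n)"
      by (auto simp: imprim_group_def carrier_presented_group)
  qed
  show ?thesis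
  proof
    show "r > 0" by fact
    show "commute (?\<phi> (Gs i)) (?\<phi> (Gs j))" if "1 \<le> i" "i + 1 < j" "j < n" for i j
    proof -
      have "([Gs i, Gs j], [Gs j, Gs i]) \<in> imprim_rels r n"
        using that by (fastforce simp: imprim_rels_def)
      from rel[OF this] show ?thesis using that by (simp add: commute_def)
    qed
    show "?\<phi> (Gs i) \<otimes>\<^bsub>?G\<^esub> ?\<phi> (Gs (i + 1)) \<otimes>\<^bsub>?G\<^esub> ?\<phi> (Gs i) =
        ?\<phi> (Gs (i + 1)) \<otimes>\<^bsub>?G\<^esub> ?\<phi> (Gs i) \<otimes>\<^bsub>?G\<^esub> ?\<phi> (Gs (i + 1))" if "1 \<le> i" "i + 1 < n" for i
    proof -
      have "([Gs i, Gs (i+1), Gs i], [Gs (i+1), Gs i, Gs (i+1)]) \<in> imprim_rels r n"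
        using that by (fastforce simp: imprim_rels_def)
      from rel[OF this] show ?thesis using that by (simp add: m_assoc)
    qed
    show "commute (?\<phi> (Gt (n - 1))) (?\<phi> (Gt n))" if "2 \<le> n"
    proof -
      have "([Gs (n-1), Gt n, Gs (n-1), Gt n], [Gt n, Gs (n-1), Gt n, Gs (n-1)]) \<in> imprim_rels r n"
        using that by (simp add: imprim_rels_def)
      from rel[OF this] show ?thesis
        using that tc[of "n - 1"] by (simp add: commute_def m_assoc)
    qed
    show "commute (?\<phi> (Gs i)) (?\<phi> (Gt n))" if "1 \<le> i" "i + 1 < n" for i
    proof -
      have "([Gs i, Gt n], [Gt n, Gs i]) \<in> imprim_rels r n"
        using that by (fastforce simp: imprim_rels_def)
      from rel[OF this] show ?thesis using that by (simp add: commute_def)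
    qed
    show "?\<phi> (Gs n) = \<one>\<^bsub>?G\<^esub>" by (simp add: gen_ext_def)
  qed (fact cl sq tp tc gen)+
qed

section \<open>The characteristic polynomial determines the representation\<close>

text \<open>The variable of the generator with number \<open>i\<close> is specialised to \<open>y\<close> to the power \<open>N\<^sup>i\<close>, where
\<open>N = length w + 1\<close>. In the expansion of the power with exponent \<open>length w\<close>, the words whose
monomial equals that of \<open>w\<close> are then exactly the rearrangements of \<open>w\<close>.\<close>

lemma character_sums_eq:
  assumes \<rho>: "is_rep (imprim_group r n) d \<rho>\<^sub>1" "is_rep (imprim_group r n) d \<rho>\<^sub>2"
    and eq: "rep_charpoly r n d \<rho>\<^sub>1 = rep_charpoly r n d \<rho>\<^sub>2"
    and w: "set w \<subseteq> imprim_gens n"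
  shows "(\<Sum>u | mset u = mset w. mtrace (\<rho>\<^sub>1 (monoid.word_prod (imprim_group r n) (gen_ext r n) u))) =
    (\<Sum>u | mset u = mset w. mtrace (\<rho>\<^sub>2 (monoid.word_prod (imprim_group r n) (gen_ext r n) u)))"
proof -
  interpret group "imprim_group r n" by (rule group_imprim_group)
  let ?X = "imprim_gens n" and ?k = "length w" and ?\<phi> = "gen_ext r n"
  define wt where "wt u = (\<Sum>x\<leftarrow>u. Suc ?k ^ variable_index n x)" for u
  have car: "\<rho>\<^sub>1 g \<in> carrier_mat d d" "\<rho>\<^sub>2 g \<in> carrier_mat d d" if "g \<in> carrier (imprim_group r n)" for g
    using \<rho> that by (auto simp: is_rep_iff[OF is_group])
  have ext: "gen_elt r n x = ?\<phi> x" if "x \<in> ?X" for x using that by (simp add: gen_ext_def)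
  have expand: "mtrace (mat_sum d d ?X (\<lambda>x. y ^ (Suc ?k ^ variable_index n x) \<cdot>\<^sub>m \<rho> (gen_elt r n x)) ^\<^sub>m ?k) =
      (\<Sum>u\<in>lists_of_length ?X ?k. y ^ wt u * mtrace (\<rho> (word_prod ?\<phi> u)))"
    if rep: "is_rep (imprim_group r n) d \<rho>" for \<rho> y
  proof -
    have c: "\<rho> g \<in> carrier_mat d d" if "g \<in> carrier (imprim_group r n)" for g
      using rep that by (auto simp: is_rep_iff[OF is_group])
    have pow: "prod_list (map (\<lambda>x. y ^ (Suc ?k ^ variable_index n x)) u) = y ^ wt u" for u
      by (induction u) (auto simp: wt_def power_add)
    have "mat_sum d d ?X (\<lambda>x. y ^ (Suc ?k ^ variable_index n x) \<cdot>\<^sub>m \<rho> (gen_elt r n x)) =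
        mat_sum d d ?X (\<lambda>x. y ^ (Suc ?k ^ variable_index n x) \<cdot>\<^sub>m \<rho> (?\<phi> x))"
      by (intro mat_sum_cong) (simp add: ext)
    then have "mat_sum d d ?X (\<lambda>x. y ^ (Suc ?k ^ variable_index n x) \<cdot>\<^sub>m \<rho> (gen_elt r n x)) ^\<^sub>m ?k =
        mat_sum d d (lists_of_length ?X ?k) (\<lambda>u. y ^ wt u \<cdot>\<^sub>m \<rho> (word_prod ?\<phi> u))"
      using rep_pow_expand[OF rep, of ?\<phi> ?X "\<lambda>x. y ^ (Suc ?k ^ variable_index n x)" ?k] gen_ext_closed[of r n]
      by (simp add: pow)
    moreover have "mtrace \<dots> = (\<Sum>u\<in>lists_of_length ?X ?k. y ^ wt u * mtrace (\<rho> (word_prod ?\<phi> u)))"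
      by (intro mtrace_mat_sum c word_prod_closed gen_ext_closed)
    ultimately show ?thesis by simp
  qed
  have sums: "(\<Sum>u\<in>lists_of_length ?X ?k. y ^ wt u * mtrace (\<rho>\<^sub>1 (word_prod ?\<phi> u))) =
      (\<Sum>u\<in>lists_of_length ?X ?k. y ^ wt u * mtrace (\<rho>\<^sub>2 (word_prod ?\<phi> u)))" for y
  proof -
    have "det (x \<cdot>\<^sub>m 1\<^sub>m d + mat_sum d d ?X (\<lambda>x. y ^ (Suc ?k ^ variable_index n x) \<cdot>\<^sub>m \<rho>\<^sub>1 (gen_elt r n x))) =
        det (x \<cdot>\<^sub>m 1\<^sub>m d + mat_sum d d ?X (\<lambda>x. y ^ (Suc ?k ^ variable_index n x) \<cdot>\<^sub>m \<rho>\<^sub>2 (gen_elt r n x)))" for x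
    proof -
      define f where "f i = (if i = 0 then x else y ^ (Suc ?k ^ i))" for i :: nat
      have f: "f 0 = x" "\<And>z. z \<in> ?X \<Longrightarrow> f (variable_index n z) = y ^ (Suc ?k ^ variable_index n z)"
        by (auto simp: f_def dest: variable_index_pos)
      have ev: "cpoly_eval f (rep_charpoly r n d \<rho>) =
          det (x \<cdot>\<^sub>m 1\<^sub>m d + mat_sum d d ?X (\<lambda>x. y ^ (Suc ?k ^ variable_index n x) \<cdot>\<^sub>m \<rho> (gen_elt r n x)))"
        if "\<And>g. g \<in> carrier (imprim_group r n) \<Longrightarrow> \<rho> g \<in> carrier_mat d d" for \<rho>
        using eval_rep_charpoly[of n \<rho> r d f] that gen_ext_closed[of r n] f
        by (simp add: ext cong: mat_sum_cong)
      show ?thesis using ev[of \<rho>\<^sub>1] ev[of \<rho>\<^sub>2] car eq by simp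
    qed
    from mtrace_pow_cong_det[OF mat_sum_carrier mat_sum_carrier this, of ?k] show ?thesis
      by (simp only: expand[OF \<rho>(1)] expand[OF \<rho>(2)])
  qed
  have fin: "finite (lists_of_length ?X ?k)"
    using finite_lists_length_eq[OF finite_imprim_gens, of n ?k] by (simp add: lists_of_length_def)
  have "{u. u \<in> lists_of_length ?X ?k \<and> wt u = wt w} = {u. mset u = mset w}"
  proof (intro equalityI subsetI)
    fix u assume "u \<in> {u. u \<in> lists_of_length ?X ?k \<and> wt u = wt w}"
    then show "u \<in> {u. mset u = mset w}"
      using kronecker_weight_inj[OF variable_index_inj, of u n w "Suc ?k"] w by (auto simp: lists_of_length_def wt_def)
  next
    fix u assume "u \<in> {u. mset u = mset w}"
    then have u: "mset u = mset w" by simp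
    have "wt u = sum_mset (image_mset (\<lambda>x. Suc ?k ^ variable_index n x) (mset u))" for u
      by (simp add: wt_def flip: sum_mset_sum_list)
    then have "wt u = wt w" using u by simp
    then show "u \<in> {u. u \<in> lists_of_length ?X ?k \<and> wt u = wt w}"
      using mset_eq_setD[OF u] mset_eq_length[OF u] w by (auto simp: lists_of_length_def)
  qed
  with graded_sum_eq[OF fin sums, of "wt w"] show ?thesis by simp
qed

theorem theorem3p6:
  fixes r n d\<^sub>1 d\<^sub>2 :: nat
    and \<rho>\<^sub>1 \<rho>\<^sub>2 :: "gen word set \<Rightarrow> complex mat"
  assumes "r > 0" and "n > 0"
    and "is_rep (imprim_group r n) d\<^sub>1 \<rho>\<^sub>1" and "is_rep (imprim_group r n) d\<^sub>2 \<rho>\<^sub>2"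
  shows "rep_charpoly r n d\<^sub>1 \<rho>\<^sub>1 = rep_charpoly r n d\<^sub>2 \<rho>\<^sub>2 \<longleftrightarrow>
    rep_equiv (imprim_group r n) d\<^sub>1 \<rho>\<^sub>1 d\<^sub>2 \<rho>\<^sub>2"
proof
  interpret imprimitive_relations "imprim_group r n" n r "gen_ext r n"
    by (rule imprim_group_relations[OF assms(1)])
  let ?G = "imprim_group r n" and ?\<phi> = "gen_ext r n"
  have elt: "gen_elt r n x \<in> carrier ?G" if "x \<in> imprim_gens n" for x
    using gen_ext_closed[of r n x] that by (simp add: gen_ext_def)
  note R = assms(3,4)[unfolded is_rep_iff[OF is_group]]
  {
    assume eq: "rep_charpoly r n d\<^sub>1 \<rho>\<^sub>1 = rep_charpoly r n d\<^sub>2 \<rho>\<^sub>2"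
    \<comment> \<open>At this point the characteristic polynomial has the value \<open>2\<^sup>d\<close>, so it determines the dimension.\<close>
    define f :: "nat \<Rightarrow> complex" where "f i = (if i = 0 then 2 else 0)" for i
    have ev: "cpoly_eval f (rep_charpoly r n d \<rho>) = 2 ^ d"
      if "\<And>g. g \<in> carrier ?G \<Longrightarrow> \<rho> g \<in> carrier_mat d d" for d \<rho>
    proof -
      have "mat_sum d d (imprim_gens n) (\<lambda>x. f (variable_index n x) \<cdot>\<^sub>m \<rho> (gen_elt r n x)) = 0\<^sub>m d d"
      proof (rule eq_matI)
        fix i j assume ij: "i < dim_row (0\<^sub>m d d :: complex mat)" "j < dim_col (0\<^sub>m d d :: complex mat)"
        have "(f (variable_index n x) \<cdot>\<^sub>m \<rho> (gen_elt r n x)) $$ (i, j) = 0" if "x \<in> imprim_gens n" for x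
          using \<open>\<And>g. g \<in> carrier ?G \<Longrightarrow> \<rho> g \<in> carrier_mat d d\<close>[OF elt[OF that]] variable_index_pos[OF that] ij
          by (auto simp: f_def)
        then show "mat_sum d d (imprim_gens n) (\<lambda>x. f (variable_index n x) \<cdot>\<^sub>m \<rho> (gen_elt r n x)) $$ (i, j) =
            0\<^sub>m d d $$ (i, j)"
          using ij by (simp add: mat_sum_def)
      qed (auto simp: mat_sum_def)
      then show ?thesis
        using eval_rep_charpoly[of n \<rho> r d f] that elt by (simp add: det_smult f_def)
    qed
    have "(2 :: complex) ^ d\<^sub>1 = 2 ^ d\<^sub>2"
      using ev[of \<rho>\<^sub>1 d\<^sub>1] ev[of \<rho>\<^sub>2 d\<^sub>2] R eq by simp
    then have "norm ((2 :: complex) ^ d\<^sub>1) = norm ((2 :: complex) ^ d\<^sub>2)" by simp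
    then have d: "d\<^sub>1 = d\<^sub>2" by (simp add: norm_power)
    define d where "d = d\<^sub>1"
    have rep: "is_rep ?G d \<rho>\<^sub>1" "is_rep ?G d \<rho>\<^sub>2" using assms d by (simp_all add: d_def)
    have eq': "rep_charpoly r n d \<rho>\<^sub>1 = rep_charpoly r n d \<rho>\<^sub>2" using eq d by (simp add: d_def)
    have car: "\<rho>\<^sub>1 g \<in> carrier_mat d d" "\<rho>\<^sub>2 g \<in> carrier_mat d d" if "g \<in> carrier ?G" for g
      using R d that by (auto simp: d_def)
    have class_fun: "mtrace (\<rho> (a \<otimes>\<^bsub>?G\<^esub> b)) = mtrace (\<rho> (b \<otimes>\<^bsub>?G\<^esub> a))"
      if "is_rep ?G d \<rho>" "a \<in> carrier ?G" "b \<in> carrier ?G" for \<rho> a b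
      using that mtrace_comm[of "\<rho> a" d d "\<rho> b"] by (simp add: is_rep_iff[OF is_group])
    have "mtrace (\<rho>\<^sub>1 g) = mtrace (\<rho>\<^sub>2 g)" if g: "g \<in> carrier ?G" for g
    proof -
      obtain z w where z: "z \<in> carrier ?G" and w: "block_word n w" and zw: "g \<otimes>\<^bsub>?G\<^esub> z = z \<otimes>\<^bsub>?G\<^esub> word_prod ?\<phi> w"
        using block_word_conjugate[of n g] g generated standard_subgroup_closed by (auto simp: standard_subgroup_def)
      have tr: "mtrace (\<rho> g) = mtrace (\<rho> (word_prod ?\<phi> w))" if rep: "is_rep ?G d \<rho>" for \<rho>
      proof -
        have "mtrace (\<rho> g) = mtrace (\<rho> ((g \<otimes>\<^bsub>?G\<^esub> z) \<otimes>\<^bsub>?G\<^esub> inv\<^bsub>?G\<^esub> z))" using g z by (simp add: m_assoc)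
        also have "\<dots> = mtrace (\<rho> (inv\<^bsub>?G\<^esub> z \<otimes>\<^bsub>?G\<^esub> (z \<otimes>\<^bsub>?G\<^esub> word_prod ?\<phi> w)))"
          unfolding zw using z by (intro class_fun[OF rep]) auto
        also have "inv\<^bsub>?G\<^esub> z \<otimes>\<^bsub>?G\<^esub> (z \<otimes>\<^bsub>?G\<^esub> word_prod ?\<phi> w) = word_prod ?\<phi> w"
          using z by (simp add: m_assoc[symmetric])
        finally show ?thesis .
      qed
      have const: "(\<Sum>u | mset u = mset w. mtrace (\<rho> (word_prod ?\<phi> u))) =
          of_nat (card {u. mset u = mset w}) * mtrace (\<rho> (word_prod ?\<phi> w))" if rep: "is_rep ?G d \<rho>" for \<rho>
      proof -
        have same: "mtrace (\<rho> (word_prod ?\<phi> u)) = mtrace (\<rho> (word_prod ?\<phi> w))" if "mset u = mset w" for u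
          by (rule class_function_block_word[where f = "\<lambda>g. mtrace (\<rho> g)", OF class_fun[OF rep] w that assms(2)])
        have "(\<Sum>u | mset u = mset w. mtrace (\<rho> (word_prod ?\<phi> u))) =
            (\<Sum>u | mset u = mset w. mtrace (\<rho> (word_prod ?\<phi> w)))"
          by (rule sum.cong[OF refl], rule same) (simp only: mem_Collect_eq)
        then show ?thesis by simp
      qed
      \<comment> \<open>The sum over rearrangements is a nonzero multiple of the value at \<open>w\<close> itself.\<close>
      have "card {u. mset u = mset w} \<noteq> 0"
        using mset_eq_finite[of w] by (auto simp: card_eq_0_iff)
      then show ?thesis
        using character_sums_eq[OF rep eq' block_word_content(1)[OF w]] const[OF rep(1)] const[OF rep(2)]
          tr[OF rep(1)] tr[OF rep(2)] by simp
    qed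
    from character_determines_rep[OF finite_carrier rep this]
    show "rep_equiv ?G d\<^sub>1 \<rho>\<^sub>1 d\<^sub>2 \<rho>\<^sub>2" using d by (simp add: d_def)
  next
    assume "rep_equiv ?G d\<^sub>1 \<rho>\<^sub>1 d\<^sub>2 \<rho>\<^sub>2"
    then obtain P where d: "d\<^sub>1 = d\<^sub>2" and P: "P \<in> carrier (GL d\<^sub>1)"
      and inter: "\<And>g. g \<in> carrier ?G \<Longrightarrow> P * \<rho>\<^sub>1 g = \<rho>\<^sub>2 g * P"
      by (auto simp: rep_equiv_def)
    have "rep_charpoly r n d\<^sub>1 \<rho>\<^sub>1 = rep_charpoly r n d\<^sub>1 \<rho>\<^sub>2"
      using P inter elt R d by (intro rep_charpoly_eq_of_intertwiner[of n \<rho>\<^sub>1 r d\<^sub>1 \<rho>\<^sub>2 P]) (auto simp: mem_GL)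
    then show "rep_charpoly r n d\<^sub>1 \<rho>\<^sub>1 = rep_charpoly r n d\<^sub>2 \<rho>\<^sub>2" using d by simp
  }
qed

end
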